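(* Let $t\in\mathbb R\setminus\{0\}$ and let $J\in\mathbb H_t^{n\times n}$ satisfy $J=J^{\circledast}=J^{-1}$. Let $R$ be an $\mathbb H_t^{n\times n}$-valued rational function regular at the origin, and let $R(x)=D+xC(I_{\mathbb H_t^N}-xA)^{-1}B$ be a minimal realization of $R$. Assume moreover that $R$ is analytic and invertible at infinity. Then $R$ satisfies $$R(x)JR(1/x)^{\circledast}=J$$ at those real points $x$ where both $R(x)$ and $R(1/x)$ are defined if and only if there exists an invertible matrix $H\in\mathbb H_t^{N\times N}$ with $H=H^{\circledast}$ such that $$\begin{pmatrix}A&B\\C&D\end{pmatrix}\begin{pmatrix}H^{-1}&0\\0&J\end{pmatrix}\begin{pmatrix}A&B\\C&D\end{pmatrix}^{\circledast}=\begin{pmatrix}H^{-1}&0\\0&J\end{pmatrix}.$$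
   Context: For real $t\neq 0$, $\mathbb H_t$ is the real associative algebra of elements $q=a+bj_t$ with $a,b\in\mathbb C$, where $\mathbb C\subset\mathbb H_t$, $j_t^2=t$ and $j_t a=\overline a\, j_t$ for $a\in\mathbb C$. For $q=a+bj_t$ set $q^{\circledast}=\overline a-bj_t$; for a matrix $M=(m_{jk})$ over $\mathbb H_t$, $M^{\circledast}$ is the matrix whose $(j,k)$ entry is $m_{kj}^{\circledast}$. $I_{\mathbb H_t^N}$ is the identity matrix in $\mathbb H_t^{N\times N}$. The variable $x$ is real. An $\mathbb H_t^{n\times n}$-valued function $R$ of the real variable $x$, defined at $x=0$ (regular at the origin), is rational if it can be written as $R(x)=D+xC(I_{\mathbb H_t^N}-xA)^{-1}B$ with $D=R(0)$ and $(C,A,B)\in\mathbb H_t^{n\times N}\times\mathbb H_t^{N\times N}\times\mathbb H_t^{N\times n}$ (a realization). The pair $(C,A)$ is observable if for $h\in\mathbb H_t^N$: $C(I_{\mathbb H_t^N}-xA)^{-1}h=0$ for all $x$ in some interval $(-\varepsilon,\varepsilon)$ if and only if $h=0$. The pair $(A,B)$ is controllable if for $h\in\mathbb H_t^{1\times N}$: $hA^kB=0$ for all $k=0,1,2,\ldots$ if and only if $h=0$. The realization is minimal if $(C,A)$ is observable and $(A,B)$ is controllable. "Analytic and invertible at infinity" means that $x\mapsto R(1/x)$ extends analytically to a neighborhood of $x=0$ and its value $R(\infty)$ at $0$ is invertible in $\mathbb H_t^{n\times n}$. *)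

theory Defs
  imports "HOL-Analysis.Product_Vector" "Jordan_Normal_Form.Matrix"
begin

text \<open>
  The pair \<open>(a, b)\<close> stands for \<open>a + b j\<^sub>t\<close>. The additive, real-vector-space and topological
  structure does not depend on \<open>t\<close> and is the one of \<open>complex \<times> complex\<close>; only the
  multiplication depends on \<open>t\<close>, which is therefore an explicit argument.
\<close>

type_synonym ht = "complex \<times> complex"

definition ht_mult :: "real \<Rightarrow> ht \<Rightarrow> ht \<Rightarrow> ht" where
  "ht_mult t p q =
     (fst p * fst q + of_real t * snd p * cnj (snd q), fst p * snd q + snd p * cnj (fst q))"

definition ht_of_complex :: "complex \<Rightarrow> ht" where
  "ht_of_complex a = (a, 0)"

definition ht_j :: ht where
  "ht_j = (0, 1)"

definition ht_conj :: "ht \<Rightarrow> ht" where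
  "ht_conj q = (cnj (fst q), - snd q)"

text \<open>The product of \<open>\<bbbH>\<^sub>t\<close> is determined by the following properties and bilinearity.\<close>

lemma ht_decomp: "(a, b) = ht_of_complex a + ht_mult t (ht_of_complex b) ht_j"
  by (simp add: ht_mult_def ht_of_complex_def ht_j_def)

lemma ht_mult_of_complex:
  "ht_mult t (ht_of_complex a) (ht_of_complex b) = ht_of_complex (a * b)"
  by (simp add: ht_mult_def ht_of_complex_def)

lemma ht_j_square: "ht_mult t ht_j ht_j = ht_of_complex (of_real t)"
  by (simp add: ht_mult_def ht_of_complex_def ht_j_def)

lemma ht_j_commute: "ht_mult t ht_j (ht_of_complex a) = ht_mult t (ht_of_complex (cnj a)) ht_j"
  by (simp add: ht_mult_def ht_of_complex_def ht_j_def)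

lemma ht_mult_assoc: "ht_mult t (ht_mult t p q) r = ht_mult t p (ht_mult t q r)"
  by (simp add: ht_mult_def algebra_simps)


text \<open>
  Matrices are those of \<open>Jordan_Normal_Form\<close>; sums, differences, zero matrices and block
  matrices are taken from there, whereas its product, identity and inverse require a
  multiplication given by a type class and are replaced by versions depending on \<open>t\<close>.
\<close>

definition ht_mat_mult :: "ht mat \<Rightarrow> real \<Rightarrow> ht mat \<Rightarrow> ht mat"
    (\<open>(_ \<star>\<^bsub>_\<^esub> _)\<close> [70, 0, 71] 70) where
  "M \<star>\<^bsub>t\<^esub> P =
     mat (dim_row M) (dim_col P) (\<lambda>(i, k). \<Sum>l<dim_col M. ht_mult t (M $$ (i, l)) (P $$ (l, k)))"

definition ht_one_mat :: "nat \<Rightarrow> ht mat" where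
  "ht_one_mat n = mat n n (\<lambda>(i, k). if i = k then ht_of_complex 1 else 0)"

definition ht_scale_mat :: "real \<Rightarrow> ht mat \<Rightarrow> ht mat" where
  "ht_scale_mat x M = map_mat (\<lambda>q. x *\<^sub>R q) M"

definition ht_adj :: "ht mat \<Rightarrow> ht mat" where
  "ht_adj M = map_mat ht_conj (transpose_mat M)"

fun ht_mat_pow :: "real \<Rightarrow> ht mat \<Rightarrow> nat \<Rightarrow> ht mat" where
  "ht_mat_pow t A 0 = ht_one_mat (dim_row A)"
| "ht_mat_pow t A (Suc k) = ht_mat_pow t A k \<star>\<^bsub>t\<^esub> A"

definition ht_is_inverse :: "real \<Rightarrow> nat \<Rightarrow> ht mat \<Rightarrow> ht mat \<Rightarrow> bool" where
  "ht_is_inverse t n M P \<longleftrightarrow>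
     M \<in> carrier_mat n n \<and> P \<in> carrier_mat n n \<and>
     M \<star>\<^bsub>t\<^esub> P = ht_one_mat n \<and> P \<star>\<^bsub>t\<^esub> M = ht_one_mat n"

definition ht_invertible :: "real \<Rightarrow> nat \<Rightarrow> ht mat \<Rightarrow> bool" where
  "ht_invertible t n M \<longleftrightarrow> (\<exists>P. ht_is_inverse t n M P)"

text \<open>Unspecified if the matrix is not invertible.\<close>

definition ht_inverse :: "real \<Rightarrow> nat \<Rightarrow> ht mat \<Rightarrow> ht mat" where
  "ht_inverse t n M = (THE P. ht_is_inverse t n M P)"


definition pencil :: "nat \<Rightarrow> ht mat \<Rightarrow> real \<Rightarrow> ht mat" where
  "pencil N A x = ht_one_mat N - ht_scale_mat x A"

text \<open>
  A function that need not be defined on the whole real line is given by its domain \<open>S\<close> and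
  by \<open>R\<close>, whose values outside \<open>S\<close> are irrelevant. A realization represents \<open>R\<close> wherever
  \<open>I - x A\<close> is invertible. As a realization may have removable singularities, \<open>S\<close> may be larger
  than that set; the continuity requirement in \<open>rational_at_origin\<close> below then determines
  the values at the (finitely many) remaining points.
\<close>

definition realization ::
  "real \<Rightarrow> nat \<Rightarrow> nat \<Rightarrow> real set \<Rightarrow> (real \<Rightarrow> ht mat) \<Rightarrow>
   ht mat \<Rightarrow> ht mat \<Rightarrow> ht mat \<Rightarrow> ht mat \<Rightarrow> bool" where
  "realization t n N S R A B C D \<longleftrightarrow>
     A \<in> carrier_mat N N \<and> B \<in> carrier_mat N n \<and> C \<in> carrier_mat n N \<and> D \<in> carrier_mat n n \<and>
     D = R 0 \<and>
     (\<forall>x. ht_invertible t N (pencil N A x) \<longrightarrow>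
        x \<in> S \<and>
        R x = D + ht_scale_mat x (C \<star>\<^bsub>t\<^esub> ht_inverse t N (pencil N A x) \<star>\<^bsub>t\<^esub> B))"

definition rational_at_origin ::
  "real \<Rightarrow> nat \<Rightarrow> real set \<Rightarrow> (real \<Rightarrow> ht mat) \<Rightarrow> bool" where
  "rational_at_origin t n S R \<longleftrightarrow>
     0 \<in> S \<and> (\<forall>x\<in>S. R x \<in> carrier_mat n n) \<and>
     (\<forall>i<n. \<forall>k<n. continuous_on S (\<lambda>x. R x $$ (i, k))) \<and>
     (\<exists>N A B C D. realization t n N S R A B C D)"

definition observable :: "real \<Rightarrow> nat \<Rightarrow> nat \<Rightarrow> ht mat \<Rightarrow> ht mat \<Rightarrow> bool" where
  "observable t n N C A \<longleftrightarrow>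
     (\<forall>h \<in> carrier_mat N 1.
        (\<exists>\<epsilon>>0. \<forall>x. \<bar>x\<bar> < \<epsilon> \<longrightarrow>
            ht_invertible t N (pencil N A x) \<and>
            C \<star>\<^bsub>t\<^esub> ht_inverse t N (pencil N A x) \<star>\<^bsub>t\<^esub> h = 0\<^sub>m n 1)
        \<longleftrightarrow> h = 0\<^sub>m N 1)"

definition controllable :: "real \<Rightarrow> nat \<Rightarrow> nat \<Rightarrow> ht mat \<Rightarrow> ht mat \<Rightarrow> bool" where
  "controllable t n N A B \<longleftrightarrow>
     (\<forall>h \<in> carrier_mat 1 N.
        (\<forall>k. h \<star>\<^bsub>t\<^esub> ht_mat_pow t A k \<star>\<^bsub>t\<^esub> B = 0\<^sub>m 1 n) \<longleftrightarrow> h = 0\<^sub>m 1 N)"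

definition minimal_realization ::
  "real \<Rightarrow> nat \<Rightarrow> nat \<Rightarrow> real set \<Rightarrow> (real \<Rightarrow> ht mat) \<Rightarrow>
   ht mat \<Rightarrow> ht mat \<Rightarrow> ht mat \<Rightarrow> ht mat \<Rightarrow> bool" where
  "minimal_realization t n N S R A B C D \<longleftrightarrow>
     realization t n N S R A B C D \<and> observable t n N C A \<and> controllable t n N A B"

text \<open>
  \<open>G\<close> is the extension of \<open>x \<mapsto> R (1 / x)\<close>; being analytic near \<open>0\<close>, it is entrywise the sum of
  a convergent power series in the real variable \<open>x\<close>.
\<close>

definition analytic_invertible_at_infinity ::
  "real \<Rightarrow> nat \<Rightarrow> real set \<Rightarrow> (real \<Rightarrow> ht mat) \<Rightarrow> bool" where
  "analytic_invertible_at_infinity t n S R \<longleftrightarrow>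
     (\<exists>\<epsilon>>0. \<exists>G :: real \<Rightarrow> ht mat.
        (\<forall>x. 0 < \<bar>x\<bar> \<and> \<bar>x\<bar> < \<epsilon> \<longrightarrow> 1 / x \<in> S \<and> R (1 / x) = G x) \<and>
        (\<forall>i<n. \<forall>k<n. \<exists>c :: nat \<Rightarrow> ht. \<forall>x. \<bar>x\<bar> < \<epsilon> \<longrightarrow>
            (\<lambda>m. x ^ m *\<^sub>R c m) sums (G x $$ (i, k))) \<and>
        ht_invertible t n (G 0))"

end

theory Submission
  imports Defs "HOL-Analysis.Euclidean_Space" "HOL-Computational_Algebra.Polynomial"
begin

text \<open>
  Write M for the system matrix with blocks A, B, C, D, and K for the block diagonal matrix with
  blocks X and J, where X is the inverse of H; a star denotes the adjoint.
  The matrix M describes one step of the linear system whose transfer function is R. If it is invertible, reading the step backwards shows that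
  the pointwise inverse of R(1/x) is again a transfer function, with system matrix M^-1
  (lemma \<open>inverse_system\<close>). So the identity R(x) J R(1/x)* = J, rewritten as
  R(x) J = J (R(1/x)*)^-1, says that two systems, one built from M and one from the adjoint of
  M^-1, have the same transfer function, hence the same Taylor coefficients
  (\<open>markov_parameters_unique\<close>). Minimality turns this into a similarity of the two state spaces
  (\<open>state_space_similarity\<close>), and the similarity X is exactly a solution of
  M K = K (M^-1)*, that is, of M K M* = K. Observability makes X unique; as the adjoint of X
  solves the same equation, X is self-adjoint (\<open>stein_from_moments\<close>).

  Conversely, if M K M* = K, multiply M from the left by the block row
  (x C(I - xA)^-1, I): the result is the row (C(I - xA)^-1, R(x)). Evaluating the form
  K on two such rows, at x and at 1/x, before and after the multiplication gives
  R(x) J R(1/x)* = J (\<open>stein_imp_J_unitary\<close>) wherever both resolvents exist. The remaining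
  points are finitely many, and continuity of R covers them.

  Regularity at infinity is what makes M invertible. Since R is bounded at infinity,
  C(I - yA)^-1B tends to 0 as y grows; by observability and controllability the resolvent
  itself then tends to 0 (\<open>resolvent_vanishes_at_infinity\<close>), and a row (h, g) annihilated by M
  satisfies g R(y) = - h(I - yA)^-1B \<rightarrow> 0, so that g = 0 because the value of R at infinity is
  invertible, and then h = 0 (\<open>system_matrix_left_kernel\<close>).

  For t > 0 the algebra has zero divisors, so that row reduction can break down. Two devices replace
  linear algebra over a field: a square matrix is a root of a nonzero real polynomial, from which
  injective square matrices and the pencils I - xA are inverted explicitly; and a positive
  anti-involution of the algebra provides Gram matrices, hence one-sided inverses of
  observability and controllability matrices.
\<close>

section \<open>The algebra\<close>

text \<open>
  The norm of the product is at most 3 + |t| times the product of the norms; continuity,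
  distributivity and compatibility with real scalars then all come from the general theory.
\<close>

lemma bounded_bilinear_ht_mult: "bounded_bilinear (ht_mult t)"
proof
  show "\<exists>K. \<forall>p q. norm (ht_mult t p q) \<le> norm p * norm q * K"
  proof (intro exI allI)
    fix p q :: ht
    have le: "norm (fst p) \<le> norm p" "norm (snd p) \<le> norm p"
             "norm (fst q) \<le> norm q" "norm (snd q) \<le> norm q"
      by (metis norm_fst_le norm_snd_le prod.collapse)+
    have "norm (ht_mult t p q) \<le>
        norm (fst p * fst q + of_real t * snd p * cnj (snd q)) + norm (fst p * snd q + snd p * cnj (fst q))"
      unfolding ht_mult_def by (rule norm_Pair_le)
    also have "\<dots> \<le> (norm (fst p) * norm (fst q) + \<bar>t\<bar> * (norm (snd p) * norm (snd q)))
        + (norm (fst p) * norm (snd q) + norm (snd p) * norm (fst q))"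
      by (intro add_mono order_trans[OF norm_triangle_ineq]) (simp_all add: norm_mult)
    also have "\<dots> \<le> (norm p * norm q + \<bar>t\<bar> * (norm p * norm q))
        + (norm p * norm q + norm p * norm q)"
      by (intro add_mono mult_mono mult_left_mono) (use le in auto)
    also have "\<dots> = norm p * norm q * (3 + \<bar>t\<bar>)"
      by (simp add: algebra_simps)
    finally show "norm (ht_mult t p q) \<le> norm p * norm q * (3 + \<bar>t\<bar>)" .
  qed
qed (simp_all add: ht_mult_def algebra_simps scaleR_conv_of_real)

interpretation ht: bounded_bilinear "ht_mult t" for t
  by (rule bounded_bilinear_ht_mult)

lemma ht_conj_mult: "ht_conj (ht_mult t p q) = ht_mult t (ht_conj q) (ht_conj p)"
  by (simp add: ht_conj_def ht_mult_def algebra_simps)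

lemma bounded_linear_ht_conj: "bounded_linear ht_conj"
proof -
  have "bounded_linear (\<lambda>q :: ht. (cnj (fst q), - snd q))"
    by (intro bounded_linear_Pair bounded_linear_compose[OF bounded_linear_cnj]
        bounded_linear_fst bounded_linear_minus bounded_linear_snd)
  then show ?thesis by (simp add: ht_conj_def[abs_def])
qed

lemma ht_conj_linear [simp]:
  "ht_conj 0 = 0" "ht_conj (p + q) = ht_conj p + ht_conj q" "ht_conj (p - q) = ht_conj p - ht_conj q"
  "ht_conj (x *\<^sub>R q) = x *\<^sub>R ht_conj q" "ht_conj (sum f I) = (\<Sum>i\<in>I. ht_conj (f i))"
  using bounded_linear.linear[OF bounded_linear_ht_conj]
  by (auto simp: linear_0 linear_add linear_diff linear_scale linear_sum)

lemma ht_conj_conj [simp]: "ht_conj (ht_conj q) = q"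
  by (simp add: ht_conj_def)

lemma ht_one_left [simp]: "ht_mult t (ht_of_complex 1) q = q"
  and ht_one_right [simp]: "ht_mult t q (ht_of_complex 1) = q"
  by (simp_all add: ht_mult_def ht_of_complex_def)

lemma ht_conj_one [simp]: "ht_conj (ht_of_complex 1) = ht_of_complex 1"
  by (simp add: ht_conj_def ht_of_complex_def)

section \<open>Matrix algebra\<close>

lemma ht_mult_dim [simp]:
  "dim_row (M \<star>\<^bsub>t\<^esub> P) = dim_row M" "dim_col (M \<star>\<^bsub>t\<^esub> P) = dim_col P"
  by (simp_all add: ht_mat_mult_def)

lemma ht_mult_carrier:
  "M \<in> carrier_mat m n \<Longrightarrow> P \<in> carrier_mat n k \<Longrightarrow> M \<star>\<^bsub>t\<^esub> P \<in> carrier_mat m k"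
  by auto

lemma ht_mult_index:
  "i < dim_row M \<Longrightarrow> k < dim_col P \<Longrightarrow>
     (M \<star>\<^bsub>t\<^esub> P) $$ (i, k) = (\<Sum>l<dim_col M. ht_mult t (M $$ (i, l)) (P $$ (l, k)))"
  by (simp add: ht_mat_mult_def)

lemma ht_one_dim [simp]: "dim_row (ht_one_mat n) = n" "dim_col (ht_one_mat n) = n"
  by (simp_all add: ht_one_mat_def)

lemma ht_one_index:
  "i < n \<Longrightarrow> k < n \<Longrightarrow> ht_one_mat n $$ (i, k) = (if i = k then ht_of_complex 1 else 0)"
  by (simp add: ht_one_mat_def)

lemma ht_scale_dim [simp]:
  "dim_row (ht_scale_mat x M) = dim_row M" "dim_col (ht_scale_mat x M) = dim_col M"
  by (simp_all add: ht_scale_mat_def)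

lemma ht_scale_index [simp]:
  "i < dim_row M \<Longrightarrow> k < dim_col M \<Longrightarrow> ht_scale_mat x M $$ (i, k) = x *\<^sub>R M $$ (i, k)"
  by (simp add: ht_scale_mat_def)

lemma ht_adj_dim [simp]: "dim_row (ht_adj M) = dim_col M" "dim_col (ht_adj M) = dim_row M"
  by (simp_all add: ht_adj_def)

lemma ht_adj_index [simp]:
  "i < dim_col M \<Longrightarrow> k < dim_row M \<Longrightarrow> ht_adj M $$ (i, k) = ht_conj (M $$ (k, i))"
  by (simp add: ht_adj_def)

lemma pencil_dim [simp]: "dim_row (pencil N A x) = dim_row A" "dim_col (pencil N A x) = dim_col A"
  by (simp_all add: pencil_def)

lemma ht_pow_dim [simp]: "dim_row (ht_mat_pow t A k) = dim_row A"
  by (induct k) simp_all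

lemma ht_pow_dim_col [simp]: "dim_row A = dim_col A \<Longrightarrow> dim_col (ht_mat_pow t A k) = dim_col A"
  by (cases k) simp_all

text \<open>
  Like most identities below, this one has hypotheses on the dimensions that must agree instead of
  membership in carrier sets: the simplifier can discharge them, so it can reassociate products.
\<close>

lemma ht_assoc:
  assumes "dim_col M = dim_row P" "dim_col P = dim_row Q"
  shows "M \<star>\<^bsub>t\<^esub> P \<star>\<^bsub>t\<^esub> Q = M \<star>\<^bsub>t\<^esub> (P \<star>\<^bsub>t\<^esub> Q)"
proof (rule eq_matI)
  fix i j assume "i < dim_row (M \<star>\<^bsub>t\<^esub> (P \<star>\<^bsub>t\<^esub> Q))" "j < dim_col (M \<star>\<^bsub>t\<^esub> (P \<star>\<^bsub>t\<^esub> Q))"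
  then show "(M \<star>\<^bsub>t\<^esub> P \<star>\<^bsub>t\<^esub> Q) $$ (i, j) = (M \<star>\<^bsub>t\<^esub> (P \<star>\<^bsub>t\<^esub> Q)) $$ (i, j)"
    using assms
    by (simp add: ht_mult_index ht.sum_left ht.sum_right ht_mult_assoc) (rule sum.swap)
qed simp_all

lemma ht_add_left:
  assumes "dim_row M = dim_row P" "dim_col M = dim_col P" "dim_col P = dim_row Q"
  shows "(M + P) \<star>\<^bsub>t\<^esub> Q = M \<star>\<^bsub>t\<^esub> Q + P \<star>\<^bsub>t\<^esub> Q"
  by (rule eq_matI) (use assms in \<open>simp_all add: ht_mult_index ht.add_left sum.distrib\<close>)

lemma ht_add_right:
  assumes "dim_row P = dim_row Q" "dim_col P = dim_col Q" "dim_col M = dim_row Q"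
  shows "M \<star>\<^bsub>t\<^esub> (P + Q) = M \<star>\<^bsub>t\<^esub> P + M \<star>\<^bsub>t\<^esub> Q"
  by (rule eq_matI) (use assms in \<open>simp_all add: ht_mult_index ht.add_right sum.distrib\<close>)

lemma ht_diff_left:
  assumes "dim_row M = dim_row P" "dim_col M = dim_col P" "dim_col P = dim_row Q"
  shows "(M - P) \<star>\<^bsub>t\<^esub> Q = M \<star>\<^bsub>t\<^esub> Q - P \<star>\<^bsub>t\<^esub> Q"
  by (rule eq_matI) (use assms in \<open>simp_all add: ht_mult_index ht.diff_left sum_subtractf\<close>)

lemma ht_diff_right:
  assumes "dim_row P = dim_row Q" "dim_col P = dim_col Q" "dim_col M = dim_row Q"
  shows "M \<star>\<^bsub>t\<^esub> (P - Q) = M \<star>\<^bsub>t\<^esub> P - M \<star>\<^bsub>t\<^esub> Q"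
  by (rule eq_matI) (use assms in \<open>simp_all add: ht_mult_index ht.diff_right sum_subtractf\<close>)

lemma ht_scale_left:
  "dim_col M = dim_row P \<Longrightarrow> ht_scale_mat x M \<star>\<^bsub>t\<^esub> P = ht_scale_mat x (M \<star>\<^bsub>t\<^esub> P)"
  by (rule eq_matI) (simp_all add: ht_mult_index ht.scaleR_left scaleR_sum_right)

lemma ht_scale_right:
  "dim_col M = dim_row P \<Longrightarrow> M \<star>\<^bsub>t\<^esub> ht_scale_mat x P = ht_scale_mat x (M \<star>\<^bsub>t\<^esub> P)"
  by (rule eq_matI) (simp_all add: ht_mult_index ht.scaleR_right scaleR_sum_right)

lemma ht_scale_diff:
  "dim_row M = dim_row P \<Longrightarrow> dim_col M = dim_col P \<Longrightarrow>
     ht_scale_mat x (M - P) = ht_scale_mat x M - ht_scale_mat x P"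
  by (rule eq_matI) (simp_all add: scaleR_diff_right)

lemma ht_scale_scale [simp]: "ht_scale_mat x (ht_scale_mat y M) = ht_scale_mat (x * y) M"
  by (rule eq_matI) simp_all

lemma ht_scale_one [simp]: "ht_scale_mat 1 M = M"
  by (rule eq_matI) simp_all

lemma ht_scale_zero [simp]: "ht_scale_mat x (0\<^sub>m m n) = 0\<^sub>m m n"
  by (rule eq_matI) simp_all

lemma ht_zero_left [simp]: "dim_row P = n \<Longrightarrow> 0\<^sub>m m n \<star>\<^bsub>t\<^esub> P = 0\<^sub>m m (dim_col P)"
  by (rule eq_matI) (simp_all add: ht_mult_index ht.zero_left)

lemma ht_zero_right [simp]: "dim_col M = m \<Longrightarrow> M \<star>\<^bsub>t\<^esub> 0\<^sub>m m n = 0\<^sub>m (dim_row M) n"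
  by (rule eq_matI) (simp_all add: ht_mult_index ht.zero_right)

lemma ht_one_mult_left [simp]: "dim_row M = n \<Longrightarrow> ht_one_mat n \<star>\<^bsub>t\<^esub> M = M"
  by (rule eq_matI)
    (simp_all add: ht_mult_index ht_one_index ht.zero_left if_distrib[of "\<lambda>p. ht_mult t p _"]
      cong: if_cong)

lemma ht_one_mult_right [simp]: "dim_col M = n \<Longrightarrow> M \<star>\<^bsub>t\<^esub> ht_one_mat n = M"
  by (rule eq_matI)
    (simp_all add: ht_mult_index ht_one_index ht.zero_right if_distrib[of "ht_mult t _"]
      cong: if_cong)

lemma ht_adj_adj [simp]: "ht_adj (ht_adj M) = M"
  by (rule eq_matI) simp_all

lemma ht_adj_mult:
  "dim_col M = dim_row P \<Longrightarrow> ht_adj (M \<star>\<^bsub>t\<^esub> P) = ht_adj P \<star>\<^bsub>t\<^esub> ht_adj M"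
  by (rule eq_matI) (simp_all add: ht_mult_index ht_conj_mult)

lemma ht_adj_add:
  "dim_row M = dim_row P \<Longrightarrow> dim_col M = dim_col P \<Longrightarrow> ht_adj (M + P) = ht_adj M + ht_adj P"
  by (rule eq_matI) (simp_all)

lemma ht_adj_diff:
  "dim_row M = dim_row P \<Longrightarrow> dim_col M = dim_col P \<Longrightarrow> ht_adj (M - P) = ht_adj M - ht_adj P"
  by (rule eq_matI) (simp_all)

lemma ht_adj_scale: "ht_adj (ht_scale_mat x M) = ht_scale_mat x (ht_adj M)"
  by (rule eq_matI) (simp_all)

lemma ht_adj_one [simp]: "ht_adj (ht_one_mat n) = ht_one_mat n"
  by (rule eq_matI) (simp_all add: ht_one_index)

lemma ht_adj_zero [simp]: "ht_adj (0\<^sub>m m n) = 0\<^sub>m n m"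
  by (rule eq_matI) (simp_all)

lemma ht_pow_Suc_left:
  assumes "dim_row A = dim_col A"
  shows "ht_mat_pow t A (Suc k) = A \<star>\<^bsub>t\<^esub> ht_mat_pow t A k"
proof (induct k)
  case (Suc k)
  have "ht_mat_pow t A (Suc (Suc k)) = A \<star>\<^bsub>t\<^esub> ht_mat_pow t A k \<star>\<^bsub>t\<^esub> A"
    using Suc by simp
  then show ?case using assms by (simp add: ht_assoc)
qed (use assms in simp)

lemma ht_adj_pow:
  "dim_row A = dim_col A \<Longrightarrow> ht_adj (ht_mat_pow t A k) = ht_mat_pow t (ht_adj A) k"
proof (induct k)
  case (Suc k)
  then show ?case
    using ht_pow_Suc_left[of "ht_adj A" t k] by (simp add: ht_adj_mult)
qed simp

lemma ht_is_inverse_unique: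
  assumes "ht_is_inverse t n M P" "ht_is_inverse t n M Q"
  shows "P = Q"
proof -
  have "P = P \<star>\<^bsub>t\<^esub> (M \<star>\<^bsub>t\<^esub> Q)" using assms by (auto simp: ht_is_inverse_def)
  also have "\<dots> = P \<star>\<^bsub>t\<^esub> M \<star>\<^bsub>t\<^esub> Q"
    by (rule ht_assoc[symmetric]) (use assms in \<open>auto simp: ht_is_inverse_def\<close>)
  also have "\<dots> = Q" using assms by (auto simp: ht_is_inverse_def)
  finally show ?thesis .
qed

lemma ht_inverse_eq: "ht_is_inverse t n M P \<Longrightarrow> ht_inverse t n M = P"
  unfolding ht_inverse_def using ht_is_inverse_unique by blast

lemma ht_inverse_is_inverse: "ht_invertible t n M \<Longrightarrow> ht_is_inverse t n M (ht_inverse t n M)"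
  unfolding ht_invertible_def using ht_inverse_eq by blast

lemma ht_is_inverse_sym: "ht_is_inverse t n M P \<Longrightarrow> ht_is_inverse t n P M"
  by (simp add: ht_is_inverse_def)

lemma ht_is_inverse_adj: "ht_is_inverse t n M P \<Longrightarrow> ht_is_inverse t n (ht_adj M) (ht_adj P)"
  by (auto simp: ht_is_inverse_def ht_adj_mult[symmetric])

lemma sum_lessThan_add:
  fixes f :: "nat \<Rightarrow> 'a::comm_monoid_add"
  shows "(\<Sum>l<a + b. f l) = (\<Sum>l<a. f l) + (\<Sum>l<b. f (a + l))"
  by (induct b) (simp_all add: ac_simps)

lemma ht_four_block_mult:
  assumes "A \<in> carrier_mat a c" "B \<in> carrier_mat a d" "C \<in> carrier_mat b c" "D \<in> carrier_mat b d"
    and "E \<in> carrier_mat c e" "F \<in> carrier_mat c f" "G \<in> carrier_mat d e" "H \<in> carrier_mat d f"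
  shows "four_block_mat A B C D \<star>\<^bsub>t\<^esub> four_block_mat E F G H =
    four_block_mat (A \<star>\<^bsub>t\<^esub> E + B \<star>\<^bsub>t\<^esub> G) (A \<star>\<^bsub>t\<^esub> F + B \<star>\<^bsub>t\<^esub> H)
      (C \<star>\<^bsub>t\<^esub> E + D \<star>\<^bsub>t\<^esub> G) (C \<star>\<^bsub>t\<^esub> F + D \<star>\<^bsub>t\<^esub> H)"
  by (rule eq_matI) (use assms in \<open>auto simp: ht_mult_index sum_lessThan_add\<close>)

lemma ht_four_block_adj:
  assumes "A \<in> carrier_mat a c" "B \<in> carrier_mat a d" "C \<in> carrier_mat b c" "D \<in> carrier_mat b d"
  shows "ht_adj (four_block_mat A B C D) = four_block_mat (ht_adj A) (ht_adj C) (ht_adj B) (ht_adj D)"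
  by (rule eq_matI) (use assms in auto)

lemma ht_four_block_one:
  "four_block_mat (ht_one_mat a) (0\<^sub>m a b) (0\<^sub>m b a) (ht_one_mat b) = ht_one_mat (a + b)"
  by (rule eq_matI) (auto simp: ht_one_index)

lemma four_block_inject:
  assumes "A \<in> carrier_mat a c" "B \<in> carrier_mat a d" "C \<in> carrier_mat b c" "D \<in> carrier_mat b d"
    and "E \<in> carrier_mat a c" "F \<in> carrier_mat a d" "G \<in> carrier_mat b c" "H \<in> carrier_mat b d"
    and eq: "four_block_mat A B C D = four_block_mat E F G H"
  shows "A = E" "B = F" "C = G" "D = H"
proof -
  have ix: "four_block_mat A B C D $$ (i, j) = four_block_mat E F G H $$ (i, j)" for i j
    by (simp add: eq)
  show "A = E"
  proof (rule eq_matI)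
    fix i j assume "i < dim_row E" "j < dim_col E"
    then show "A $$ (i, j) = E $$ (i, j)" using ix[of i j] assms(1-8) by auto
  qed (use assms in auto)
  show "B = F"
  proof (rule eq_matI)
    fix i j assume "i < dim_row F" "j < dim_col F"
    then show "B $$ (i, j) = F $$ (i, j)" using ix[of i "j + c"] assms(1-8) by auto
  qed (use assms in auto)
  show "C = G"
  proof (rule eq_matI)
    fix i j assume "i < dim_row G" "j < dim_col G"
    then show "C $$ (i, j) = G $$ (i, j)" using ix[of "i + a" j] assms(1-8) by auto
  qed (use assms in auto)
  show "D = H"
  proof (rule eq_matI)
    fix i j assume "i < dim_row H" "j < dim_col H"
    then show "D $$ (i, j) = H $$ (i, j)" using ix[of "i + a" "j + c"] assms(1-8) by auto
  qed (use assms in auto)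
qed

section \<open>Polynomials in a matrix and invertibility\<close>

text \<open>
  Horner evaluation of a real polynomial at a matrix. Real coefficients are central in the algebra,
  so that such expressions commute with the matrix.
\<close>

definition ht_poly :: "real \<Rightarrow> ht mat \<Rightarrow> real poly \<Rightarrow> ht mat" where
  "ht_poly t A p = fold_coeffs
     (\<lambda>c M. ht_scale_mat c (ht_one_mat (dim_row A)) + A \<star>\<^bsub>t\<^esub> M) p (0\<^sub>m (dim_row A) (dim_row A))"

lemma ht_poly_0 [simp]: "ht_poly t A 0 = 0\<^sub>m (dim_row A) (dim_row A)"
  by (simp add: ht_poly_def)

lemma ht_poly_pCons [simp]:
  assumes "dim_row A = dim_col A"
  shows "ht_poly t A (pCons c p) = ht_scale_mat c (ht_one_mat (dim_row A)) + A \<star>\<^bsub>t\<^esub> ht_poly t A p"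
proof (cases "c = 0 \<and> p = 0")
  case True
  then show ?thesis using assms by (intro eq_matI) (auto simp: ht_one_index)
next
  case False
  then have "pCons c p \<noteq> 0" by simp
  with False show ?thesis
    unfolding ht_poly_def by (cases "c = 0") (simp_all add: fold_coeffs_pCons_coeff_not_0_eq fold_coeffs_pCons_not_0_0_eq)
qed

lemma ht_poly_carrier:
  assumes "A \<in> carrier_mat N N"
  shows "ht_poly t A p \<in> carrier_mat N N"
proof (induct p)
  case (pCons c p)
  have "dim_row A = N" "dim_col A = N" using assms by auto
  with pCons(2) show ?case
    by (intro carrier_matI) simp_all
qed (use assms in auto)

lemma ht_poly_dim [simp]:
  assumes "dim_row A = dim_col A"
  shows "dim_row (ht_poly t A p) = dim_row A" "dim_col (ht_poly t A p) = dim_col A"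
proof -
  have "ht_poly t A p \<in> carrier_mat (dim_row A) (dim_row A)"
    by (rule ht_poly_carrier) (metis assms carrier_matI)
  then show "dim_row (ht_poly t A p) = dim_row A" "dim_col (ht_poly t A p) = dim_col A"
    unfolding assms[symmetric] by (rule carrier_matD)+
qed

lemma ht_poly_add:
  assumes "dim_row A = dim_col A"
  shows "ht_poly t A (p + q) = ht_poly t A p + ht_poly t A q"
proof (induct p q rule: poly_induct2)
  case 0
  then show ?case by (intro eq_matI) (use assms in auto)
next
  case (pCons a p b q)
  then show ?case using assms
    by (intro eq_matI) (simp_all add: ht_add_right algebra_simps)
qed

lemma ht_poly_smult:
  assumes "dim_row A = dim_col A"
  shows "ht_poly t A (smult c p) = ht_scale_mat c (ht_poly t A p)"
proof (induct p)
  case (pCons a p)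
  then show ?case using assms
    by (intro eq_matI) (simp_all add: ht_scale_right algebra_simps)
qed simp

lemma ht_poly_commute:
  assumes "dim_row A = dim_col A"
  shows "A \<star>\<^bsub>t\<^esub> ht_poly t A p = ht_poly t A p \<star>\<^bsub>t\<^esub> A"
proof (induct p)
  case (pCons a p)
  show ?case using assms
    by (simp add: ht_add_right ht_add_left ht_scale_right ht_scale_left ht_assoc
        pCons(2)[symmetric])
qed (use assms in simp)

text \<open>
  A polynomial of degree less than d in A only involves the moments of index less than d.
\<close>

lemma ht_poly_kernel:
  assumes "dim_row A = dim_col A" "dim_col C = dim_row A" "dim_row h = dim_row A"
    and moments: "\<And>k. k < d \<Longrightarrow> C \<star>\<^bsub>t\<^esub> ht_mat_pow t A k \<star>\<^bsub>t\<^esub> h = 0\<^sub>m (dim_row C) (dim_col h)"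
    and deg: "p = 0 \<or> degree p < d"
  shows "C \<star>\<^bsub>t\<^esub> ht_poly t A p \<star>\<^bsub>t\<^esub> h = 0\<^sub>m (dim_row C) (dim_col h)"
proof -
  have "C \<star>\<^bsub>t\<^esub> ht_mat_pow t A k \<star>\<^bsub>t\<^esub> (ht_poly t A p \<star>\<^bsub>t\<^esub> h) = 0\<^sub>m (dim_row C) (dim_col h)"
    if "p = 0 \<or> k + degree p < d" for k
    using that
  proof (induct p arbitrary: k)
    case 0
    then show ?case using assms(1-3) by simp
  next
    case (pCons a p)
    have "C \<star>\<^bsub>t\<^esub> ht_mat_pow t A k \<star>\<^bsub>t\<^esub> (ht_poly t A (pCons a p) \<star>\<^bsub>t\<^esub> h) =
      ht_scale_mat a (C \<star>\<^bsub>t\<^esub> ht_mat_pow t A k \<star>\<^bsub>t\<^esub> h) +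
      C \<star>\<^bsub>t\<^esub> ht_mat_pow t A (Suc k) \<star>\<^bsub>t\<^esub> (ht_poly t A p \<star>\<^bsub>t\<^esub> h)"
      using assms(1-3)
      by (simp add: ht_add_right ht_add_left ht_scale_right ht_scale_left ht_assoc)
    moreover have "C \<star>\<^bsub>t\<^esub> ht_mat_pow t A k \<star>\<^bsub>t\<^esub> h = 0\<^sub>m (dim_row C) (dim_col h)"
      using pCons(1,3) by (intro moments) auto
    moreover have "C \<star>\<^bsub>t\<^esub> ht_mat_pow t A (Suc k) \<star>\<^bsub>t\<^esub> (ht_poly t A p \<star>\<^bsub>t\<^esub> h) =
        0\<^sub>m (dim_row C) (dim_col h)"
      using pCons(1,3) by (intro pCons(2)) (auto split: if_splits)
    ultimately show ?case by simp
  qed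
  from this[of 0] show ?thesis using assms(1-3) deg by (simp add: ht_assoc)
qed

lemma ht_poly_one: "dim_row A = dim_col A \<Longrightarrow> ht_poly t A 1 = ht_one_mat (dim_row A)"
  unfolding one_pCons by (rule eq_matI) simp_all

lemma ht_poly_monom:
  assumes "dim_row A = dim_col A"
  shows "ht_poly t A (monom 1 k) = ht_mat_pow t A k"
proof (induct k)
  case 0
  then show ?case using assms by (simp add: ht_poly_one)
next
  case (Suc k)
  then show ?case
    unfolding monom_Suc using assms ht_pow_Suc_left[OF assms, of t k]
    by (intro eq_matI) (simp_all del: ht_mat_pow.simps(2))
qed

lemma ht_poly_multiple_zero:
  assumes A: "dim_row A = dim_col A" and p: "ht_poly t A p = 0\<^sub>m (dim_row A) (dim_row A)"
  shows "ht_poly t A (q * p) = 0\<^sub>m (dim_row A) (dim_row A)"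
proof (induct q)
  case (pCons a q)
  show ?case using A p pCons(2)
    by (intro eq_matI) (simp_all add: ht_poly_add ht_poly_smult)
qed simp

text \<open>
  Each linear functional costs one dimension: given two polynomials of different degrees in the
  common kernel of the previous functionals, a combination of them is killed by the next one and keeps
  the larger degree. Requiring arbitrarily large degree makes the induction go through.
\<close>

lemma common_kernel_poly:
  fixes f :: "'i \<Rightarrow> real poly \<Rightarrow> real"
  assumes "finite I"
    and add: "\<And>i p q. f i (p + q) = f i p + f i q"
    and smult: "\<And>i c p. f i (smult c p) = c * f i p"
  shows "\<exists>p. p \<noteq> 0 \<and> n \<le> degree p \<and> (\<forall>i\<in>I. f i p = 0)"
  using assms(1)
proof (induct I arbitrary: n rule: finite_induct)
  case empty
  show ?case by (intro exI[of _ "monom 1 n"]) (simp add: degree_monom_eq monom_eq_0_iff)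
next
  case (insert i I)
  obtain p where p: "p \<noteq> 0" "n \<le> degree p" "\<forall>i\<in>I. f i p = 0"
    using insert(3) by blast
  obtain q where q: "q \<noteq> 0" "Suc (degree p) \<le> degree q" "\<forall>i\<in>I. f i q = 0"
    using insert(3) by blast
  show ?case
  proof (cases "f i p = 0")
    case True
    with p show ?thesis by auto
  next
    case False
    define r where "r = smult (f i q) p + smult (- f i p) q"
    have "degree (smult (f i q) p) < degree (smult (- f i p) q)"
      using q(2) False degree_smult_le[of "f i q" p] by simp
    then have "degree r = degree q"
      unfolding r_def using False by (subst degree_add_eq_right) auto
    moreover have "\<forall>k\<in>insert i I. f k r = 0"
      using p q unfolding r_def by (auto simp: add smult simp del: smult_minus_left)
    ultimately show ?thesis using p q by (intro exI[of _ r]) auto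
  qed
qed

text \<open>
  The functionals are the real coordinates of the entries of p(A).
\<close>

lemma annihilating_poly:
  assumes A: "dim_row A = dim_col A"
  shows "\<exists>p. p \<noteq> 0 \<and> ht_poly t A p = 0\<^sub>m (dim_row A) (dim_row A)"
proof -
  let ?N = "dim_row A"
  let ?f = "\<lambda>(i, j, b :: ht) p. if i < ?N \<and> j < ?N then inner (ht_poly t A p $$ (i, j)) b else 0"
  let ?I = "{..<?N} \<times> {..<?N} \<times> (Basis :: ht set)"
  have "\<exists>p. p \<noteq> 0 \<and> 0 \<le> degree p \<and> (\<forall>i\<in>?I. ?f i p = 0)"
  proof (rule common_kernel_poly)
    show "finite ?I" by simp
    show "?f i (p + q) = ?f i p + ?f i q" for i p q
      using A by (auto simp: ht_poly_add inner_add_left split: prod.split)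
    show "?f i (smult c p) = c * ?f i p" for i c p
      using A by (auto simp: ht_poly_smult split: prod.split)
  qed
  then obtain p where p: "p \<noteq> 0" "\<forall>i\<in>?I. ?f i p = 0" by blast
  have "ht_poly t A p = 0\<^sub>m ?N ?N"
  proof (rule eq_matI)
    fix i j assume "i < dim_row (0\<^sub>m ?N ?N :: ht mat)" "j < dim_col (0\<^sub>m ?N ?N :: ht mat)"
    then have *: "inner (ht_poly t A p $$ (i, j)) b = 0" if "b \<in> Basis" for b
      using bspec[OF p(2), of "(i, j, b)"] that by simp
    have "ht_poly t A p $$ (i, j) = 0"
      by (rule euclidean_eqI) (simp add: *)
    then show "ht_poly t A p $$ (i, j) = (0\<^sub>m ?N ?N :: ht mat) $$ (i, j)"
      using \<open>i < _\<close> \<open>j < _\<close> by simp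
  qed (use A in auto)
  with p show ?thesis by blast
qed

lemma injective_columns:
  assumes dims: "dim_col M = dim_row P"
    and inj: "\<And>h. h \<in> carrier_mat (dim_col M) 1 \<Longrightarrow> M \<star>\<^bsub>t\<^esub> h = 0\<^sub>m (dim_row M) 1 \<Longrightarrow>
      h = 0\<^sub>m (dim_col M) 1"
    and zero: "M \<star>\<^bsub>t\<^esub> P = 0\<^sub>m (dim_row M) (dim_col P)"
  shows "P = 0\<^sub>m (dim_row P) (dim_col P)"
proof (rule eq_matI)
  fix i j assume "i < dim_row (0\<^sub>m (dim_row P) (dim_col P) :: ht mat)"
    and "j < dim_col (0\<^sub>m (dim_row P) (dim_col P) :: ht mat)"
  then have ij: "i < dim_row P" "j < dim_col P" by auto
  define h where "h = mat (dim_row P) 1 (\<lambda>(i, _). P $$ (i, j))"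
  have "M \<star>\<^bsub>t\<^esub> h = 0\<^sub>m (dim_row M) 1"
  proof (rule eq_matI)
    fix r s assume "r < dim_row (0\<^sub>m (dim_row M) 1 :: ht mat)" "s < dim_col (0\<^sub>m (dim_row M) 1 :: ht mat)"
    then have r: "r < dim_row M" "s = 0" by auto
    have "(M \<star>\<^bsub>t\<^esub> h) $$ (r, s) = (M \<star>\<^bsub>t\<^esub> P) $$ (r, j)"
      using r ij dims by (simp add: ht_mult_index h_def)
    then show "(M \<star>\<^bsub>t\<^esub> h) $$ (r, s) = (0\<^sub>m (dim_row M) 1 :: ht mat) $$ (r, s)"
      using r ij zero by simp
  qed (simp_all add: h_def)
  then have "h = 0\<^sub>m (dim_col M) 1"
    using inj[of h] dims by (simp add: h_def)
  then have "h $$ (i, 0) = 0" using ij dims by simp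
  then show "P $$ (i, j) = (0\<^sub>m (dim_row P) (dim_col P) :: ht mat) $$ (i, j)"
    using ij by (simp add: h_def)
qed simp_all

lemma mat_add_eq_zero:
  fixes M P :: "ht mat"
  assumes "M + P = 0\<^sub>m r c" "dim_row M = r" "dim_col M = c"
  shows "P = ht_scale_mat (- 1) M"
proof (rule eq_matI)
  have d: "dim_row P = r" "dim_col P = c"
    using arg_cong[OF assms(1), of dim_row] arg_cong[OF assms(1), of dim_col] by auto
  then show "dim_row P = dim_row (ht_scale_mat (- 1) M)" "dim_col P = dim_col (ht_scale_mat (- 1) M)"
    using assms by auto
  fix i j assume "i < dim_row (ht_scale_mat (- 1) M)" "j < dim_col (ht_scale_mat (- 1) M)"
  then have ij: "i < r" "j < c" using assms by auto
  have "(M + P) $$ (i, j) = 0" using ij by (simp add: assms(1))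
  then show "P $$ (i, j) = ht_scale_mat (- 1) M $$ (i, j)"
    using ij d assms(2,3) by (simp add: eq_neg_iff_add_eq_0 add.commute)
qed

text \<open>
  An annihilating polynomial c + s q(s) of least degree has c \<noteq> 0, because otherwise injectivity
  of A would allow cancelling a factor s. Then A q(A) = q(A) A = - c, and - q(A)/c is the inverse.
\<close>

lemma injective_imp_invertible:
  assumes A: "A \<in> carrier_mat N N"
    and inj: "\<And>h. h \<in> carrier_mat N 1 \<Longrightarrow> A \<star>\<^bsub>t\<^esub> h = 0\<^sub>m N 1 \<Longrightarrow> h = 0\<^sub>m N 1"
  shows "ht_invertible t N A"
proof -
  have dims: "dim_row A = N" "dim_col A = N" using A by auto
  let ?ann = "\<lambda>p. p \<noteq> 0 \<and> ht_poly t A p = 0\<^sub>m N N"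
  have "\<exists>p. ?ann p" using annihilating_poly[of A t] dims by auto
  then obtain p where p: "?ann p" and least: "\<And>q. ?ann q \<Longrightarrow> degree p \<le> degree q"
    using ex_has_least_nat[of ?ann _ degree] by blast
  obtain c q where pq: "p = pCons c q" by (cases p)
  have eq: "ht_scale_mat c (ht_one_mat N) + A \<star>\<^bsub>t\<^esub> ht_poly t A q = 0\<^sub>m N N"
    using p dims by (simp add: pq)
  have "c \<noteq> 0"
  proof
    assume "c = 0"
    then have "A \<star>\<^bsub>t\<^esub> ht_poly t A q = ht_scale_mat (- 1) (ht_scale_mat 0 (ht_one_mat N))"
      using mat_add_eq_zero[OF eq] by simp
    also have "\<dots> = 0\<^sub>m N N" by (rule eq_matI) simp_all
    finally have "ht_poly t A q = 0\<^sub>m N N"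
      using injective_columns[of A "ht_poly t A q" t] inj dims by simp
    moreover have "q \<noteq> 0" using p \<open>c = 0\<close> by (auto simp: pq)
    ultimately show False using least[of q] by (simp add: pq)
  qed
  have "A \<star>\<^bsub>t\<^esub> ht_poly t A q = ht_scale_mat (- c) (ht_one_mat N)"
    using mat_add_eq_zero[OF eq] by simp
  then have "ht_is_inverse t N A (ht_scale_mat (- 1 / c) (ht_poly t A q))"
    unfolding ht_is_inverse_def using \<open>c \<noteq> 0\<close> dims
    by (intro conjI carrier_matI)
      (simp_all add: ht_scale_right ht_scale_left ht_poly_commute[symmetric])
  then show ?thesis by (auto simp: ht_invertible_def)
qed

lemma right_inverse_imp_inverse:
  assumes "Y \<in> carrier_mat N N" "Z \<in> carrier_mat N N" "Y \<star>\<^bsub>t\<^esub> Z = ht_one_mat N"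
  shows "ht_is_inverse t N Y Z"
proof -
  have "ht_invertible t N Z"
  proof (rule injective_imp_invertible[OF assms(2)])
    fix h assume h: "h \<in> carrier_mat N 1" "Z \<star>\<^bsub>t\<^esub> h = 0\<^sub>m N 1"
    have "h = Y \<star>\<^bsub>t\<^esub> Z \<star>\<^bsub>t\<^esub> h" using h assms by simp
    also have "\<dots> = Y \<star>\<^bsub>t\<^esub> (Z \<star>\<^bsub>t\<^esub> h)" using h assms by (intro ht_assoc) auto
    also have "\<dots> = 0\<^sub>m N 1" using h assms by simp
    finally show "h = 0\<^sub>m N 1" .
  qed
  then obtain W where W: "ht_is_inverse t N Z W" by (auto simp: ht_invertible_def)
  have "Y = Y \<star>\<^bsub>t\<^esub> (Z \<star>\<^bsub>t\<^esub> W)" using W assms by (auto simp: ht_is_inverse_def)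
  also have "\<dots> = Y \<star>\<^bsub>t\<^esub> Z \<star>\<^bsub>t\<^esub> W"
    using W assms by (intro ht_assoc[symmetric]) (auto simp: ht_is_inverse_def)
  also have "\<dots> = W" using W assms by (auto simp: ht_is_inverse_def)
  finally show ?thesis using W ht_is_inverse_sym by blast
qed

text \<open>
  With s = 1/x, the polynomial p(z) - p(s) is divisible by z - s; evaluating at A shows that the
  quotient inverts s - A up to the factor p(s).
\<close>

lemma pencil_inverse_poly:
  assumes A: "A \<in> carrier_mat N N" and p: "ht_poly t A p = 0\<^sub>m N N"
    and x: "x \<noteq> 0" "poly p (1 / x) \<noteq> 0"
  shows "\<exists>q. ht_is_inverse t N (pencil N A x) (ht_poly t A q)"
proof -
  have dims: "dim_row A = N" "dim_col A = N" using A by auto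
  define c where "c = poly p (1 / x)"
  have "poly (p - [:c:]) (1 / x) = 0" by (simp add: c_def)
  then obtain q where "p - [:c:] = [:- (1 / x), 1:] * q"
    by (metis poly_eq_0_iff_dvd dvdE)
  then have pq: "p = [:c:] + (smult (- (1 / x)) q + pCons 0 q)"
    by (simp add: algebra_simps)
  have "ht_poly t A ([:c:] + (smult (- (1 / x)) q + pCons 0 q)) = 0\<^sub>m N N"
    using p unfolding pq[symmetric] .
  moreover have "ht_scale_mat 0 (ht_one_mat N) + A \<star>\<^bsub>t\<^esub> ht_poly t A q = A \<star>\<^bsub>t\<^esub> ht_poly t A q"
    "ht_scale_mat c (ht_one_mat N) + 0\<^sub>m N N = ht_scale_mat c (ht_one_mat N)"
    by (rule eq_matI; use dims in simp)+
  ultimately have eq: "ht_scale_mat c (ht_one_mat N) +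
      (ht_scale_mat (- (1 / x)) (ht_poly t A q) + A \<star>\<^bsub>t\<^esub> ht_poly t A q) = 0\<^sub>m N N"
    using dims by (simp add: ht_poly_add ht_poly_smult del: smult_minus_left)
  define r where "r = smult (1 / (c * x)) q"
  have *: "ht_scale_mat (1 / (c * x)) (ht_poly t A q - ht_scale_mat x (A \<star>\<^bsub>t\<^esub> ht_poly t A q))
      = ht_one_mat N"
  proof (rule eq_matI)
    fix i j assume "i < dim_row (ht_one_mat N)" "j < dim_col (ht_one_mat N)"
    then have ij: "i < N" "j < N" by auto
    have "(ht_scale_mat c (ht_one_mat N) +
      (ht_scale_mat (- (1 / x)) (ht_poly t A q) + A \<star>\<^bsub>t\<^esub> ht_poly t A q)) $$ (i, j) = 0"
      using ij by (simp add: eq)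
    then have "c *\<^sub>R ht_one_mat N $$ (i, j) =
        (1 / x) *\<^sub>R ht_poly t A q $$ (i, j) - (A \<star>\<^bsub>t\<^esub> ht_poly t A q) $$ (i, j)"
      using ij dims by (simp add: algebra_simps add_eq_0_iff)
    then have "(1 / c) *\<^sub>R c *\<^sub>R ht_one_mat N $$ (i, j) =
        (1 / c) *\<^sub>R ((1 / x) *\<^sub>R ht_poly t A q $$ (i, j) - (A \<star>\<^bsub>t\<^esub> ht_poly t A q) $$ (i, j))"
      by simp
    moreover have "c \<noteq> 0" using x by (simp add: c_def)
    ultimately show "ht_scale_mat (1 / (c * x)) (ht_poly t A q -
        ht_scale_mat x (A \<star>\<^bsub>t\<^esub> ht_poly t A q)) $$ (i, j) = ht_one_mat N $$ (i, j)"
      using ij dims x by (simp add: scaleR_diff_right)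
  qed (use dims in auto)
  have "ht_is_inverse t N (pencil N A x) (ht_poly t A r)"
    unfolding ht_is_inverse_def using * dims x(1)
    by (intro conjI carrier_matI) (simp_all add: pencil_def r_def ht_scale_diff ht_poly_smult ht_diff_left
      ht_diff_right ht_scale_right ht_scale_left ht_poly_commute[symmetric])
  then show ?thesis by blast
qed

lemma pencil_zero [simp]: "A \<in> carrier_mat N N \<Longrightarrow> pencil N A 0 = ht_one_mat N"
  by (rule eq_matI) (auto simp: pencil_def)

lemma ht_is_inverse_one: "ht_is_inverse t N (ht_one_mat N) (ht_one_mat N)"
  by (simp add: ht_is_inverse_def carrier_matI)

text \<open>
  That the inverse of the pencil is a polynomial in A is what relates the resolvent to the
  moments C A^k h.
\<close>

lemma pencil_inverse_poly_cofinite: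
  assumes A: "A \<in> carrier_mat N N"
  shows "\<exists>F. finite F \<and> 0 \<notin> F \<and>
    (\<forall>x. x \<notin> F \<longrightarrow> (\<exists>q. ht_is_inverse t N (pencil N A x) (ht_poly t A q)))"
proof -
  have dims: "dim_row A = N" "dim_col A = N" using A by auto
  obtain p where p: "p \<noteq> 0" "ht_poly t A p = 0\<^sub>m N N"
    using annihilating_poly[of A t] dims by auto
  define F where "F = inverse ` {s. poly p s = 0} - {0}"
  have "\<exists>q. ht_is_inverse t N (pencil N A x) (ht_poly t A q)" if "x \<notin> F" for x
  proof (cases "x = 0")
    case True
    then show ?thesis
      using A dims ht_is_inverse_one by (intro exI[of _ 1]) (simp add: ht_poly_one)
  next
    case False
    then have "poly p (1 / x) \<noteq> 0"
      using that by (auto simp: F_def inverse_eq_divide image_iff)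
    then show ?thesis using pencil_inverse_poly[OF A p(2) False] by blast
  qed
  moreover have "finite F" unfolding F_def by (simp add: poly_roots_finite[OF p(1)])
  ultimately show ?thesis by (intro exI[of _ F]) (simp add: F_def)
qed

lemma finite_singular_pencil:
  assumes A: "A \<in> carrier_mat N N"
  shows "finite {x. \<not> ht_invertible t N (pencil N A x)}"
proof -
  obtain F where "finite F" "\<forall>x. x \<notin> F \<longrightarrow> (\<exists>q. ht_is_inverse t N (pencil N A x) (ht_poly t A q))"
    using pencil_inverse_poly_cofinite[OF A] by blast
  then show ?thesis
    by (elim finite_subset[rotated]) (auto simp: ht_invertible_def)
qed

section \<open>Observability and controllability\<close>

text \<open>
  Sums of matrices need the dimensions as arguments, since an empty sum must still be a matrix of
  the right size.
\<close>

definition ht_sum :: "nat \<Rightarrow> nat \<Rightarrow> nat \<Rightarrow> (nat \<Rightarrow> ht mat) \<Rightarrow> ht mat" where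
  "ht_sum m n K F = mat m n (\<lambda>(i, j). \<Sum>k<K. F k $$ (i, j))"

lemma ht_sum_dim [simp]: "dim_row (ht_sum m n K F) = m" "dim_col (ht_sum m n K F) = n"
  by (simp_all add: ht_sum_def)

lemma ht_sum_index [simp]: "i < m \<Longrightarrow> j < n \<Longrightarrow> ht_sum m n K F $$ (i, j) = (\<Sum>k<K. F k $$ (i, j))"
  by (simp add: ht_sum_def)

lemma ht_sum_carrier: "ht_sum m n K F \<in> carrier_mat m n"
  by (simp add: ht_sum_def)

lemma ht_sum_cong: "(\<And>k. k < K \<Longrightarrow> F k = G k) \<Longrightarrow> ht_sum m n K F = ht_sum m n K G"
  by (rule eq_matI) simp_all

lemma ht_sum_mult_right:
  assumes "\<And>k. F k \<in> carrier_mat m n" "dim_row P = n"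
  shows "ht_sum m n K F \<star>\<^bsub>t\<^esub> P = ht_sum m (dim_col P) K (\<lambda>k. F k \<star>\<^bsub>t\<^esub> P)"
proof (rule eq_matI)
  have d: "dim_row (F k) = m" "dim_col (F k) = n" for k using assms(1)[of k] by auto
  fix i j assume "i < dim_row (ht_sum m (dim_col P) K (\<lambda>k. F k \<star>\<^bsub>t\<^esub> P))"
    and "j < dim_col (ht_sum m (dim_col P) K (\<lambda>k. F k \<star>\<^bsub>t\<^esub> P))"
  then show "(ht_sum m n K F \<star>\<^bsub>t\<^esub> P) $$ (i, j) = ht_sum m (dim_col P) K (\<lambda>k. F k \<star>\<^bsub>t\<^esub> P) $$ (i, j)"
    using assms d by (simp add: ht_mult_index ht.sum_left) (rule sum.swap)
qed simp_all

lemma ht_sum_mult_left: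
  assumes "\<And>k. F k \<in> carrier_mat m n" "dim_col P = m"
  shows "P \<star>\<^bsub>t\<^esub> ht_sum m n K F = ht_sum (dim_row P) n K (\<lambda>k. P \<star>\<^bsub>t\<^esub> F k)"
proof (rule eq_matI)
  have d: "dim_row (F k) = m" "dim_col (F k) = n" for k using assms(1)[of k] by auto
  fix i j assume "i < dim_row (ht_sum (dim_row P) n K (\<lambda>k. P \<star>\<^bsub>t\<^esub> F k))"
    and "j < dim_col (ht_sum (dim_row P) n K (\<lambda>k. P \<star>\<^bsub>t\<^esub> F k))"
  then show "(P \<star>\<^bsub>t\<^esub> ht_sum m n K F) $$ (i, j) = ht_sum (dim_row P) n K (\<lambda>k. P \<star>\<^bsub>t\<^esub> F k) $$ (i, j)"
    using assms d by (simp add: ht_mult_index ht.sum_right) (rule sum.swap)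
qed simp_all

lemma ht_sum_adj:
  assumes "\<And>k. F k \<in> carrier_mat m n"
  shows "ht_adj (ht_sum m n K F) = ht_sum n m K (\<lambda>k. ht_adj (F k))"
proof (rule eq_matI)
  have d: "dim_row (F k) = m" "dim_col (F k) = n" for k using assms(1)[of k] by auto
  fix i j assume "i < dim_row (ht_sum n m K (\<lambda>k. ht_adj (F k)))"
    and "j < dim_col (ht_sum n m K (\<lambda>k. ht_adj (F k)))"
  then show "ht_adj (ht_sum m n K F) $$ (i, j) = ht_sum n m K (\<lambda>k. ht_adj (F k)) $$ (i, j)"
    using d by simp
qed simp_all

text \<open>
  The conjugation of the algebra is indefinite for t > 0. Changing the sign of the second component
  in that case gives an anti-involution for which q^\<dagger> q has positive real part unless q = 0.
\<close>

definition ht_dag :: "real \<Rightarrow> ht \<Rightarrow> ht" where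
  "ht_dag t q = (cnj (fst q), of_real (sgn t) * snd q)"

definition ht_dag_mat :: "real \<Rightarrow> ht mat \<Rightarrow> ht mat" where
  "ht_dag_mat t M = map_mat (ht_dag t) (transpose_mat M)"

lemma ht_dag_mult: "t \<noteq> 0 \<Longrightarrow> ht_dag t (ht_mult t p q) = ht_mult t (ht_dag t q) (ht_dag t p)"
  by (cases "t > 0") (simp_all add: ht_dag_def ht_mult_def algebra_simps)

lemma ht_dag_sum: "ht_dag t (\<Sum>i\<in>I. f i) = (\<Sum>i\<in>I. ht_dag t (f i))"
  by (simp add: ht_dag_def prod_eq_iff fst_sum snd_sum sum_distrib_left)

lemma ht_dag_positive:
  "Re (fst (ht_mult t (ht_dag t q) q)) = (norm (fst q))\<^sup>2 + \<bar>t\<bar> * (norm (snd q))\<^sup>2"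
proof -
  have "fst (ht_mult t (ht_dag t q) q) = cnj (fst q) * fst q + of_real (t * sgn t) * (snd q * cnj (snd q))"
    by (simp add: ht_mult_def ht_dag_def algebra_simps)
  also have "\<dots> = of_real ((norm (fst q))\<^sup>2 + \<bar>t\<bar> * (norm (snd q))\<^sup>2)"
    by (simp add: complex_norm_square[symmetric] mult.commute[of "cnj (fst q)"] abs_sgn)
  finally show ?thesis by simp
qed

lemma ht_dag_mat_dim [simp]:
  "dim_row (ht_dag_mat t M) = dim_col M" "dim_col (ht_dag_mat t M) = dim_row M"
  by (simp_all add: ht_dag_mat_def)

lemma ht_dag_mat_index [simp]:
  "i < dim_col M \<Longrightarrow> k < dim_row M \<Longrightarrow> ht_dag_mat t M $$ (i, k) = ht_dag t (M $$ (k, i))"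
  by (simp add: ht_dag_mat_def)

lemma ht_dag_mat_mult:
  "t \<noteq> 0 \<Longrightarrow> dim_col M = dim_row P \<Longrightarrow>
    ht_dag_mat t (M \<star>\<^bsub>t\<^esub> P) = ht_dag_mat t P \<star>\<^bsub>t\<^esub> ht_dag_mat t M"
  by (rule eq_matI) (simp_all add: ht_mult_index ht_dag_sum ht_dag_mult)

lemma dag_gram_column:
  assumes "v \<in> carrier_mat r 1"
  shows "Re (fst ((ht_dag_mat t v \<star>\<^bsub>t\<^esub> v) $$ (0, 0))) =
    (\<Sum>i<r. (norm (fst (v $$ (i, 0))))\<^sup>2 + \<bar>t\<bar> * (norm (snd (v $$ (i, 0))))\<^sup>2)"
  using assms by (simp add: ht_mult_index fst_sum ht_dag_positive)

text \<open>
  The Gram matrix G, the sum of the products M_k^\<dagger> M_k, is injective by positivity, hence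
  invertible, and L_k = G^-1 M_k^\<dagger> works.
\<close>

lemma common_left_inverse:
  assumes t: "t \<noteq> 0" and M: "\<And>k. M k \<in> carrier_mat r N"
    and inj: "\<And>h. h \<in> carrier_mat N 1 \<Longrightarrow> (\<And>k. k < K \<Longrightarrow> M k \<star>\<^bsub>t\<^esub> h = 0\<^sub>m r 1) \<Longrightarrow> h = 0\<^sub>m N 1"
  shows "\<exists>L. (\<forall>k. L k \<in> carrier_mat N r) \<and> ht_sum N N K (\<lambda>k. L k \<star>\<^bsub>t\<^esub> M k) = ht_one_mat N"
proof -
  have d [simp]: "dim_row (M k) = r" "dim_col (M k) = N" for k using M[of k] by auto
  define G where "G = ht_sum N N K (\<lambda>k. ht_dag_mat t (M k) \<star>\<^bsub>t\<^esub> M k)"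
  have G: "G \<in> carrier_mat N N" by (simp add: G_def ht_sum_carrier)
  have "ht_invertible t N G"
  proof (rule injective_imp_invertible[OF G])
    fix h assume h: "h \<in> carrier_mat N 1" and Gh: "G \<star>\<^bsub>t\<^esub> h = 0\<^sub>m N 1"
    have dh [simp]: "dim_row h = N" "dim_col h = 1" using h by auto
    let ?q = "\<lambda>v :: ht. (norm (fst v))\<^sup>2 + \<bar>t\<bar> * (norm (snd v))\<^sup>2"
    have c: "ht_dag_mat t (M k) \<star>\<^bsub>t\<^esub> M k \<in> carrier_mat N N" for k by (intro carrier_matI) simp_all
    have "G \<star>\<^bsub>t\<^esub> h = ht_sum N 1 K (\<lambda>k. ht_dag_mat t (M k) \<star>\<^bsub>t\<^esub> M k \<star>\<^bsub>t\<^esub> h)"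
      unfolding G_def using ht_sum_mult_right[where F = "\<lambda>k. ht_dag_mat t (M k) \<star>\<^bsub>t\<^esub> M k", OF c] by simp
    moreover have "ht_dag_mat t (M k) \<star>\<^bsub>t\<^esub> M k \<star>\<^bsub>t\<^esub> h \<in> carrier_mat N 1" for k
      by (intro carrier_matI) simp_all
    ultimately have "ht_dag_mat t h \<star>\<^bsub>t\<^esub> (G \<star>\<^bsub>t\<^esub> h) =
        ht_sum 1 1 K (\<lambda>k. ht_dag_mat t h \<star>\<^bsub>t\<^esub> (ht_dag_mat t (M k) \<star>\<^bsub>t\<^esub> M k \<star>\<^bsub>t\<^esub> h))"
      using ht_sum_mult_left[where F = "\<lambda>k. ht_dag_mat t (M k) \<star>\<^bsub>t\<^esub> M k \<star>\<^bsub>t\<^esub> h"] by simp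
    also have "\<dots> = ht_sum 1 1 K (\<lambda>k. ht_dag_mat t (M k \<star>\<^bsub>t\<^esub> h) \<star>\<^bsub>t\<^esub> (M k \<star>\<^bsub>t\<^esub> h))"
      by (rule ht_sum_cong) (simp add: ht_dag_mat_mult t ht_assoc)
    finally have "ht_sum 1 1 K (\<lambda>k. ht_dag_mat t (M k \<star>\<^bsub>t\<^esub> h) \<star>\<^bsub>t\<^esub> (M k \<star>\<^bsub>t\<^esub> h)) = 0\<^sub>m 1 1"
      by (simp add: Gh)
    then have "Re (fst (ht_sum 1 1 K (\<lambda>k. ht_dag_mat t (M k \<star>\<^bsub>t\<^esub> h) \<star>\<^bsub>t\<^esub> (M k \<star>\<^bsub>t\<^esub> h)) $$ (0, 0))) = 0"
      by (simp del: ht_sum_index)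
    then have "(\<Sum>k<K. Re (fst ((ht_dag_mat t (M k \<star>\<^bsub>t\<^esub> h) \<star>\<^bsub>t\<^esub> (M k \<star>\<^bsub>t\<^esub> h)) $$ (0, 0)))) = 0"
      by (simp add: fst_sum)
    then have sum0: "(\<Sum>k<K. \<Sum>i<r. ?q ((M k \<star>\<^bsub>t\<^esub> h) $$ (i, 0))) = 0"
      by (subst (asm) dag_gram_column[of _ r]) (auto intro!: carrier_matI)
    show "h = 0\<^sub>m N 1"
    proof (rule inj[OF h])
      fix k assume "k < K"
      have "(\<Sum>i<r. ?q ((M k \<star>\<^bsub>t\<^esub> h) $$ (i, 0))) = 0"
        using sum0 \<open>k < K\<close> by (subst (asm) sum_nonneg_eq_0_iff) (auto intro!: sum_nonneg)
      then have q0: "?q ((M k \<star>\<^bsub>t\<^esub> h) $$ (i, 0)) = 0" if "i < r" for i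
        using that by (subst (asm) sum_nonneg_eq_0_iff) auto
      have e0: "(M k \<star>\<^bsub>t\<^esub> h) $$ (i, 0) = 0" if "i < r" for i
        using q0[OF that] t by (subst (asm) add_nonneg_eq_0_iff) (auto simp: prod_eq_iff)
      show "M k \<star>\<^bsub>t\<^esub> h = 0\<^sub>m r 1"
        by (rule eq_matI) (use e0 in simp_all)
    qed
  qed
  then obtain P where P: "ht_is_inverse t N G P" by (auto simp: ht_invertible_def)
  then have dP [simp]: "dim_row P = N" "dim_col P = N" by (auto simp: ht_is_inverse_def)
  have c: "ht_dag_mat t (M k) \<star>\<^bsub>t\<^esub> M k \<in> carrier_mat N N" for k by (intro carrier_matI) simp_all
  have "P \<star>\<^bsub>t\<^esub> G = ht_sum N N K (\<lambda>k. P \<star>\<^bsub>t\<^esub> (ht_dag_mat t (M k) \<star>\<^bsub>t\<^esub> M k))"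
    unfolding G_def by (subst ht_sum_mult_left[OF c]) simp_all
  also have "\<dots> = ht_sum N N K (\<lambda>k. P \<star>\<^bsub>t\<^esub> ht_dag_mat t (M k) \<star>\<^bsub>t\<^esub> M k)"
    by (rule ht_sum_cong) (simp add: ht_assoc)
  finally have "ht_sum N N K (\<lambda>k. P \<star>\<^bsub>t\<^esub> ht_dag_mat t (M k) \<star>\<^bsub>t\<^esub> M k) = ht_one_mat N"
    using P by (simp add: ht_is_inverse_def)
  then show ?thesis
    by (intro exI[of _ "\<lambda>k. P \<star>\<^bsub>t\<^esub> ht_dag_mat t (M k)"]) (auto intro!: carrier_matI)
qed

text \<open>
  Finitely many moments suffice: modulo an annihilating polynomial of A, every power of A is a
  polynomial in A of smaller degree.
\<close>

lemma moments_left_inverse: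
  assumes t: "t \<noteq> 0" and A: "A \<in> carrier_mat N N" and C: "C \<in> carrier_mat n N"
    and inj: "\<And>h. h \<in> carrier_mat N 1 \<Longrightarrow> (\<And>k. C \<star>\<^bsub>t\<^esub> ht_mat_pow t A k \<star>\<^bsub>t\<^esub> h = 0\<^sub>m n 1) \<Longrightarrow> h = 0\<^sub>m N 1"
  shows "\<exists>K L. (\<forall>k. L k \<in> carrier_mat N n) \<and>
    ht_sum N N K (\<lambda>k. L k \<star>\<^bsub>t\<^esub> (C \<star>\<^bsub>t\<^esub> ht_mat_pow t A k)) = ht_one_mat N"
proof -
  have dims: "dim_row A = N" "dim_col A = N" "dim_row C = n" "dim_col C = N" using A C by auto
  obtain p where p: "p \<noteq> 0" "ht_poly t A p = 0\<^sub>m N N"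
    using annihilating_poly[of A t] dims by auto
  show ?thesis
  proof (intro exI[of _ "degree p"] common_left_inverse t)
    show "C \<star>\<^bsub>t\<^esub> ht_mat_pow t A k \<in> carrier_mat n N" for k
      using dims by (intro carrier_matI) simp_all
    fix h assume h: "h \<in> carrier_mat N 1"
      and van: "\<And>k. k < degree p \<Longrightarrow> C \<star>\<^bsub>t\<^esub> ht_mat_pow t A k \<star>\<^bsub>t\<^esub> h = 0\<^sub>m n 1"
    show "h = 0\<^sub>m N 1"
    proof (rule inj[OF h])
      fix k
      \<comment> \<open>A^k = r(A), and r has degree less than p\<close>
      define r where "r = monom 1 k mod p"
      have r: "r = 0 \<or> degree r < degree p"
        unfolding r_def by (rule degree_mod_less[OF p(1)])
      have "monom 1 k = (monom 1 k div p) * p + r" by (simp add: r_def)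
      then have "ht_mat_pow t A k = ht_poly t A ((monom 1 k div p) * p + r)"
        using ht_poly_monom[of A t k] dims by simp
      also have "\<dots> = 0\<^sub>m N N + ht_poly t A r"
        using dims ht_poly_multiple_zero[of A t p] p by (simp add: ht_poly_add)
      also have "\<dots> = ht_poly t A r" using dims by (intro eq_matI) simp_all
      finally show "C \<star>\<^bsub>t\<^esub> ht_mat_pow t A k \<star>\<^bsub>t\<^esub> h = 0\<^sub>m n 1"
        using ht_poly_kernel[of A C h "degree p" t r] dims h van r by simp
    qed
  qed
qed

text \<open>
  Controllability of (A, B) is observability of the adjoint pair.
\<close>

lemma moments_right_inverse:
  assumes t: "t \<noteq> 0" and A: "A \<in> carrier_mat N N" and B: "B \<in> carrier_mat N n"
    and ctrl: "controllable t n N A B"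
  shows "\<exists>K W. (\<forall>k. W k \<in> carrier_mat n N) \<and>
    ht_sum N N K (\<lambda>k. ht_mat_pow t A k \<star>\<^bsub>t\<^esub> B \<star>\<^bsub>t\<^esub> W k) = ht_one_mat N"
proof -
  have dims: "dim_row A = N" "dim_col A = N" "dim_row B = N" "dim_col B = n" using A B by auto
  have "\<exists>K L. (\<forall>k. L k \<in> carrier_mat N n) \<and>
    ht_sum N N K (\<lambda>k. L k \<star>\<^bsub>t\<^esub> (ht_adj B \<star>\<^bsub>t\<^esub> ht_mat_pow t (ht_adj A) k)) = ht_one_mat N"
  proof (rule moments_left_inverse[OF t])
    fix h assume h: "h \<in> carrier_mat N 1"
      and van: "\<And>k. ht_adj B \<star>\<^bsub>t\<^esub> ht_mat_pow t (ht_adj A) k \<star>\<^bsub>t\<^esub> h = 0\<^sub>m n 1"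
    have "ht_adj h \<star>\<^bsub>t\<^esub> ht_mat_pow t A k \<star>\<^bsub>t\<^esub> B = 0\<^sub>m 1 n" for k
    proof -
      have "ht_adj (ht_adj B \<star>\<^bsub>t\<^esub> ht_mat_pow t (ht_adj A) k \<star>\<^bsub>t\<^esub> h) =
          ht_adj h \<star>\<^bsub>t\<^esub> ht_mat_pow t A k \<star>\<^bsub>t\<^esub> B"
        using dims h by (simp add: ht_adj_mult ht_adj_pow ht_assoc)
      then show ?thesis by (simp add: van)
    qed
    moreover have "ht_adj h \<in> carrier_mat 1 N" using h by (intro carrier_matI) auto
    ultimately have "ht_adj h = 0\<^sub>m 1 N" using ctrl by (auto simp: controllable_def)
    then have "ht_adj (ht_adj h) = 0\<^sub>m N 1" by simp
    then show "h = 0\<^sub>m N 1" by simp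
  qed (use dims in \<open>auto intro!: carrier_matI\<close>)
  then obtain K L where L: "\<And>k. L k \<in> carrier_mat N n"
    and sum: "ht_sum N N K (\<lambda>k. L k \<star>\<^bsub>t\<^esub> (ht_adj B \<star>\<^bsub>t\<^esub> ht_mat_pow t (ht_adj A) k)) = ht_one_mat N"
    by blast
  have dL [simp]: "dim_row (L k) = N" "dim_col (L k) = n" for k using L[of k] by auto
  have "ht_one_mat N = ht_sum N N K (\<lambda>k. ht_adj (L k \<star>\<^bsub>t\<^esub> (ht_adj B \<star>\<^bsub>t\<^esub> ht_mat_pow t (ht_adj A) k)))"
    using arg_cong[OF sum, of ht_adj] dims
    by (subst (asm) ht_sum_adj[of _ N N]) (auto intro!: carrier_matI)
  also have "\<dots> = ht_sum N N K (\<lambda>k. ht_mat_pow t A k \<star>\<^bsub>t\<^esub> B \<star>\<^bsub>t\<^esub> ht_adj (L k))"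
    using dims by (intro ht_sum_cong) (simp add: ht_adj_mult ht_adj_pow)
  finally show ?thesis
    by (intro exI[of _ K] exI[of _ "\<lambda>k. ht_adj (L k)"]) (auto intro!: carrier_matI)
qed

lemma finite_avoid_interval:
  fixes F :: "real set"
  assumes "finite F" "0 \<notin> F"
  shows "\<exists>\<epsilon>>0. \<forall>x. \<bar>x\<bar> < \<epsilon> \<longrightarrow> x \<notin> F"
proof -
  have "open (- F)" using finite_imp_closed[OF assms(1)] by (simp add: open_closed)
  then obtain e where "e > 0" "\<And>y. dist y 0 < e \<Longrightarrow> y \<in> - F"
    using assms(2) unfolding open_dist by blast
  then show ?thesis by (intro exI[of _ e]) (auto simp: dist_real_def)
qed

text \<open>
  If all moments C A^k h vanish, so does C(I - xA)^-1 h near the origin, because the resolvent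
  is a polynomial in A there; this connects the definition of observability with the moments.
\<close>

lemma observable_moments:
  assumes A: "A \<in> carrier_mat N N" and C: "C \<in> carrier_mat n N"
    and obs: "observable t n N C A" and h: "h \<in> carrier_mat N 1"
    and van: "\<And>k. C \<star>\<^bsub>t\<^esub> ht_mat_pow t A k \<star>\<^bsub>t\<^esub> h = 0\<^sub>m n 1"
  shows "h = 0\<^sub>m N 1"
proof -
  have dims: "dim_row A = N" "dim_col A = N" "dim_row C = n" "dim_col C = N" using A C by auto
  obtain F where F: "finite F" "0 \<notin> F"
    and inv: "\<And>x. x \<notin> F \<Longrightarrow> \<exists>q. ht_is_inverse t N (pencil N A x) (ht_poly t A q)"
    using pencil_inverse_poly_cofinite[OF A] by blast
  obtain \<epsilon> where \<epsilon>: "\<epsilon> > 0" "\<And>x. \<bar>x\<bar> < \<epsilon> \<Longrightarrow> x \<notin> F"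
    using finite_avoid_interval[OF F] by blast
  have "ht_invertible t N (pencil N A x) \<and>
      C \<star>\<^bsub>t\<^esub> ht_inverse t N (pencil N A x) \<star>\<^bsub>t\<^esub> h = 0\<^sub>m n 1" if x: "\<bar>x\<bar> < \<epsilon>" for x
  proof -
    obtain q where q: "ht_is_inverse t N (pencil N A x) (ht_poly t A q)"
      using inv[OF \<epsilon>(2)[OF x]] by blast
    have "C \<star>\<^bsub>t\<^esub> ht_poly t A q \<star>\<^bsub>t\<^esub> h = 0\<^sub>m n 1"
      using ht_poly_kernel[of A C h "Suc (degree q)" t q] dims h van by simp
    then show ?thesis using q ht_inverse_eq[OF q] by (auto simp: ht_invertible_def)
  qed
  then show ?thesis using obs h \<epsilon>(1) unfolding observable_def by blast
qed

section \<open>Limits of matrix functions and of the resolvent\<close>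

text \<open>
  Entrywise convergence. The functions of interest have the right dimensions only where an inverse
  exists, so this is required only eventually.
\<close>

definition ht_tendsto :: "nat \<Rightarrow> nat \<Rightarrow> ('a \<Rightarrow> ht mat) \<Rightarrow> ht mat \<Rightarrow> 'a filter \<Rightarrow> bool" where
  "ht_tendsto m n F M fl \<longleftrightarrow> M \<in> carrier_mat m n \<and> (\<forall>\<^sub>F x in fl. F x \<in> carrier_mat m n) \<and>
     (\<forall>i<m. \<forall>k<n. ((\<lambda>x. F x $$ (i, k)) \<longlongrightarrow> M $$ (i, k)) fl)"

lemma ht_tendsto_const: "M \<in> carrier_mat m n \<Longrightarrow> ht_tendsto m n (\<lambda>_. M) M fl"
  by (simp add: ht_tendsto_def)

lemma ht_tendsto_cong:
  assumes F: "ht_tendsto m n F M fl" and eq: "\<forall>\<^sub>F x in fl. F x = G x"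
  shows "ht_tendsto m n G M fl"
  unfolding ht_tendsto_def
proof (intro conjI allI impI)
  show "M \<in> carrier_mat m n" using F by (simp add: ht_tendsto_def)
  have "\<forall>\<^sub>F x in fl. F x \<in> carrier_mat m n" using F by (simp add: ht_tendsto_def)
  with eq show "\<forall>\<^sub>F x in fl. G x \<in> carrier_mat m n" by eventually_elim simp
  fix i k assume "i < m" "k < n"
  then have "((\<lambda>x. F x $$ (i, k)) \<longlongrightarrow> M $$ (i, k)) fl" using F by (simp add: ht_tendsto_def)
  moreover have "\<forall>\<^sub>F x in fl. F x $$ (i, k) = G x $$ (i, k)"
    using eq by eventually_elim simp
  ultimately show "((\<lambda>x. G x $$ (i, k)) \<longlongrightarrow> M $$ (i, k)) fl"
    by (rule Lim_transform_eventually)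
qed

lemma ht_tendsto_mult:
  assumes F: "ht_tendsto m n F M fl" and G: "ht_tendsto n k G P fl"
  shows "ht_tendsto m k (\<lambda>x. F x \<star>\<^bsub>t\<^esub> G x) (M \<star>\<^bsub>t\<^esub> P) fl"
proof -
  have c: "\<forall>\<^sub>F x in fl. F x \<in> carrier_mat m n \<and> G x \<in> carrier_mat n k"
    using F G by (simp add: ht_tendsto_def eventually_conj_iff)
  have M: "M \<in> carrier_mat m n" "P \<in> carrier_mat n k" using F G by (simp_all add: ht_tendsto_def)
  have "((\<lambda>x. (F x \<star>\<^bsub>t\<^esub> G x) $$ (i, j)) \<longlongrightarrow> (M \<star>\<^bsub>t\<^esub> P) $$ (i, j)) fl" if "i < m" "j < k" for i j
  proof -
    have "((\<lambda>x. \<Sum>l<n. ht_mult t (F x $$ (i, l)) (G x $$ (l, j))) \<longlongrightarrow>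
        (\<Sum>l<n. ht_mult t (M $$ (i, l)) (P $$ (l, j)))) fl"
      using F G that by (intro tendsto_sum ht.tendsto) (auto simp: ht_tendsto_def)
    moreover have "\<forall>\<^sub>F x in fl. (\<Sum>l<n. ht_mult t (F x $$ (i, l)) (G x $$ (l, j))) =
        (F x \<star>\<^bsub>t\<^esub> G x) $$ (i, j)"
      using c by eventually_elim (use that in \<open>auto simp: ht_mult_index\<close>)
    ultimately show ?thesis
      using M that by (auto simp: ht_mult_index intro: Lim_transform_eventually)
  qed
  moreover have "\<forall>\<^sub>F x in fl. F x \<star>\<^bsub>t\<^esub> G x \<in> carrier_mat m k"
    using c by eventually_elim auto
  moreover have "M \<star>\<^bsub>t\<^esub> P \<in> carrier_mat m k" using M by (rule ht_mult_carrier)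
  ultimately show ?thesis by (simp add: ht_tendsto_def)
qed

lemma ht_tendsto_add:
  assumes F: "ht_tendsto m n F M fl" and G: "ht_tendsto m n G P fl"
  shows "ht_tendsto m n (\<lambda>x. F x + G x) (M + P) fl"
proof -
  have c: "\<forall>\<^sub>F x in fl. F x \<in> carrier_mat m n \<and> G x \<in> carrier_mat m n"
    using F G by (simp add: ht_tendsto_def eventually_conj_iff)
  have M: "M \<in> carrier_mat m n" "P \<in> carrier_mat m n" using F G by (simp_all add: ht_tendsto_def)
  have "((\<lambda>x. (F x + G x) $$ (i, j)) \<longlongrightarrow> (M + P) $$ (i, j)) fl" if "i < m" "j < n" for i j
  proof -
    have "((\<lambda>x. F x $$ (i, j) + G x $$ (i, j)) \<longlongrightarrow> M $$ (i, j) + P $$ (i, j)) fl"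
      using F G that by (intro tendsto_add) (auto simp: ht_tendsto_def)
    moreover have "\<forall>\<^sub>F x in fl. F x $$ (i, j) + G x $$ (i, j) = (F x + G x) $$ (i, j)"
      using c by eventually_elim (use that in auto)
    ultimately show ?thesis
      using M that by (auto intro: Lim_transform_eventually)
  qed
  moreover have "\<forall>\<^sub>F x in fl. F x + G x \<in> carrier_mat m n"
    using c by eventually_elim auto
  ultimately show ?thesis using M by (simp add: ht_tendsto_def)
qed

lemma ht_tendsto_scale:
  assumes F: "ht_tendsto m n F M fl" and f: "(f \<longlongrightarrow> c) fl"
  shows "ht_tendsto m n (\<lambda>x. ht_scale_mat (f x) (F x)) (ht_scale_mat c M) fl"
proof -
  have c: "\<forall>\<^sub>F x in fl. F x \<in> carrier_mat m n" and M: "M \<in> carrier_mat m n"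
    using F by (simp_all add: ht_tendsto_def)
  have "((\<lambda>x. ht_scale_mat (f x) (F x) $$ (i, j)) \<longlongrightarrow> ht_scale_mat c M $$ (i, j)) fl"
    if "i < m" "j < n" for i j
  proof -
    have "((\<lambda>x. f x *\<^sub>R F x $$ (i, j)) \<longlongrightarrow> c *\<^sub>R M $$ (i, j)) fl"
      using F f that by (intro tendsto_scaleR) (auto simp: ht_tendsto_def)
    moreover have "\<forall>\<^sub>F x in fl. f x *\<^sub>R F x $$ (i, j) = ht_scale_mat (f x) (F x) $$ (i, j)"
      using c by eventually_elim (use that in auto)
    ultimately show ?thesis
      using M that by (auto intro: Lim_transform_eventually)
  qed
  moreover have "\<forall>\<^sub>F x in fl. ht_scale_mat (f x) (F x) \<in> carrier_mat m n"
    using c by eventually_elim auto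
  moreover have "ht_scale_mat c M \<in> carrier_mat m n" using M by auto
  ultimately show ?thesis by (simp add: ht_tendsto_def)
qed

lemma ht_tendsto_adj:
  assumes F: "ht_tendsto m n F M fl"
  shows "ht_tendsto n m (\<lambda>x. ht_adj (F x)) (ht_adj M) fl"
proof -
  have c: "\<forall>\<^sub>F x in fl. F x \<in> carrier_mat m n" and M: "M \<in> carrier_mat m n"
    using F by (simp_all add: ht_tendsto_def)
  have "((\<lambda>x. ht_adj (F x) $$ (i, j)) \<longlongrightarrow> ht_adj M $$ (i, j)) fl" if "i < n" "j < m" for i j
  proof -
    have "((\<lambda>x. ht_conj (F x $$ (j, i))) \<longlongrightarrow> ht_conj (M $$ (j, i))) fl"
      using F that
      by (intro bounded_linear.tendsto[OF bounded_linear_ht_conj]) (auto simp: ht_tendsto_def)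
    moreover have "\<forall>\<^sub>F x in fl. ht_conj (F x $$ (j, i)) = ht_adj (F x) $$ (i, j)"
      using c by eventually_elim (use that in auto)
    ultimately show ?thesis
      using M that by (auto intro: Lim_transform_eventually)
  qed
  moreover have "\<forall>\<^sub>F x in fl. ht_adj (F x) \<in> carrier_mat n m"
    using c by eventually_elim auto
  moreover have "ht_adj M \<in> carrier_mat n m" using M by auto
  ultimately show ?thesis by (simp add: ht_tendsto_def)
qed

lemma ht_tendsto_sum:
  assumes "\<And>k. ht_tendsto m n (F k) (M k) fl"
  shows "ht_tendsto m n (\<lambda>x. ht_sum m n K (\<lambda>k. F k x)) (ht_sum m n K M) fl"
  using assms by (auto simp: ht_tendsto_def ht_sum_carrier intro!: tendsto_sum)

lemma ht_tendsto_unique: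
  assumes "ht_tendsto m n F M fl" "ht_tendsto m n F P fl" "fl \<noteq> bot"
  shows "M = P"
proof (rule eq_matI)
  show "dim_row M = dim_row P" "dim_col M = dim_col P" using assms by (auto simp: ht_tendsto_def)
  fix i j assume "i < dim_row P" "j < dim_col P"
  then have "i < m" "j < n" using assms by (auto simp: ht_tendsto_def)
  then show "M $$ (i, j) = P $$ (i, j)"
    using assms tendsto_unique[of fl "\<lambda>x. F x $$ (i, j)"] by (simp add: ht_tendsto_def)
qed

lemma resolvent_expand:
  assumes "A \<in> carrier_mat N N" "ht_is_inverse t N (pencil N A x) P"
  shows "P = ht_one_mat N + ht_scale_mat x (A \<star>\<^bsub>t\<^esub> P)" "P = ht_one_mat N + ht_scale_mat x (P \<star>\<^bsub>t\<^esub> A)"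
proof -
  have d: "dim_row A = N" "dim_col A = N" "dim_row P = N" "dim_col P = N"
    using assms by (auto simp: ht_is_inverse_def)
  have e: "P - ht_scale_mat x (A \<star>\<^bsub>t\<^esub> P) = ht_one_mat N" "P - ht_scale_mat x (P \<star>\<^bsub>t\<^esub> A) = ht_one_mat N"
    using assms(2) d
    by (simp_all add: ht_is_inverse_def pencil_def ht_diff_left ht_diff_right ht_scale_left ht_scale_right)
  show "P = ht_one_mat N + ht_scale_mat x (A \<star>\<^bsub>t\<^esub> P)"
    unfolding e(1)[symmetric] by (rule eq_matI) (use d in auto)
  show "P = ht_one_mat N + ht_scale_mat x (P \<star>\<^bsub>t\<^esub> A)"
    unfolding e(2)[symmetric] by (rule eq_matI) (use d in auto)
qed

lemma resolvent_scaled: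
  assumes "A \<in> carrier_mat N N" "ht_is_inverse t N (pencil N A x) P" "x \<noteq> 0"
  shows "A \<star>\<^bsub>t\<^esub> P = ht_scale_mat (inverse x) (P - ht_one_mat N)"
    and "P \<star>\<^bsub>t\<^esub> A = ht_scale_mat (inverse x) (P - ht_one_mat N)"
proof -
  have d: "dim_row A = N" "dim_col A = N" "dim_row P = N" "dim_col P = N"
    using assms by (auto simp: ht_is_inverse_def)
  have "P - ht_one_mat N = ht_scale_mat x (A \<star>\<^bsub>t\<^esub> P)"
    by (subst (1) resolvent_expand(1)[OF assms(1,2)]) (rule eq_matI, use d in auto)
  then show "A \<star>\<^bsub>t\<^esub> P = ht_scale_mat (inverse x) (P - ht_one_mat N)"
    using assms(3) by simp
  have "P - ht_one_mat N = ht_scale_mat x (P \<star>\<^bsub>t\<^esub> A)"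
    by (subst (1) resolvent_expand(2)[OF assms(1,2)]) (rule eq_matI, use d in auto)
  then show "P \<star>\<^bsub>t\<^esub> A = ht_scale_mat (inverse x) (P - ht_one_mat N)"
    using assms(3) by simp
qed

lemma eventually_pencil_inverse_at_0:
  assumes "A \<in> carrier_mat N N"
  shows "\<forall>\<^sub>F x in at 0. ht_is_inverse t N (pencil N A x) (ht_inverse t N (pencil N A x))"
proof -
  obtain e where "e > 0" "\<forall>x. \<bar>x\<bar> < e \<longrightarrow> x \<notin> {x. \<not> ht_invertible t N (pencil N A x)} - {0}"
    using finite_avoid_interval[of "{x. \<not> ht_invertible t N (pencil N A x)} - {0}"]
      finite_singular_pencil[OF assms, of t] by auto
  then show ?thesis
    by (auto simp: eventually_at dist_real_def intro!: exI[of _ e] ht_inverse_is_inverse)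
qed

lemma eventually_pencil_inverse_at_infinity:
  assumes "A \<in> carrier_mat N N"
  shows "\<forall>\<^sub>F x in at_infinity. ht_is_inverse t N (pencil N A x) (ht_inverse t N (pencil N A x))"
proof -
  define b where "b = (\<Sum>x | \<not> ht_invertible t N (pencil N A x). \<bar>x\<bar>)"
  have b: "\<bar>x\<bar> \<le> b" if "\<not> ht_invertible t N (pencil N A x)" for x
    unfolding b_def using finite_singular_pencil[OF assms, of t] that
    by (intro member_le_sum[of x _ abs]) auto
  have "\<forall>\<^sub>F x :: real in at_infinity. b + 1 \<le> norm x"
    by (auto simp: eventually_at_infinity)
  then show ?thesis
    by eventually_elim (use b in \<open>force intro: ht_inverse_is_inverse\<close>)
qed

text \<open>
  Let b be the sum of the norms of the entries of P = (I - xA)^-1. From P = I + xAP one gets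
  b \<le> u + b/2 for small x, where u is the same quantity for I. So P stays bounded, and
  P - I = xAP tends to 0.
\<close>

lemma resolvent_tendsto_one:
  assumes A: "A \<in> carrier_mat N N"
  shows "ht_tendsto N N (\<lambda>x. ht_inverse t N (pencil N A x)) (ht_one_mat N) (at 0)"
proof -
  let ?L = "\<lambda>x. ht_inverse t N (pencil N A x)"
  obtain K where K: "K > 0" "\<And>p q. norm (ht_mult t p q) \<le> norm p * norm q * K"
    using ht.pos_bounded by blast
  define a where "a = (\<Sum>i<N. \<Sum>l<N. norm (A $$ (i, l)))"
  define u where "u = (\<Sum>i<N. \<Sum>j<N. norm (ht_one_mat N $$ (i, j)))"
  \<comment> \<open>for |x| < \<delta> the contribution of xAP to b is at most b/2\<close>
  define \<delta> where "\<delta> = 1 / (2 * (N * N * (a * K) + 1))"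
  have a0: "a \<ge> 0" by (simp add: a_def sum_nonneg)
  have d0: "\<delta> > 0" using a0 K(1) by (simp add: \<delta>_def add_nonneg_pos)
  have inv: "\<forall>\<^sub>F x in at 0. ht_is_inverse t N (pencil N A x) (?L x)"
    by (rule eventually_pencil_inverse_at_0[OF A])
  have small: "\<forall>\<^sub>F x in at (0::real). \<bar>x\<bar> < \<delta>"
    using d0 by (auto simp: eventually_at dist_real_def intro!: exI[of _ \<delta>])
  have bnd: "\<forall>\<^sub>F x in at 0. \<forall>i<N. \<forall>j<N.
      norm (?L x $$ (i, j) - ht_one_mat N $$ (i, j)) \<le> \<bar>x\<bar> * (a * K * (2 * u))"
    using inv small
  proof eventually_elim
    case (elim x)
    define b where "b = (\<Sum>i<N. \<Sum>j<N. norm (?L x $$ (i, j)))"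
    have d: "dim_row A = N" "dim_col A = N" "dim_row (?L x) = N" "dim_col (?L x) = N"
      using elim(1) A by (auto simp: ht_is_inverse_def)
    have b0: "b \<ge> 0" by (simp add: b_def sum_nonneg)
    have entry: "norm (?L x $$ (i, j) - ht_one_mat N $$ (i, j)) \<le> \<bar>x\<bar> * (a * K * b)"
      if ij: "i < N" "j < N" for i j
    proof -
      have "?L x $$ (i, j) = ht_one_mat N $$ (i, j) + x *\<^sub>R (A \<star>\<^bsub>t\<^esub> ?L x) $$ (i, j)"
        by (subst (1) resolvent_expand(1)[OF A elim(1)]) (use d ij in simp)
      then have norm_eq: "norm (?L x $$ (i, j) - ht_one_mat N $$ (i, j)) = \<bar>x\<bar> * norm ((A \<star>\<^bsub>t\<^esub> ?L x) $$ (i, j))"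
        by simp
      have "norm ((A \<star>\<^bsub>t\<^esub> ?L x) $$ (i, j)) \<le>
          (\<Sum>l<N. norm (ht_mult t (A $$ (i, l)) (?L x $$ (l, j))))"
        using d ij by (simp add: ht_mult_index norm_sum)
      also have "\<dots> \<le> (\<Sum>l<N. norm (A $$ (i, l)) * b * K)"
      proof (rule sum_mono)
        fix l assume l: "l \<in> {..<N}"
        have "norm (?L x $$ (l, j)) \<le> (\<Sum>j<N. norm (?L x $$ (l, j)))"
          using ij by (intro member_le_sum) auto
        also have "\<dots> \<le> b" unfolding b_def
          using l by (intro member_le_sum[of l _ "\<lambda>l. \<Sum>j<N. norm (?L x $$ (l, j))"]) (auto intro: sum_nonneg)
        finally have "norm (A $$ (i, l)) * norm (?L x $$ (l, j)) * K \<le> norm (A $$ (i, l)) * b * K"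
          using K(1) by (intro mult_right_mono mult_left_mono) auto
        then show "norm (ht_mult t (A $$ (i, l)) (?L x $$ (l, j))) \<le> norm (A $$ (i, l)) * b * K"
          using K(2) order_trans by blast
      qed
      also have "\<dots> = (\<Sum>l<N. norm (A $$ (i, l))) * (b * K)"
        by (simp add: sum_distrib_right mult.assoc)
      also have "\<dots> \<le> a * (b * K)"
        unfolding a_def using K(1) b0 ij
        by (intro mult_right_mono member_le_sum[of i _ "\<lambda>i. \<Sum>l<N. norm (A $$ (i, l))"])
          (auto intro: sum_nonneg)
      finally have "\<bar>x\<bar> * norm ((A \<star>\<^bsub>t\<^esub> ?L x) $$ (i, j)) \<le> \<bar>x\<bar> * (a * (b * K))"
        by (simp add: mult_left_mono)
      with norm_eq show ?thesis by (simp add: ac_simps)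
    qed
    have "norm (?L x $$ (i, j)) \<le> norm (ht_one_mat N $$ (i, j)) + \<bar>x\<bar> * (a * K * b)"
      if "i < N" "j < N" for i j
      using entry[OF that] norm_triangle_sub[of "?L x $$ (i, j)" "ht_one_mat N $$ (i, j)"] by linarith
    then have "b \<le> (\<Sum>i<N. \<Sum>j<N. norm (ht_one_mat N $$ (i, j)) + \<bar>x\<bar> * (a * K * b))"
      by (subst (1) b_def) (intro sum_mono, auto)
    also have "\<dots> = u + \<bar>x\<bar> * (N * N * (a * K)) * b"
      by (simp add: sum.distrib u_def algebra_simps)
    also have "\<dots> \<le> u + 1 / 2 * b"
    proof -
      have "\<bar>x\<bar> * (N * N * (a * K)) \<le> \<delta> * (N * N * (a * K) + 1)"
        using elim(2) a0 K(1) by (intro mult_mono) auto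
      also have "\<dots> = 1 / 2"
      proof -
        have "N * N * (a * K) + 1 > 0" using a0 K(1) by (simp add: add_nonneg_pos)
        then show ?thesis by (simp add: \<delta>_def field_simps)
      qed
      finally show ?thesis using b0 by (intro add_left_mono mult_right_mono)
    qed
    finally have "b \<le> 2 * u" by simp
    then have "\<bar>x\<bar> * (a * K * b) \<le> \<bar>x\<bar> * (a * K * (2 * u))"
      using a0 K(1) by (intro mult_left_mono) auto
    then show ?case using entry order_trans by blast
  qed
  have "((\<lambda>x. ?L x $$ (i, j)) \<longlongrightarrow> ht_one_mat N $$ (i, j)) (at 0)" if "i < N" "j < N" for i j
  proof (rule LIM_zero_cancel, rule tendsto_0_le)
    show "\<forall>\<^sub>F x in at 0. norm (?L x $$ (i, j) - ht_one_mat N $$ (i, j)) \<le> norm x * (a * K * (2 * u))"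
      using bnd by eventually_elim (use that in auto)
    show "((\<lambda>x::real. x) \<longlongrightarrow> 0) (at 0)"
      by (rule tendsto_ident_at)
  qed
  moreover have "\<forall>\<^sub>F x in at 0. ?L x \<in> carrier_mat N N"
    using inv by eventually_elim (simp add: ht_is_inverse_def)
  ultimately show ?thesis by (simp add: ht_tendsto_def) (intro carrier_matI, simp_all)
qed

section \<open>Regularity at infinity and the system matrix\<close>

text \<open>
  Since A(I - yA)^-1 = (I - yA)^-1A = ((I - yA)^-1 - I)/y, inserting a factor A next to the resolvent
  preserves convergence to 0 at infinity.
\<close>

lemma resolvent_step_tendsto:
  assumes A: "A \<in> carrier_mat N N" and X: "X \<in> carrier_mat m N" and Y: "Y \<in> carrier_mat N k"
    and lim: "ht_tendsto m k (\<lambda>y. X \<star>\<^bsub>t\<^esub> ht_inverse t N (pencil N A y) \<star>\<^bsub>t\<^esub> Y) (0\<^sub>m m k) at_infinity"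
  shows "ht_tendsto m k (\<lambda>y. X \<star>\<^bsub>t\<^esub> A \<star>\<^bsub>t\<^esub> ht_inverse t N (pencil N A y) \<star>\<^bsub>t\<^esub> Y) (0\<^sub>m m k) at_infinity"
    and "ht_tendsto m k (\<lambda>y. X \<star>\<^bsub>t\<^esub> ht_inverse t N (pencil N A y) \<star>\<^bsub>t\<^esub> (A \<star>\<^bsub>t\<^esub> Y)) (0\<^sub>m m k) at_infinity"
proof -
  let ?L = "\<lambda>y. ht_inverse t N (pencil N A y)"
  let ?F = "\<lambda>y. ht_scale_mat (inverse y) (X \<star>\<^bsub>t\<^esub> ?L y \<star>\<^bsub>t\<^esub> Y + ht_scale_mat (- 1) (X \<star>\<^bsub>t\<^esub> Y))"
  have d: "dim_row A = N" "dim_col A = N" "dim_row X = m" "dim_col X = N" "dim_row Y = N" "dim_col Y = k"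
    using A X Y by auto
  have c: "ht_scale_mat (- 1) (X \<star>\<^bsub>t\<^esub> Y) \<in> carrier_mat m k"
    using d by (intro carrier_matI) simp_all
  have "ht_tendsto m k ?F (ht_scale_mat 0 (0\<^sub>m m k + ht_scale_mat (- 1) (X \<star>\<^bsub>t\<^esub> Y))) at_infinity"
    by (intro ht_tendsto_scale ht_tendsto_add ht_tendsto_const lim c tendsto_inverse_0)
  moreover have "ht_scale_mat 0 (0\<^sub>m m k + ht_scale_mat (- 1) (X \<star>\<^bsub>t\<^esub> Y)) = 0\<^sub>m m k"
    by (rule eq_matI) (use d in simp_all)
  ultimately have F: "ht_tendsto m k ?F (0\<^sub>m m k) at_infinity" by simp
  have nz: "\<forall>\<^sub>F y :: real in at_infinity. y \<noteq> 0"
    by (rule eventually_at_infinityI[of 1]) auto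
  have ev: "\<forall>\<^sub>F y in at_infinity. ?F y = X \<star>\<^bsub>t\<^esub> A \<star>\<^bsub>t\<^esub> ?L y \<star>\<^bsub>t\<^esub> Y \<and> ?F y = X \<star>\<^bsub>t\<^esub> ?L y \<star>\<^bsub>t\<^esub> (A \<star>\<^bsub>t\<^esub> Y)"
    using eventually_pencil_inverse_at_infinity[OF A, of t] nz
  proof eventually_elim
    case (elim y)
    have dL: "dim_row (?L y) = N" "dim_col (?L y) = N" using elim(1) by (auto simp: ht_is_inverse_def)
    have F_eq: "X \<star>\<^bsub>t\<^esub> ht_scale_mat (inverse y) (?L y - ht_one_mat N) \<star>\<^bsub>t\<^esub> Y = ?F y"
      using d dL
      by (intro eq_matI) (simp_all add: ht_scale_right ht_scale_left ht_diff_left ht_diff_right)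
    have "X \<star>\<^bsub>t\<^esub> A \<star>\<^bsub>t\<^esub> ?L y \<star>\<^bsub>t\<^esub> Y = X \<star>\<^bsub>t\<^esub> (A \<star>\<^bsub>t\<^esub> ?L y) \<star>\<^bsub>t\<^esub> Y"
      and "X \<star>\<^bsub>t\<^esub> ?L y \<star>\<^bsub>t\<^esub> (A \<star>\<^bsub>t\<^esub> Y) = X \<star>\<^bsub>t\<^esub> (?L y \<star>\<^bsub>t\<^esub> A) \<star>\<^bsub>t\<^esub> Y"
      using d dL by (simp_all add: ht_assoc)
    then show ?case
      using F_eq by (simp only: resolvent_scaled[OF A elim])
  qed
  show "ht_tendsto m k (\<lambda>y. X \<star>\<^bsub>t\<^esub> A \<star>\<^bsub>t\<^esub> ?L y \<star>\<^bsub>t\<^esub> Y) (0\<^sub>m m k) at_infinity"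
    by (rule ht_tendsto_cong[OF F]) (use ev in eventually_elim, blast)
  show "ht_tendsto m k (\<lambda>y. X \<star>\<^bsub>t\<^esub> ?L y \<star>\<^bsub>t\<^esub> (A \<star>\<^bsub>t\<^esub> Y)) (0\<^sub>m m k) at_infinity"
    by (rule ht_tendsto_cong[OF F]) (use ev in eventually_elim, blast)
qed

text \<open>
  Decay of C(I - yA)^-1B propagates to all C A^j(I - yA)^-1A^iB; the one-sided inverses of the
  observability and controllability matrices recover the resolvent from finitely many of these.
\<close>

lemma resolvent_vanishes_at_infinity:
  assumes A: "A \<in> carrier_mat N N" and B: "B \<in> carrier_mat N n" and C: "C \<in> carrier_mat n N"
    and L: "\<And>k. L k \<in> carrier_mat N n"
    and left: "ht_sum N N K (\<lambda>k. L k \<star>\<^bsub>t\<^esub> (C \<star>\<^bsub>t\<^esub> ht_mat_pow t A k)) = ht_one_mat N"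
    and W: "\<And>k. W k \<in> carrier_mat n N"
    and right: "ht_sum N N K' (\<lambda>k. ht_mat_pow t A k \<star>\<^bsub>t\<^esub> B \<star>\<^bsub>t\<^esub> W k) = ht_one_mat N"
    and lim: "ht_tendsto n n (\<lambda>y. C \<star>\<^bsub>t\<^esub> ht_inverse t N (pencil N A y) \<star>\<^bsub>t\<^esub> B) (0\<^sub>m n n) at_infinity"
  shows "ht_tendsto N N (\<lambda>y. ht_inverse t N (pencil N A y)) (0\<^sub>m N N) at_infinity"
proof -
  let ?L = "\<lambda>y. ht_inverse t N (pencil N A y)"
  have d [simp]: "dim_row A = N" "dim_col A = N" "dim_row B = N" "dim_col B = n" "dim_row C = n" "dim_col C = N"
    using A B C by auto
  have dL [simp]: "dim_row (L k) = N" "dim_col (L k) = n" "dim_row (W k) = n" "dim_col (W k) = N" for k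
    using L[of k] W[of k] by auto
  have cB: "ht_mat_pow t A i \<star>\<^bsub>t\<^esub> B \<in> carrier_mat N n" for i by (intro carrier_matI) simp_all
  have cC: "C \<star>\<^bsub>t\<^esub> ht_mat_pow t A j \<in> carrier_mat n N" for j by (intro carrier_matI) simp_all
  have 1: "ht_tendsto n n (\<lambda>y. C \<star>\<^bsub>t\<^esub> ?L y \<star>\<^bsub>t\<^esub> (ht_mat_pow t A i \<star>\<^bsub>t\<^esub> B)) (0\<^sub>m n n) at_infinity" for i
  proof (induct i)
    case 0
    then show ?case using lim by simp
  next
    case (Suc i)
    have "ht_mat_pow t A (Suc i) \<star>\<^bsub>t\<^esub> B = A \<star>\<^bsub>t\<^esub> (ht_mat_pow t A i \<star>\<^bsub>t\<^esub> B)"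
      unfolding ht_pow_Suc_left[OF trans[OF d(1) d(2)[symmetric]]] by (simp add: ht_assoc)
    then show ?case using resolvent_step_tendsto(2)[OF A C cB Suc] by simp
  qed
  have 2: "ht_tendsto n n (\<lambda>y. C \<star>\<^bsub>t\<^esub> ht_mat_pow t A j \<star>\<^bsub>t\<^esub> ?L y \<star>\<^bsub>t\<^esub> (ht_mat_pow t A i \<star>\<^bsub>t\<^esub> B)) (0\<^sub>m n n) at_infinity"
    for i j
  proof (induct j)
    case 0
    then show ?case using 1 by simp
  next
    case (Suc j)
    have "C \<star>\<^bsub>t\<^esub> ht_mat_pow t A (Suc j) = C \<star>\<^bsub>t\<^esub> ht_mat_pow t A j \<star>\<^bsub>t\<^esub> A"
      by (simp add: ht_assoc)
    then show ?case using resolvent_step_tendsto(1)[OF A cC cB Suc] by simp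
  qed
  have carr: "\<forall>\<^sub>F y in at_infinity. ?L y \<in> carrier_mat N N"
    using eventually_pencil_inverse_at_infinity[OF A, of t]
    by eventually_elim (simp add: ht_is_inverse_def)
  have 3: "ht_tendsto n N (\<lambda>y. C \<star>\<^bsub>t\<^esub> ht_mat_pow t A j \<star>\<^bsub>t\<^esub> ?L y) (0\<^sub>m n N) at_infinity" for j
  proof -
    let ?T = "\<lambda>i y. C \<star>\<^bsub>t\<^esub> ht_mat_pow t A j \<star>\<^bsub>t\<^esub> ?L y \<star>\<^bsub>t\<^esub> (ht_mat_pow t A i \<star>\<^bsub>t\<^esub> B) \<star>\<^bsub>t\<^esub> W i"
    have "ht_tendsto n N (\<lambda>y. ht_sum n N K' (\<lambda>i. ?T i y)) (ht_sum n N K' (\<lambda>i. 0\<^sub>m n n \<star>\<^bsub>t\<^esub> W i)) at_infinity"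
      by (intro ht_tendsto_sum ht_tendsto_mult[OF 2] ht_tendsto_const W)
    moreover have "ht_sum n N K' (\<lambda>i. 0\<^sub>m n n \<star>\<^bsub>t\<^esub> W i) = 0\<^sub>m n N"
      by (rule eq_matI) simp_all
    moreover have "\<forall>\<^sub>F y in at_infinity. ht_sum n N K' (\<lambda>i. ?T i y) = C \<star>\<^bsub>t\<^esub> ht_mat_pow t A j \<star>\<^bsub>t\<^esub> ?L y"
      using carr
    proof eventually_elim
      case (elim y)
      then have e [simp]: "dim_row (?L y) = N" "dim_col (?L y) = N" by auto
      have c: "ht_mat_pow t A i \<star>\<^bsub>t\<^esub> B \<star>\<^bsub>t\<^esub> W i \<in> carrier_mat N N" for i
        by (intro carrier_matI) simp_all
      have "C \<star>\<^bsub>t\<^esub> ht_mat_pow t A j \<star>\<^bsub>t\<^esub> ?L y =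
        C \<star>\<^bsub>t\<^esub> ht_mat_pow t A j \<star>\<^bsub>t\<^esub> ?L y \<star>\<^bsub>t\<^esub> ht_sum N N K' (\<lambda>k. ht_mat_pow t A k \<star>\<^bsub>t\<^esub> B \<star>\<^bsub>t\<^esub> W k)"
        by (simp add: right)
      also have "\<dots> = ht_sum n N K' (\<lambda>k. C \<star>\<^bsub>t\<^esub> ht_mat_pow t A j \<star>\<^bsub>t\<^esub> ?L y \<star>\<^bsub>t\<^esub> (ht_mat_pow t A k \<star>\<^bsub>t\<^esub> B \<star>\<^bsub>t\<^esub> W k))"
        using ht_sum_mult_left[where F = "\<lambda>k. ht_mat_pow t A k \<star>\<^bsub>t\<^esub> B \<star>\<^bsub>t\<^esub> W k", OF c] by simp
      also have "\<dots> = ht_sum n N K' (\<lambda>i. ?T i y)"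
        by (rule ht_sum_cong) (simp add: ht_assoc)
      finally show ?case by simp
    qed
    ultimately show ?thesis by (simp add: ht_tendsto_cong)
  qed
  let ?T = "\<lambda>j y. L j \<star>\<^bsub>t\<^esub> (C \<star>\<^bsub>t\<^esub> ht_mat_pow t A j \<star>\<^bsub>t\<^esub> ?L y)"
  have "ht_tendsto N N (\<lambda>y. ht_sum N N K (\<lambda>j. ?T j y)) (ht_sum N N K (\<lambda>j. L j \<star>\<^bsub>t\<^esub> 0\<^sub>m n N)) at_infinity"
    by (intro ht_tendsto_sum ht_tendsto_mult[OF _ 3] ht_tendsto_const L)
  moreover have "ht_sum N N K (\<lambda>j. L j \<star>\<^bsub>t\<^esub> 0\<^sub>m n N) = 0\<^sub>m N N"
    by (rule eq_matI) simp_all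
  moreover have "\<forall>\<^sub>F y in at_infinity. ht_sum N N K (\<lambda>j. ?T j y) = ?L y"
    using carr
  proof eventually_elim
    case (elim y)
    then have e [simp]: "dim_row (?L y) = N" "dim_col (?L y) = N" by auto
    have c: "L j \<star>\<^bsub>t\<^esub> (C \<star>\<^bsub>t\<^esub> ht_mat_pow t A j) \<in> carrier_mat N N" for j
      by (intro carrier_matI) simp_all
    have "?L y = ht_sum N N K (\<lambda>k. L k \<star>\<^bsub>t\<^esub> (C \<star>\<^bsub>t\<^esub> ht_mat_pow t A k)) \<star>\<^bsub>t\<^esub> ?L y"
      by (simp add: left)
    also have "\<dots> = ht_sum N N K (\<lambda>k. L k \<star>\<^bsub>t\<^esub> (C \<star>\<^bsub>t\<^esub> ht_mat_pow t A k) \<star>\<^bsub>t\<^esub> ?L y)"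
      using ht_sum_mult_right[where F = "\<lambda>k. L k \<star>\<^bsub>t\<^esub> (C \<star>\<^bsub>t\<^esub> ht_mat_pow t A k)", OF c] by simp
    also have "\<dots> = ht_sum N N K (\<lambda>j. ?T j y)"
      by (rule ht_sum_cong) (simp add: ht_assoc)
    finally show ?case by simp
  qed
  ultimately show ?thesis by (simp add: ht_tendsto_cong)
qed

text \<open>
  From hA = - gC and hB = - gD one computes g R(y) = - h(I - yA)^-1B and
  h = h(I - yA)^-1 + y gC(I - yA)^-1. Letting y grow in the first identity gives g = 0, and then the
  second one gives h = 0.
\<close>

lemma system_matrix_left_kernel:
  assumes A: "A \<in> carrier_mat N N" and B: "B \<in> carrier_mat N n" and C: "C \<in> carrier_mat n N"
    and D: "D \<in> carrier_mat n n"
    and h: "h \<in> carrier_mat 1 N" and g: "g \<in> carrier_mat 1 n"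
    and hA: "h \<star>\<^bsub>t\<^esub> A + g \<star>\<^bsub>t\<^esub> C = 0\<^sub>m 1 N" and hB: "h \<star>\<^bsub>t\<^esub> B + g \<star>\<^bsub>t\<^esub> D = 0\<^sub>m 1 n"
    and res: "ht_tendsto N N (\<lambda>y. ht_inverse t N (pencil N A y)) (0\<^sub>m N N) at_infinity"
    and lim: "ht_tendsto n n (\<lambda>y. D + ht_scale_mat y (C \<star>\<^bsub>t\<^esub> ht_inverse t N (pencil N A y) \<star>\<^bsub>t\<^esub> B)) Q at_infinity"
    and Q: "ht_invertible t n Q"
  shows "h = 0\<^sub>m 1 N" "g = 0\<^sub>m 1 n"
proof -
  let ?L = "\<lambda>y. ht_inverse t N (pencil N A y)"
  have d [simp]: "dim_row A = N" "dim_col A = N" "dim_row B = N" "dim_col B = n" "dim_row C = n" "dim_col C = N"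
    "dim_row D = n" "dim_col D = n" "dim_row h = 1" "dim_col h = N" "dim_row g = 1" "dim_col g = n"
    using A B C D h g by auto
  have gC: "g \<star>\<^bsub>t\<^esub> C = ht_scale_mat (- 1) (h \<star>\<^bsub>t\<^esub> A)" by (rule mat_add_eq_zero[OF hA]) simp_all
  have gD: "g \<star>\<^bsub>t\<^esub> D = ht_scale_mat (- 1) (h \<star>\<^bsub>t\<^esub> B)" by (rule mat_add_eq_zero[OF hB]) simp_all
  have gCX: "g \<star>\<^bsub>t\<^esub> (C \<star>\<^bsub>t\<^esub> X) = ht_scale_mat (- 1) (h \<star>\<^bsub>t\<^esub> (A \<star>\<^bsub>t\<^esub> X))" if "dim_row X = N" for X
    using arg_cong[OF gC, of "\<lambda>M. M \<star>\<^bsub>t\<^esub> X"] that by (simp add: ht_assoc ht_scale_left)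
  have ev: "\<forall>\<^sub>F y in at_infinity.
      g \<star>\<^bsub>t\<^esub> (D + ht_scale_mat y (C \<star>\<^bsub>t\<^esub> ?L y \<star>\<^bsub>t\<^esub> B)) = ht_scale_mat (- 1) (h \<star>\<^bsub>t\<^esub> ?L y \<star>\<^bsub>t\<^esub> B) \<and>
      h \<star>\<^bsub>t\<^esub> ?L y + ht_scale_mat y (g \<star>\<^bsub>t\<^esub> C \<star>\<^bsub>t\<^esub> ?L y) = h"
    using eventually_pencil_inverse_at_infinity[OF A, of t]
  proof eventually_elim
    case (elim y)
    have e [simp]: "dim_row (?L y) = N" "dim_col (?L y) = N" using elim by (auto simp: ht_is_inverse_def)
    have hL: "h \<star>\<^bsub>t\<^esub> ?L y = h + ht_scale_mat y (h \<star>\<^bsub>t\<^esub> (A \<star>\<^bsub>t\<^esub> ?L y))"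
      by (subst (1) resolvent_expand(1)[OF A elim]) (simp add: ht_add_right ht_scale_right)
    have hLB: "h \<star>\<^bsub>t\<^esub> (?L y \<star>\<^bsub>t\<^esub> B) = h \<star>\<^bsub>t\<^esub> B + ht_scale_mat y (h \<star>\<^bsub>t\<^esub> (A \<star>\<^bsub>t\<^esub> (?L y \<star>\<^bsub>t\<^esub> B)))"
      using arg_cong[OF hL, of "\<lambda>M. M \<star>\<^bsub>t\<^esub> B"] by (simp add: ht_assoc ht_add_left ht_scale_left)
    have "g \<star>\<^bsub>t\<^esub> (D + ht_scale_mat y (C \<star>\<^bsub>t\<^esub> ?L y \<star>\<^bsub>t\<^esub> B)) =
        ht_scale_mat (- 1) (h \<star>\<^bsub>t\<^esub> B) + ht_scale_mat (- y) (h \<star>\<^bsub>t\<^esub> (A \<star>\<^bsub>t\<^esub> (?L y \<star>\<^bsub>t\<^esub> B)))"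
      by (simp add: ht_add_right ht_scale_right ht_assoc gD gCX)
    also have "\<dots> = ht_scale_mat (- 1) (h \<star>\<^bsub>t\<^esub> (?L y \<star>\<^bsub>t\<^esub> B))"
      unfolding hLB by (rule eq_matI) (simp_all add: algebra_simps)
    finally have "g \<star>\<^bsub>t\<^esub> (D + ht_scale_mat y (C \<star>\<^bsub>t\<^esub> ?L y \<star>\<^bsub>t\<^esub> B)) = ht_scale_mat (- 1) (h \<star>\<^bsub>t\<^esub> ?L y \<star>\<^bsub>t\<^esub> B)"
      by (simp add: ht_assoc)
    moreover have "h \<star>\<^bsub>t\<^esub> ?L y + ht_scale_mat y (g \<star>\<^bsub>t\<^esub> C \<star>\<^bsub>t\<^esub> ?L y) = h"
      by (simp add: hL ht_assoc gCX) (rule eq_matI, simp_all)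
    ultimately show ?case by blast
  qed
  have nb: "(at_infinity :: real filter) \<noteq> bot"
    unfolding trivial_limit_def eventually_at_infinity by (metis abs_ge_self real_norm_def)
  have "ht_tendsto 1 n (\<lambda>y. ht_scale_mat (- 1) (h \<star>\<^bsub>t\<^esub> ?L y \<star>\<^bsub>t\<^esub> B)) (ht_scale_mat (- 1) (h \<star>\<^bsub>t\<^esub> 0\<^sub>m N N \<star>\<^bsub>t\<^esub> B)) at_infinity"
    by (intro ht_tendsto_scale ht_tendsto_mult[OF ht_tendsto_mult[OF _ res]] ht_tendsto_const h B tendsto_const)
  moreover have "ht_tendsto 1 n (\<lambda>y. ht_scale_mat (- 1) (h \<star>\<^bsub>t\<^esub> ?L y \<star>\<^bsub>t\<^esub> B)) (g \<star>\<^bsub>t\<^esub> Q) at_infinity"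
    by (rule ht_tendsto_cong[OF ht_tendsto_mult[OF ht_tendsto_const[OF g] lim]])
      (use ev in eventually_elim, blast)
  ultimately have gQ: "g \<star>\<^bsub>t\<^esub> Q = 0\<^sub>m 1 n"
    using ht_tendsto_unique[OF _ _ nb] by fastforce
  obtain P where P: "ht_is_inverse t n Q P" using Q by (auto simp: ht_invertible_def)
  then have dP [simp]: "dim_row Q = n" "dim_col Q = n" "dim_row P = n" "dim_col P = n"
    by (auto simp: ht_is_inverse_def)
  have "g = g \<star>\<^bsub>t\<^esub> (Q \<star>\<^bsub>t\<^esub> P)" using P by (simp add: ht_is_inverse_def)
  also have "\<dots> = g \<star>\<^bsub>t\<^esub> Q \<star>\<^bsub>t\<^esub> P" by (simp add: ht_assoc)
  finally show g0: "g = 0\<^sub>m 1 n" by (simp add: gQ)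
  have lim_h: "ht_tendsto 1 N (\<lambda>y. h \<star>\<^bsub>t\<^esub> ?L y) (h \<star>\<^bsub>t\<^esub> 0\<^sub>m N N) at_infinity"
    by (intro ht_tendsto_mult[OF _ res] ht_tendsto_const h)
  have ev_h: "\<forall>\<^sub>F y in at_infinity. h \<star>\<^bsub>t\<^esub> ?L y = h"
    using ev eventually_pencil_inverse_at_infinity[OF A, of t]
  proof eventually_elim
    case (elim y)
    have e [simp]: "dim_row (?L y) = N" "dim_col (?L y) = N" using elim(2) by (auto simp: ht_is_inverse_def)
    have "h \<star>\<^bsub>t\<^esub> ?L y + 0\<^sub>m 1 N = h" using elim(1) by (simp add: g0)
    moreover have "h \<star>\<^bsub>t\<^esub> ?L y + 0\<^sub>m 1 N = h \<star>\<^bsub>t\<^esub> ?L y" by (rule eq_matI) simp_all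
    ultimately show ?case by simp
  qed
  have "h = h \<star>\<^bsub>t\<^esub> 0\<^sub>m N N"
    by (rule ht_tendsto_unique[OF ht_tendsto_const[OF h] ht_tendsto_cong[OF lim_h ev_h] nb])
  then show "h = 0\<^sub>m 1 N" by simp
qed

lemma system_matrix_invertible:
  assumes A: "A \<in> carrier_mat N N" and B: "B \<in> carrier_mat N n" and C: "C \<in> carrier_mat n N"
    and D: "D \<in> carrier_mat n n"
    and ker: "\<And>h g. h \<in> carrier_mat 1 N \<Longrightarrow> g \<in> carrier_mat 1 n \<Longrightarrow>
      h \<star>\<^bsub>t\<^esub> A + g \<star>\<^bsub>t\<^esub> C = 0\<^sub>m 1 N \<Longrightarrow> h \<star>\<^bsub>t\<^esub> B + g \<star>\<^bsub>t\<^esub> D = 0\<^sub>m 1 n \<Longrightarrow>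
      h = 0\<^sub>m 1 N \<and> g = 0\<^sub>m 1 n"
  shows "ht_invertible t (N + n) (four_block_mat A B C D)"
proof -
  let ?M = "four_block_mat A B C D"
  have d [simp]: "dim_row A = N" "dim_col A = N" "dim_row B = N" "dim_col B = n" "dim_row C = n" "dim_col C = N"
    "dim_row D = n" "dim_col D = n"
    using A B C D by auto
  have "ht_invertible t (N + n) (ht_adj ?M)"
  proof (rule injective_imp_invertible)
    show "ht_adj ?M \<in> carrier_mat (N + n) (N + n)" by (intro carrier_matI) simp_all
    fix v assume v: "v \<in> carrier_mat (N + n) 1" and Mv: "ht_adj ?M \<star>\<^bsub>t\<^esub> v = 0\<^sub>m (N + n) 1"
    then have dv [simp]: "dim_row v = N + n" "dim_col v = 1" by auto
    define h where "h = mat 1 N (\<lambda>(_, j). ht_adj v $$ (0, j))"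
    define g where "g = mat 1 n (\<lambda>(_, j). ht_adj v $$ (0, N + j))"
    have hg: "h \<in> carrier_mat 1 N" "g \<in> carrier_mat 1 n" by (simp_all add: h_def g_def)
    have row: "ht_adj v = four_block_mat h g (0\<^sub>m 0 N) (0\<^sub>m 0 n)"
      by (rule eq_matI) (auto simp: h_def g_def)
    have "ht_adj v \<star>\<^bsub>t\<^esub> ?M = ht_adj (ht_adj ?M \<star>\<^bsub>t\<^esub> v)" by (simp add: ht_adj_mult)
    also have "\<dots> = 0\<^sub>m (1 + 0) (N + n)" by (simp add: Mv)
    finally have "ht_adj v \<star>\<^bsub>t\<^esub> ?M = four_block_mat (0\<^sub>m 1 N) (0\<^sub>m 1 n) (0\<^sub>m 0 N) (0\<^sub>m 0 n)"
      by simp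
    then have "four_block_mat (h \<star>\<^bsub>t\<^esub> A + g \<star>\<^bsub>t\<^esub> C) (h \<star>\<^bsub>t\<^esub> B + g \<star>\<^bsub>t\<^esub> D)
        (0\<^sub>m 0 N \<star>\<^bsub>t\<^esub> A + 0\<^sub>m 0 n \<star>\<^bsub>t\<^esub> C) (0\<^sub>m 0 N \<star>\<^bsub>t\<^esub> B + 0\<^sub>m 0 n \<star>\<^bsub>t\<^esub> D) =
        four_block_mat (0\<^sub>m 1 N) (0\<^sub>m 1 n) (0\<^sub>m 0 N) (0\<^sub>m 0 n)"
      unfolding row
      by (subst (asm) ht_four_block_mult[OF hg zero_carrier_mat zero_carrier_mat A B C D])
    note blocks = four_block_inject[OF _ _ _ _ _ _ _ _ this]
    have c: "h \<star>\<^bsub>t\<^esub> A + g \<star>\<^bsub>t\<^esub> C \<in> carrier_mat 1 N" "h \<star>\<^bsub>t\<^esub> B + g \<star>\<^bsub>t\<^esub> D \<in> carrier_mat 1 n"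
      "0\<^sub>m 0 N \<star>\<^bsub>t\<^esub> A + 0\<^sub>m 0 n \<star>\<^bsub>t\<^esub> C \<in> carrier_mat 0 N"
      "0\<^sub>m 0 N \<star>\<^bsub>t\<^esub> B + 0\<^sub>m 0 n \<star>\<^bsub>t\<^esub> D \<in> carrier_mat 0 n"
      using hg A B C D by (intro add_carrier_mat ht_mult_carrier; simp)+
    have "h \<star>\<^bsub>t\<^esub> A + g \<star>\<^bsub>t\<^esub> C = 0\<^sub>m 1 N" "h \<star>\<^bsub>t\<^esub> B + g \<star>\<^bsub>t\<^esub> D = 0\<^sub>m 1 n"
      by (rule blocks[OF c]; simp)+
    then have "h = 0\<^sub>m 1 N" "g = 0\<^sub>m 1 n" using ker[OF hg] by auto
    then have "ht_adj v = 0\<^sub>m 1 (N + n)" by (simp add: row)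
    then have "ht_adj (ht_adj v) = 0\<^sub>m (N + n) 1" by simp
    then show "v = 0\<^sub>m (N + n) 1" by simp
  qed
  then show ?thesis
    using ht_is_inverse_adj[of t "N + n" "ht_adj ?M"] by (auto simp: ht_invertible_def)
qed

section \<open>Taylor coefficients of a realization\<close>

lemma transfer_tendsto_0:
  assumes A: "A \<in> carrier_mat N N" and B: "B \<in> carrier_mat N n" and C: "C \<in> carrier_mat n N"
  shows "ht_tendsto n n (\<lambda>x. C \<star>\<^bsub>t\<^esub> ht_inverse t N (pencil N A x) \<star>\<^bsub>t\<^esub> B) (C \<star>\<^bsub>t\<^esub> B) (at 0)"
proof -
  have "ht_tendsto n n (\<lambda>x. C \<star>\<^bsub>t\<^esub> ht_inverse t N (pencil N A x) \<star>\<^bsub>t\<^esub> B) (C \<star>\<^bsub>t\<^esub> ht_one_mat N \<star>\<^bsub>t\<^esub> B) (at 0)"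
    by (intro ht_tendsto_mult[OF ht_tendsto_mult[OF _ resolvent_tendsto_one[OF A]]] ht_tendsto_const B C)
  then show ?thesis using C by simp
qed

lemma mat_add_left_cancel:
  fixes M P Q :: "ht mat"
  assumes eq: "M + P = M + Q" and "M \<in> carrier_mat m n" "P \<in> carrier_mat m n" "Q \<in> carrier_mat m n"
  shows "P = Q"
proof (rule eq_matI)
  fix i j assume "i < dim_row Q" "j < dim_col Q"
  moreover have "(M + P) $$ (i, j) = (M + Q) $$ (i, j)" by (simp add: eq)
  ultimately show "P $$ (i, j) = Q $$ (i, j)" using assms(2-4) by simp
qed (use assms in auto)

lemma ht_scale_cancel:
  assumes "ht_scale_mat x M = ht_scale_mat x P" "x \<noteq> 0"
  shows "M = P"
  using arg_cong[OF assms(1), of "ht_scale_mat (1 / x)"] assms(2) by simp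

text \<open>
  The identity C A^k P B = C A^kB + x C A^{k+1} P B for P = (I - xA)^-1 peels off one coefficient
  at a time, by taking the limit at 0 and then dividing by x.
\<close>

lemma markov_parameters_unique:
  assumes A: "A \<in> carrier_mat N N" and B: "B \<in> carrier_mat N n" and C: "C \<in> carrier_mat n N"
    and D: "D \<in> carrier_mat n n"
    and A': "A' \<in> carrier_mat N' N'" and B': "B' \<in> carrier_mat N' n" and C': "C' \<in> carrier_mat n N'"
    and D': "D' \<in> carrier_mat n n"
    and eq: "\<forall>\<^sub>F x in at 0. D + ht_scale_mat x (C \<star>\<^bsub>t\<^esub> ht_inverse t N (pencil N A x) \<star>\<^bsub>t\<^esub> B) =
      D' + ht_scale_mat x (C' \<star>\<^bsub>t\<^esub> ht_inverse t N' (pencil N' A' x) \<star>\<^bsub>t\<^esub> B')"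
  shows "D = D'" "C \<star>\<^bsub>t\<^esub> ht_mat_pow t A k \<star>\<^bsub>t\<^esub> B = C' \<star>\<^bsub>t\<^esub> ht_mat_pow t A' k \<star>\<^bsub>t\<^esub> B'"
proof -
  let ?L = "\<lambda>x. ht_inverse t N (pencil N A x)" and ?L' = "\<lambda>x. ht_inverse t N' (pencil N' A' x)"
  have d [simp]: "dim_row A = N" "dim_col A = N" "dim_row B = N" "dim_col B = n" "dim_row C = n" "dim_col C = N"
    "dim_row D = n" "dim_col D = n"
    using A B C D by auto
  have d' [simp]: "dim_row A' = N'" "dim_col A' = N'" "dim_row B' = N'" "dim_col B' = n" "dim_row C' = n" "dim_col C' = N'"
    "dim_row D' = n" "dim_col D' = n"
    using A' B' C' D' by auto
  have nb: "at (0::real) \<noteq> bot" by simp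
  have nz: "\<forall>\<^sub>F x :: real in at 0. x \<noteq> 0" by (simp add: eventually_at_filter)
  \<comment> \<open>the limit at 0 gives E = E'; then the common term cancels and x can be divided out\<close>
  have split: "E = E' \<and> (\<forall>\<^sub>F x in at 0. F x = F' x)"
    if E: "E \<in> carrier_mat n n" "E' \<in> carrier_mat n n"
      and F: "ht_tendsto n n F M (at 0)" "ht_tendsto n n F' M' (at 0)"
      and eqF: "\<forall>\<^sub>F x in at 0. E + ht_scale_mat x (F x) = E' + ht_scale_mat x (F' x)"
    for E E' F F' M M'
  proof -
    have lim: "ht_tendsto n n (\<lambda>x. Y + ht_scale_mat x (X x)) Y (at 0)"
      if "Y \<in> carrier_mat n n" "ht_tendsto n n X Z (at 0)" for X Y Z
    proof -
      have "ht_tendsto n n (\<lambda>x. Y + ht_scale_mat x (X x)) (Y + ht_scale_mat 0 Z) (at 0)"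
        by (intro ht_tendsto_add ht_tendsto_const that ht_tendsto_scale[OF that(2)] tendsto_ident_at)
      moreover have "Z \<in> carrier_mat n n" using that(2) by (simp add: ht_tendsto_def)
      then have "Y + ht_scale_mat 0 Z = Y" using that(1) by (intro eq_matI) auto
      ultimately show ?thesis by simp
    qed
    have "ht_tendsto n n (\<lambda>x. E' + ht_scale_mat x (F' x)) E (at 0)"
      by (rule ht_tendsto_cong[OF lim[OF E(1) F(1)] eqF])
    then have EE: "E = E'"
      using ht_tendsto_unique[OF _ lim[OF E(2) F(2)] nb] by blast
    have "\<forall>\<^sub>F x in at 0. F x \<in> carrier_mat n n" "\<forall>\<^sub>F x in at 0. F' x \<in> carrier_mat n n"
      using F by (simp_all add: ht_tendsto_def)
    with eqF nz have "\<forall>\<^sub>F x in at 0. F x = F' x"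
    proof eventually_elim
      case (elim x)
      have "ht_scale_mat x (F x) = ht_scale_mat x (F' x)"
        by (rule mat_add_left_cancel[of E _ _ n n]) (use elim E EE in auto)
      then show ?case using elim(2) by (rule ht_scale_cancel)
    qed
    with EE show ?thesis by blast
  qed
  have expand: "X \<star>\<^bsub>t\<^esub> P \<star>\<^bsub>t\<^esub> Y = X \<star>\<^bsub>t\<^esub> Y + ht_scale_mat x (X \<star>\<^bsub>t\<^esub> Z \<star>\<^bsub>t\<^esub> P \<star>\<^bsub>t\<^esub> Y)"
    if "Z \<in> carrier_mat m m" "ht_is_inverse t m (pencil m Z x) P" "dim_col X = m" "dim_row Y = m"
    for X Y Z P x m
  proof -
    have e: "dim_row Z = m" "dim_col Z = m" "dim_row P = m" "dim_col P = m"
      using that by (auto simp: ht_is_inverse_def)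
    show ?thesis
      by (subst (1) resolvent_expand(1)[OF that(1,2)])
        (use e that in \<open>simp add: ht_add_right ht_add_left ht_scale_left ht_scale_right ht_assoc\<close>)
  qed
  have pw: "C \<star>\<^bsub>t\<^esub> ht_mat_pow t A k \<in> carrier_mat n N" "C' \<star>\<^bsub>t\<^esub> ht_mat_pow t A' k \<in> carrier_mat n N'" for k
    by (intro carrier_matI; simp)+
  have pwB: "C \<star>\<^bsub>t\<^esub> ht_mat_pow t A k \<star>\<^bsub>t\<^esub> B \<in> carrier_mat n n" "C' \<star>\<^bsub>t\<^esub> ht_mat_pow t A' k \<star>\<^bsub>t\<^esub> B' \<in> carrier_mat n n" for k
    by (intro carrier_matI; simp)+
  note lims = transfer_tendsto_0[OF A B pw(1)] transfer_tendsto_0[OF A' B' pw(2)]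
  have base: "D = D' \<and> (\<forall>\<^sub>F x in at 0. C \<star>\<^bsub>t\<^esub> ?L x \<star>\<^bsub>t\<^esub> B = C' \<star>\<^bsub>t\<^esub> ?L' x \<star>\<^bsub>t\<^esub> B')"
    by (rule split[OF D D' transfer_tendsto_0[OF A B C] transfer_tendsto_0[OF A' B' C'] eq])
  then show "D = D'" by blast
  have step: "C \<star>\<^bsub>t\<^esub> ht_mat_pow t A k \<star>\<^bsub>t\<^esub> B = C' \<star>\<^bsub>t\<^esub> ht_mat_pow t A' k \<star>\<^bsub>t\<^esub> B' \<and>
      (\<forall>\<^sub>F x in at 0. C \<star>\<^bsub>t\<^esub> ht_mat_pow t A (Suc k) \<star>\<^bsub>t\<^esub> ?L x \<star>\<^bsub>t\<^esub> B =
        C' \<star>\<^bsub>t\<^esub> ht_mat_pow t A' (Suc k) \<star>\<^bsub>t\<^esub> ?L' x \<star>\<^bsub>t\<^esub> B')"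
    if k: "\<forall>\<^sub>F x in at 0. C \<star>\<^bsub>t\<^esub> ht_mat_pow t A k \<star>\<^bsub>t\<^esub> ?L x \<star>\<^bsub>t\<^esub> B =
        C' \<star>\<^bsub>t\<^esub> ht_mat_pow t A' k \<star>\<^bsub>t\<^esub> ?L' x \<star>\<^bsub>t\<^esub> B'" for k
  proof (rule split[OF pwB lims])
    show "\<forall>\<^sub>F x in at 0. C \<star>\<^bsub>t\<^esub> ht_mat_pow t A k \<star>\<^bsub>t\<^esub> B +
        ht_scale_mat x (C \<star>\<^bsub>t\<^esub> ht_mat_pow t A (Suc k) \<star>\<^bsub>t\<^esub> ?L x \<star>\<^bsub>t\<^esub> B) =
      C' \<star>\<^bsub>t\<^esub> ht_mat_pow t A' k \<star>\<^bsub>t\<^esub> B' +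
        ht_scale_mat x (C' \<star>\<^bsub>t\<^esub> ht_mat_pow t A' (Suc k) \<star>\<^bsub>t\<^esub> ?L' x \<star>\<^bsub>t\<^esub> B')"
      using k eventually_pencil_inverse_at_0[OF A, of t] eventually_pencil_inverse_at_0[OF A', of t]
    proof eventually_elim
      case (elim x)
      show ?case
        using elim(1) expand[OF A elim(2), of "C \<star>\<^bsub>t\<^esub> ht_mat_pow t A k" B]
          expand[OF A' elim(3), of "C' \<star>\<^bsub>t\<^esub> ht_mat_pow t A' k" B']
        by (simp add: ht_assoc)
    qed
  qed
  have "\<forall>\<^sub>F x in at 0. C \<star>\<^bsub>t\<^esub> ht_mat_pow t A k \<star>\<^bsub>t\<^esub> ?L x \<star>\<^bsub>t\<^esub> B =
        C' \<star>\<^bsub>t\<^esub> ht_mat_pow t A' k \<star>\<^bsub>t\<^esub> ?L' x \<star>\<^bsub>t\<^esub> B'"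
  proof (induct k)
    case 0
    then show ?case using base by simp
  next
    case (Suc k)
    then show ?case using step by blast
  qed
  then show "C \<star>\<^bsub>t\<^esub> ht_mat_pow t A k \<star>\<^bsub>t\<^esub> B = C' \<star>\<^bsub>t\<^esub> ht_mat_pow t A' k \<star>\<^bsub>t\<^esub> B'"
    using step by blast
qed

section \<open>State space similarity\<close>

lemma ht_pow_add:
  assumes "dim_row A = dim_col A"
  shows "ht_mat_pow t A (j + k) = ht_mat_pow t A j \<star>\<^bsub>t\<^esub> ht_mat_pow t A k"
  by (induct k) (simp_all add: assms ht_assoc)

lemma observability_cancel:
  assumes A: "A \<in> carrier_mat N N" and C: "C \<in> carrier_mat n N"
    and L: "\<And>k. L k \<in> carrier_mat N n"
    and left: "ht_sum N N K (\<lambda>k. L k \<star>\<^bsub>t\<^esub> (C \<star>\<^bsub>t\<^esub> ht_mat_pow t A k)) = ht_one_mat N"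
    and X: "X \<in> carrier_mat N m" and Y: "Y \<in> carrier_mat N m"
    and eq: "\<And>k. C \<star>\<^bsub>t\<^esub> ht_mat_pow t A k \<star>\<^bsub>t\<^esub> X = C \<star>\<^bsub>t\<^esub> ht_mat_pow t A k \<star>\<^bsub>t\<^esub> Y"
  shows "X = Y"
proof -
  have d [simp]: "dim_row A = N" "dim_col A = N" "dim_row C = n" "dim_col C = N" using A C by auto
  have dL [simp]: "dim_row (L k) = N" "dim_col (L k) = n" for k using L[of k] by auto
  have c: "L k \<star>\<^bsub>t\<^esub> (C \<star>\<^bsub>t\<^esub> ht_mat_pow t A k) \<in> carrier_mat N N" for k
    by (intro carrier_matI) simp_all
  have "Z = ht_sum N m K (\<lambda>k. L k \<star>\<^bsub>t\<^esub> (C \<star>\<^bsub>t\<^esub> ht_mat_pow t A k \<star>\<^bsub>t\<^esub> Z))" if Z: "Z \<in> carrier_mat N m" for Z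
  proof -
    have dZ [simp]: "dim_row Z = N" "dim_col Z = m" using Z by auto
    have "Z = ht_sum N N K (\<lambda>k. L k \<star>\<^bsub>t\<^esub> (C \<star>\<^bsub>t\<^esub> ht_mat_pow t A k)) \<star>\<^bsub>t\<^esub> Z"
      by (simp add: left)
    also have "\<dots> = ht_sum N m K (\<lambda>k. L k \<star>\<^bsub>t\<^esub> (C \<star>\<^bsub>t\<^esub> ht_mat_pow t A k) \<star>\<^bsub>t\<^esub> Z)"
      using ht_sum_mult_right[where F = "\<lambda>k. L k \<star>\<^bsub>t\<^esub> (C \<star>\<^bsub>t\<^esub> ht_mat_pow t A k)", OF c] by simp
    also have "\<dots> = ht_sum N m K (\<lambda>k. L k \<star>\<^bsub>t\<^esub> (C \<star>\<^bsub>t\<^esub> ht_mat_pow t A k \<star>\<^bsub>t\<^esub> Z))"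
      by (rule ht_sum_cong) (simp add: ht_assoc)
    finally show ?thesis .
  qed
  from this[OF X] this[OF Y] show ?thesis by (simp add: eq)
qed

lemma intertwine_moments:
  assumes dims: "dim_row A = N" "dim_col A = N" "dim_col C = N" "dim_row X = N" "dim_col X = N"
      "dim_row A' = N" "dim_col A' = N"
    and CX: "C \<star>\<^bsub>t\<^esub> X = C'" and AX: "A \<star>\<^bsub>t\<^esub> X = X \<star>\<^bsub>t\<^esub> A'"
  shows "C \<star>\<^bsub>t\<^esub> ht_mat_pow t A k \<star>\<^bsub>t\<^esub> X = C' \<star>\<^bsub>t\<^esub> ht_mat_pow t A' k"
proof -
  have "ht_mat_pow t A k \<star>\<^bsub>t\<^esub> X = X \<star>\<^bsub>t\<^esub> ht_mat_pow t A' k"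
  proof (induct k)
    case (Suc k)
    have "ht_mat_pow t A (Suc k) \<star>\<^bsub>t\<^esub> X = ht_mat_pow t A k \<star>\<^bsub>t\<^esub> (A \<star>\<^bsub>t\<^esub> X)"
      using dims by (simp add: ht_assoc)
    also have "\<dots> = ht_mat_pow t A k \<star>\<^bsub>t\<^esub> X \<star>\<^bsub>t\<^esub> A'" using dims by (simp add: AX ht_assoc)
    also have "\<dots> = X \<star>\<^bsub>t\<^esub> ht_mat_pow t A' (Suc k)" using dims by (simp add: Suc ht_assoc)
    finally show ?case .
  qed (use dims in simp)
  then show ?thesis using dims by (simp add: ht_assoc CX[symmetric])
qed

text \<open>
  Equal Markov parameters mean that the two Hankel matrices, observability times controllability
  matrix, coincide. Multiplying the primed observability matrix by the left inverse L of the unprimed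
  one gives X, and multiplying the right inverse W by the primed controllability matrix gives Z.
  Then X Z = I, which for square matrices makes X invertible, so minimality of the primed
  system is a consequence.
\<close>

lemma state_space_similarity:
  assumes A: "A \<in> carrier_mat N N" and B: "B \<in> carrier_mat N n" and C: "C \<in> carrier_mat n N"
    and A': "A' \<in> carrier_mat N N" and B': "B' \<in> carrier_mat N n" and C': "C' \<in> carrier_mat n N"
    and L: "\<And>k. L k \<in> carrier_mat N n"
    and left: "ht_sum N N K (\<lambda>k. L k \<star>\<^bsub>t\<^esub> (C \<star>\<^bsub>t\<^esub> ht_mat_pow t A k)) = ht_one_mat N"
    and W: "\<And>k. W k \<in> carrier_mat n N"
    and right: "ht_sum N N K' (\<lambda>k. ht_mat_pow t A k \<star>\<^bsub>t\<^esub> B \<star>\<^bsub>t\<^esub> W k) = ht_one_mat N"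
    and moments: "\<And>k. C \<star>\<^bsub>t\<^esub> ht_mat_pow t A k \<star>\<^bsub>t\<^esub> B = C' \<star>\<^bsub>t\<^esub> ht_mat_pow t A' k \<star>\<^bsub>t\<^esub> B'"
  shows "\<exists>X Z. ht_is_inverse t N X Z \<and> C \<star>\<^bsub>t\<^esub> X = C' \<and> A \<star>\<^bsub>t\<^esub> X = X \<star>\<^bsub>t\<^esub> A' \<and> B = X \<star>\<^bsub>t\<^esub> B'"
proof -
  have d [simp]: "dim_row A = N" "dim_col A = N" "dim_row B = N" "dim_col B = n" "dim_row C = n" "dim_col C = N"
    "dim_row A' = N" "dim_col A' = N" "dim_row B' = N" "dim_col B' = n" "dim_row C' = n" "dim_col C' = N"
    using A B C A' B' C' by auto
  have dL [simp]: "dim_row (L k) = N" "dim_col (L k) = n" "dim_row (W k) = n" "dim_col (W k) = N" for k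
    using L[of k] W[of k] by auto
  define X where "X = ht_sum N N K (\<lambda>j. L j \<star>\<^bsub>t\<^esub> (C' \<star>\<^bsub>t\<^esub> ht_mat_pow t A' j))"
  define Z where "Z = ht_sum N N K' (\<lambda>i. ht_mat_pow t A' i \<star>\<^bsub>t\<^esub> B' \<star>\<^bsub>t\<^esub> W i)"
  have dX [simp]: "dim_row X = N" "dim_col X = N" "dim_row Z = N" "dim_col Z = N"
    by (simp_all add: X_def Z_def)
  have c1: "L j \<star>\<^bsub>t\<^esub> (C \<star>\<^bsub>t\<^esub> ht_mat_pow t A j) \<in> carrier_mat N N"
    and c2: "L j \<star>\<^bsub>t\<^esub> (C' \<star>\<^bsub>t\<^esub> ht_mat_pow t A' j) \<in> carrier_mat N N"
    and c3: "ht_mat_pow t A j \<star>\<^bsub>t\<^esub> B \<star>\<^bsub>t\<^esub> W j \<in> carrier_mat N N"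
    and c4: "ht_mat_pow t A' j \<star>\<^bsub>t\<^esub> B' \<star>\<^bsub>t\<^esub> W j \<in> carrier_mat N N" for j
    by (intro carrier_matI; simp)+
  have hankel: "C' \<star>\<^bsub>t\<^esub> (ht_mat_pow t A' j \<star>\<^bsub>t\<^esub> (ht_mat_pow t A' k \<star>\<^bsub>t\<^esub> B')) =
      C \<star>\<^bsub>t\<^esub> (ht_mat_pow t A j \<star>\<^bsub>t\<^esub> (ht_mat_pow t A k \<star>\<^bsub>t\<^esub> B))" for j k
    using moments[of "j + k"] by (simp add: ht_pow_add ht_assoc)
  have XB: "X \<star>\<^bsub>t\<^esub> (ht_mat_pow t A' k \<star>\<^bsub>t\<^esub> B') = ht_mat_pow t A k \<star>\<^bsub>t\<^esub> B" for k
  proof -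
    have "X \<star>\<^bsub>t\<^esub> (ht_mat_pow t A' k \<star>\<^bsub>t\<^esub> B') =
        ht_sum N n K (\<lambda>j. L j \<star>\<^bsub>t\<^esub> (C' \<star>\<^bsub>t\<^esub> ht_mat_pow t A' j) \<star>\<^bsub>t\<^esub> (ht_mat_pow t A' k \<star>\<^bsub>t\<^esub> B'))"
      unfolding X_def
      using ht_sum_mult_right[where F = "\<lambda>j. L j \<star>\<^bsub>t\<^esub> (C' \<star>\<^bsub>t\<^esub> ht_mat_pow t A' j)", OF c2] by simp
    also have "\<dots> = ht_sum N n K (\<lambda>j. L j \<star>\<^bsub>t\<^esub> (C \<star>\<^bsub>t\<^esub> ht_mat_pow t A j) \<star>\<^bsub>t\<^esub> (ht_mat_pow t A k \<star>\<^bsub>t\<^esub> B))"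
      by (rule ht_sum_cong) (simp add: ht_assoc hankel)
    also have "\<dots> = ht_sum N N K (\<lambda>k. L k \<star>\<^bsub>t\<^esub> (C \<star>\<^bsub>t\<^esub> ht_mat_pow t A k)) \<star>\<^bsub>t\<^esub> (ht_mat_pow t A k \<star>\<^bsub>t\<^esub> B)"
      using ht_sum_mult_right[where F = "\<lambda>j. L j \<star>\<^bsub>t\<^esub> (C \<star>\<^bsub>t\<^esub> ht_mat_pow t A j)", OF c1] by simp
    finally show ?thesis by (simp add: left)
  qed
  have CZ: "C' \<star>\<^bsub>t\<^esub> ht_mat_pow t A' k \<star>\<^bsub>t\<^esub> Z = C \<star>\<^bsub>t\<^esub> ht_mat_pow t A k" for k
  proof -
    have "C' \<star>\<^bsub>t\<^esub> ht_mat_pow t A' k \<star>\<^bsub>t\<^esub> Z =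
        ht_sum n N K' (\<lambda>i. C' \<star>\<^bsub>t\<^esub> ht_mat_pow t A' k \<star>\<^bsub>t\<^esub> (ht_mat_pow t A' i \<star>\<^bsub>t\<^esub> B' \<star>\<^bsub>t\<^esub> W i))"
      unfolding Z_def
      using ht_sum_mult_left[where F = "\<lambda>i. ht_mat_pow t A' i \<star>\<^bsub>t\<^esub> B' \<star>\<^bsub>t\<^esub> W i", OF c4] by simp
    also have "\<dots> = ht_sum n N K' (\<lambda>i. C \<star>\<^bsub>t\<^esub> ht_mat_pow t A k \<star>\<^bsub>t\<^esub> (ht_mat_pow t A i \<star>\<^bsub>t\<^esub> B \<star>\<^bsub>t\<^esub> W i))"
    proof (rule ht_sum_cong)
      fix i
      show "C' \<star>\<^bsub>t\<^esub> ht_mat_pow t A' k \<star>\<^bsub>t\<^esub> (ht_mat_pow t A' i \<star>\<^bsub>t\<^esub> B' \<star>\<^bsub>t\<^esub> W i) =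
          C \<star>\<^bsub>t\<^esub> ht_mat_pow t A k \<star>\<^bsub>t\<^esub> (ht_mat_pow t A i \<star>\<^bsub>t\<^esub> B \<star>\<^bsub>t\<^esub> W i)"
        using arg_cong[OF hankel[of k i], of "\<lambda>M. M \<star>\<^bsub>t\<^esub> W i"] by (simp add: ht_assoc)
    qed
    also have "\<dots> = C \<star>\<^bsub>t\<^esub> ht_mat_pow t A k \<star>\<^bsub>t\<^esub> ht_sum N N K' (\<lambda>k. ht_mat_pow t A k \<star>\<^bsub>t\<^esub> B \<star>\<^bsub>t\<^esub> W k)"
      using ht_sum_mult_left[where F = "\<lambda>i. ht_mat_pow t A i \<star>\<^bsub>t\<^esub> B \<star>\<^bsub>t\<^esub> W i", OF c3] by simp
    finally show ?thesis by (simp add: right)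
  qed
  have "X \<star>\<^bsub>t\<^esub> Z = ht_sum N N K' (\<lambda>i. X \<star>\<^bsub>t\<^esub> (ht_mat_pow t A' i \<star>\<^bsub>t\<^esub> B' \<star>\<^bsub>t\<^esub> W i))"
    unfolding Z_def
    using ht_sum_mult_left[where F = "\<lambda>i. ht_mat_pow t A' i \<star>\<^bsub>t\<^esub> B' \<star>\<^bsub>t\<^esub> W i", OF c4] by simp
  also have "\<dots> = ht_sum N N K' (\<lambda>i. ht_mat_pow t A i \<star>\<^bsub>t\<^esub> B \<star>\<^bsub>t\<^esub> W i)"
  proof (rule ht_sum_cong)
    fix i
    show "X \<star>\<^bsub>t\<^esub> (ht_mat_pow t A' i \<star>\<^bsub>t\<^esub> B' \<star>\<^bsub>t\<^esub> W i) = ht_mat_pow t A i \<star>\<^bsub>t\<^esub> B \<star>\<^bsub>t\<^esub> W i"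
      using arg_cong[OF XB[of i], of "\<lambda>M. M \<star>\<^bsub>t\<^esub> W i"] by (simp add: ht_assoc)
  qed
  finally have "X \<star>\<^bsub>t\<^esub> Z = ht_one_mat N" by (simp add: right)
  moreover have cXZ: "X \<in> carrier_mat N N" "Z \<in> carrier_mat N N" by (simp_all add: X_def Z_def ht_sum_carrier)
  ultimately have inv: "ht_is_inverse t N X Z" by (intro right_inverse_imp_inverse)
  have CAX: "C \<star>\<^bsub>t\<^esub> ht_mat_pow t A k \<star>\<^bsub>t\<^esub> X = C' \<star>\<^bsub>t\<^esub> ht_mat_pow t A' k" for k
  proof -
    have "C \<star>\<^bsub>t\<^esub> ht_mat_pow t A k \<star>\<^bsub>t\<^esub> X = C' \<star>\<^bsub>t\<^esub> ht_mat_pow t A' k \<star>\<^bsub>t\<^esub> Z \<star>\<^bsub>t\<^esub> X" by (simp only: CZ)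
    also have "\<dots> = C' \<star>\<^bsub>t\<^esub> ht_mat_pow t A' k \<star>\<^bsub>t\<^esub> (Z \<star>\<^bsub>t\<^esub> X)" by (rule ht_assoc) simp_all
    also have "\<dots> = C' \<star>\<^bsub>t\<^esub> ht_mat_pow t A' k" using inv by (simp add: ht_is_inverse_def)
    finally show ?thesis .
  qed
  have CX: "C \<star>\<^bsub>t\<^esub> X = C'" using CAX[of 0] by simp
  have "B = X \<star>\<^bsub>t\<^esub> B'" using XB[of 0] by simp
  moreover have "A \<star>\<^bsub>t\<^esub> X = X \<star>\<^bsub>t\<^esub> A'"
  proof (rule observability_cancel[OF A C L left])
    show "A \<star>\<^bsub>t\<^esub> X \<in> carrier_mat N N" "X \<star>\<^bsub>t\<^esub> A' \<in> carrier_mat N N" by (intro carrier_matI; simp)+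
    fix k
    have "C \<star>\<^bsub>t\<^esub> ht_mat_pow t A k \<star>\<^bsub>t\<^esub> (A \<star>\<^bsub>t\<^esub> X) = C \<star>\<^bsub>t\<^esub> ht_mat_pow t A (Suc k) \<star>\<^bsub>t\<^esub> X"
      by (simp add: ht_assoc)
    also have "\<dots> = C' \<star>\<^bsub>t\<^esub> ht_mat_pow t A' k \<star>\<^bsub>t\<^esub> A'" unfolding CAX by (simp add: ht_assoc)
    also have "\<dots> = C \<star>\<^bsub>t\<^esub> ht_mat_pow t A k \<star>\<^bsub>t\<^esub> X \<star>\<^bsub>t\<^esub> A'" by (simp only: CAX)
    also have "\<dots> = C \<star>\<^bsub>t\<^esub> ht_mat_pow t A k \<star>\<^bsub>t\<^esub> (X \<star>\<^bsub>t\<^esub> A')" by (rule ht_assoc) simp_all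
    finally show "C \<star>\<^bsub>t\<^esub> ht_mat_pow t A k \<star>\<^bsub>t\<^esub> (A \<star>\<^bsub>t\<^esub> X) = C \<star>\<^bsub>t\<^esub> ht_mat_pow t A k \<star>\<^bsub>t\<^esub> (X \<star>\<^bsub>t\<^esub> A')" .
  qed
  ultimately show ?thesis using inv CX by blast
qed

section \<open>The inverse system and the Stein equation\<close>

text \<open>
  Let S = (I - yA)^-1 B. The system matrix sends the column (y S, I) to (S, R(y)), so its inverse
  sends (S, R(y)) back to (y S, I). With w = 1/y this reads S = w(P S + Q R(y)) and
  I = U S + V R(y), and eliminating S leaves the claim.
\<close>

lemma inverse_system:
  assumes A: "A \<in> carrier_mat N N" and B: "B \<in> carrier_mat N n" and C: "C \<in> carrier_mat n N"
    and D: "D \<in> carrier_mat n n"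
    and P: "P \<in> carrier_mat N N" and Q: "Q \<in> carrier_mat N n" and U: "U \<in> carrier_mat n N"
    and V: "V \<in> carrier_mat n n"
    and inv: "four_block_mat P Q U V \<star>\<^bsub>t\<^esub> four_block_mat A B C D = ht_one_mat (N + n)"
    and w: "w * y = 1"
    and Ly: "ht_is_inverse t N (pencil N A y) L" and Lw: "ht_is_inverse t N (pencil N P w) L'"
  shows "(V + ht_scale_mat w (U \<star>\<^bsub>t\<^esub> L' \<star>\<^bsub>t\<^esub> Q)) \<star>\<^bsub>t\<^esub> (D + ht_scale_mat y (C \<star>\<^bsub>t\<^esub> L \<star>\<^bsub>t\<^esub> B)) = ht_one_mat n"
proof -
  have d [simp]: "dim_row A = N" "dim_col A = N" "dim_row B = N" "dim_col B = n" "dim_row C = n" "dim_col C = N"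
    "dim_row D = n" "dim_col D = n" "dim_row P = N" "dim_col P = N" "dim_row Q = N" "dim_col Q = n"
    "dim_row U = n" "dim_col U = N" "dim_row V = n" "dim_col V = n"
    "dim_row L = N" "dim_col L = N" "dim_row L' = N" "dim_col L' = N"
    using A B C D P Q U V Ly Lw by (auto simp: ht_is_inverse_def)
  have "four_block_mat (P \<star>\<^bsub>t\<^esub> A + Q \<star>\<^bsub>t\<^esub> C) (P \<star>\<^bsub>t\<^esub> B + Q \<star>\<^bsub>t\<^esub> D) (U \<star>\<^bsub>t\<^esub> A + V \<star>\<^bsub>t\<^esub> C) (U \<star>\<^bsub>t\<^esub> B + V \<star>\<^bsub>t\<^esub> D) =
      four_block_mat (ht_one_mat N) (0\<^sub>m N n) (0\<^sub>m n N) (ht_one_mat n)"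
    using inv ht_four_block_mult[OF P Q U V A B C D, of t] by (simp add: ht_four_block_one)
  note blk = four_block_inject[OF _ _ _ _ _ _ _ _ this]
  have blocks: "P \<star>\<^bsub>t\<^esub> A + Q \<star>\<^bsub>t\<^esub> C = ht_one_mat N" "P \<star>\<^bsub>t\<^esub> B + Q \<star>\<^bsub>t\<^esub> D = 0\<^sub>m N n"
    "U \<star>\<^bsub>t\<^esub> A + V \<star>\<^bsub>t\<^esub> C = 0\<^sub>m n N" "U \<star>\<^bsub>t\<^esub> B + V \<star>\<^bsub>t\<^esub> D = ht_one_mat n"
    by (rule blk[of N N n n]; intro carrier_matI; simp)+
  define S where "S = L \<star>\<^bsub>t\<^esub> B"
  define R where "R = D + ht_scale_mat y (C \<star>\<^bsub>t\<^esub> L \<star>\<^bsub>t\<^esub> B)"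
  have dS [simp]: "dim_row S = N" "dim_col S = n" "dim_row R = n" "dim_col R = n"
    by (simp_all add: S_def R_def)
  have S: "S = B + ht_scale_mat y (A \<star>\<^bsub>t\<^esub> S)"
    unfolding S_def
    by (subst (1) resolvent_expand(1)[OF A Ly]) (simp add: ht_add_left ht_scale_left ht_assoc)
  have R: "R = D + ht_scale_mat y (C \<star>\<^bsub>t\<^esub> S)" by (simp add: R_def S_def ht_assoc)
  have XS: "X \<star>\<^bsub>t\<^esub> S + Y \<star>\<^bsub>t\<^esub> R = (X \<star>\<^bsub>t\<^esub> B + Y \<star>\<^bsub>t\<^esub> D) + ht_scale_mat y ((X \<star>\<^bsub>t\<^esub> A + Y \<star>\<^bsub>t\<^esub> C) \<star>\<^bsub>t\<^esub> S)"
    if "dim_row X = m" "dim_row Y = m" "dim_col X = N" "dim_col Y = n" for X Y m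
  proof -
    have "X \<star>\<^bsub>t\<^esub> S = X \<star>\<^bsub>t\<^esub> B + ht_scale_mat y (X \<star>\<^bsub>t\<^esub> (A \<star>\<^bsub>t\<^esub> S))"
      by (subst (1) S) (use that in \<open>simp add: ht_add_right ht_scale_right\<close>)
    moreover have "Y \<star>\<^bsub>t\<^esub> R = Y \<star>\<^bsub>t\<^esub> D + ht_scale_mat y (Y \<star>\<^bsub>t\<^esub> (C \<star>\<^bsub>t\<^esub> S))"
      by (subst (1) R) (use that in \<open>simp add: ht_add_right ht_scale_right\<close>)
    ultimately show ?thesis
      using that by (intro eq_matI) (simp_all add: ht_add_left ht_assoc algebra_simps)
  qed
  have 1: "P \<star>\<^bsub>t\<^esub> S + Q \<star>\<^bsub>t\<^esub> R = ht_scale_mat y S"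
    using XS[of P N Q] by (simp add: blocks) (rule eq_matI, simp_all)
  have 2: "U \<star>\<^bsub>t\<^esub> S + V \<star>\<^bsub>t\<^esub> R = ht_one_mat n"
    using XS[of U n V] by (simp add: blocks) (rule eq_matI, simp_all)
  have 3: "pencil N P w \<star>\<^bsub>t\<^esub> S = ht_scale_mat w (Q \<star>\<^bsub>t\<^esub> R)"
  proof (rule eq_matI)
    fix i j assume "i < dim_row (ht_scale_mat w (Q \<star>\<^bsub>t\<^esub> R))" "j < dim_col (ht_scale_mat w (Q \<star>\<^bsub>t\<^esub> R))"
    then have ij: "i < N" "j < n" by auto
    have "(P \<star>\<^bsub>t\<^esub> S + Q \<star>\<^bsub>t\<^esub> R) $$ (i, j) = ht_scale_mat y S $$ (i, j)" by (simp only: 1)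
    then have "w *\<^sub>R (P \<star>\<^bsub>t\<^esub> S) $$ (i, j) + w *\<^sub>R (Q \<star>\<^bsub>t\<^esub> R) $$ (i, j) = (w * y) *\<^sub>R S $$ (i, j)"
      using ij by (simp flip: scaleR_add_right)
    then show "(pencil N P w \<star>\<^bsub>t\<^esub> S) $$ (i, j) = ht_scale_mat w (Q \<star>\<^bsub>t\<^esub> R) $$ (i, j)"
      using ij w by (simp add: pencil_def ht_diff_left ht_scale_left algebra_simps)
  qed simp_all
  have "S = L' \<star>\<^bsub>t\<^esub> pencil N P w \<star>\<^bsub>t\<^esub> S" using Lw by (simp add: ht_is_inverse_def)
  also have "\<dots> = L' \<star>\<^bsub>t\<^esub> ht_scale_mat w (Q \<star>\<^bsub>t\<^esub> R)" by (simp add: ht_assoc 3)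
  finally have "U \<star>\<^bsub>t\<^esub> S = ht_scale_mat w (U \<star>\<^bsub>t\<^esub> (L' \<star>\<^bsub>t\<^esub> (Q \<star>\<^bsub>t\<^esub> R)))"
    by (metis d dS ht_mult_dim ht_scale_right)
  then have "(V + ht_scale_mat w (U \<star>\<^bsub>t\<^esub> L' \<star>\<^bsub>t\<^esub> Q)) \<star>\<^bsub>t\<^esub> R = V \<star>\<^bsub>t\<^esub> R + U \<star>\<^bsub>t\<^esub> S"
    by (simp add: ht_add_left ht_scale_left ht_assoc)
  also have "\<dots> = U \<star>\<^bsub>t\<^esub> S + V \<star>\<^bsub>t\<^esub> R" by (rule eq_matI) simp_all
  also note 2
  finally show ?thesis by (simp only: R_def)
qed

text \<open>
  A block row is a block matrix whose lower blocks have no rows, so that the block product applies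
  to it.
\<close>

definition block_row :: "ht mat \<Rightarrow> ht mat \<Rightarrow> ht mat" where
  "block_row c r = four_block_mat c r (0\<^sub>m 0 (dim_col c)) (0\<^sub>m 0 (dim_col r))"

lemma block_row_mult:
  assumes c: "c \<in> carrier_mat m a" and r: "r \<in> carrier_mat m b"
    and A: "A \<in> carrier_mat a a'" and B: "B \<in> carrier_mat a b'" and C: "C \<in> carrier_mat b a'"
    and D: "D \<in> carrier_mat b b'"
  shows "block_row c r \<star>\<^bsub>t\<^esub> four_block_mat A B C D = block_row (c \<star>\<^bsub>t\<^esub> A + r \<star>\<^bsub>t\<^esub> C) (c \<star>\<^bsub>t\<^esub> B + r \<star>\<^bsub>t\<^esub> D)"
proof -
  have d: "dim_row c = m" "dim_col c = a" "dim_row r = m" "dim_col r = b"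
    "dim_row A = a" "dim_col A = a'" "dim_row B = a" "dim_col B = b'" "dim_row C = b" "dim_col C = a'"
    "dim_row D = b" "dim_col D = b'"
    using assms by auto
  show ?thesis
    unfolding block_row_def
    using ht_four_block_mult[OF c r zero_carrier_mat zero_carrier_mat A B C D, of 0 t] d by simp
qed

lemma block_row_form:
  assumes c: "c \<in> carrier_mat m a" and r: "r \<in> carrier_mat m b"
    and c': "c' \<in> carrier_mat m a" and r': "r' \<in> carrier_mat m b"
    and X: "X \<in> carrier_mat a a" and J: "J \<in> carrier_mat b b"
  shows "block_row c r \<star>\<^bsub>t\<^esub> four_block_mat X (0\<^sub>m a b) (0\<^sub>m b a) J \<star>\<^bsub>t\<^esub> ht_adj (block_row c' r') =
    c \<star>\<^bsub>t\<^esub> X \<star>\<^bsub>t\<^esub> ht_adj c' + r \<star>\<^bsub>t\<^esub> J \<star>\<^bsub>t\<^esub> ht_adj r'"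
proof -
  have d [simp]: "dim_row c = m" "dim_col c = a" "dim_row r = m" "dim_col r = b"
    "dim_row c' = m" "dim_col c' = a" "dim_row r' = m" "dim_col r' = b"
    "dim_row X = a" "dim_col X = a" "dim_row J = b" "dim_col J = b"
    using assms by auto
  have cX: "c \<star>\<^bsub>t\<^esub> X \<in> carrier_mat m a" "r \<star>\<^bsub>t\<^esub> J \<in> carrier_mat m b"
    "ht_adj c' \<in> carrier_mat a m" "ht_adj r' \<in> carrier_mat b m"
    by (intro carrier_matI; simp)+
  have "block_row c r \<star>\<^bsub>t\<^esub> four_block_mat X (0\<^sub>m a b) (0\<^sub>m b a) J =
      block_row (c \<star>\<^bsub>t\<^esub> X + 0\<^sub>m m a) (0\<^sub>m m b + r \<star>\<^bsub>t\<^esub> J)"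
    by (simp add: block_row_mult[OF c r X zero_carrier_mat zero_carrier_mat J])
  also have "c \<star>\<^bsub>t\<^esub> X + 0\<^sub>m m a = c \<star>\<^bsub>t\<^esub> X" using cX(1) by simp
  also have "0\<^sub>m m b + r \<star>\<^bsub>t\<^esub> J = r \<star>\<^bsub>t\<^esub> J" using cX(2) by simp
  finally have 1: "block_row c r \<star>\<^bsub>t\<^esub> four_block_mat X (0\<^sub>m a b) (0\<^sub>m b a) J =
      four_block_mat (c \<star>\<^bsub>t\<^esub> X) (r \<star>\<^bsub>t\<^esub> J) (0\<^sub>m 0 a) (0\<^sub>m 0 b)"
    by (simp add: block_row_def)
  have 2: "ht_adj (block_row c' r') = four_block_mat (ht_adj c') (0\<^sub>m a 0) (ht_adj r') (0\<^sub>m b 0)"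
    using ht_four_block_adj[OF c' r' zero_carrier_mat zero_carrier_mat, of 0]
    by (simp add: block_row_def)
  show ?thesis
    unfolding 1 2 ht_four_block_mult[OF cX(1,2) zero_carrier_mat zero_carrier_mat cX(3)
        zero_carrier_mat cX(4) zero_carrier_mat]
    by (rule eq_matI) simp_all
qed

text \<open>
  For the row E(z) = (z C(I - zA)^-1, I) and the system matrix M one has
  E(z) M = (C(I - zA)^-1, R(z)). Hence E(x) M K M* E(y)* can be evaluated in two ways. The two
  state space terms differ by the factor x y = 1 and cancel.
\<close>

lemma stein_imp_J_unitary:
  assumes A: "A \<in> carrier_mat N N" and B: "B \<in> carrier_mat N n" and C: "C \<in> carrier_mat n N"
    and D: "D \<in> carrier_mat n n" and J: "J \<in> carrier_mat n n" and X: "X \<in> carrier_mat N N"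
    and stein: "four_block_mat A B C D \<star>\<^bsub>t\<^esub> four_block_mat X (0\<^sub>m N n) (0\<^sub>m n N) J
      \<star>\<^bsub>t\<^esub> ht_adj (four_block_mat A B C D) = four_block_mat X (0\<^sub>m N n) (0\<^sub>m n N) J"
    and xy: "x * y = 1"
    and Lx: "ht_is_inverse t N (pencil N A x) Lx" and Ly: "ht_is_inverse t N (pencil N A y) Ly"
  shows "(D + ht_scale_mat x (C \<star>\<^bsub>t\<^esub> Lx \<star>\<^bsub>t\<^esub> B)) \<star>\<^bsub>t\<^esub> J \<star>\<^bsub>t\<^esub> ht_adj (D + ht_scale_mat y (C \<star>\<^bsub>t\<^esub> Ly \<star>\<^bsub>t\<^esub> B)) = J"
proof -
  let ?M = "four_block_mat A B C D" and ?K = "four_block_mat X (0\<^sub>m N n) (0\<^sub>m n N) J"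
  have d [simp]: "dim_row A = N" "dim_col A = N" "dim_row B = N" "dim_col B = n" "dim_row C = n" "dim_col C = N"
    "dim_row D = n" "dim_col D = n" "dim_row J = n" "dim_col J = n" "dim_row X = N" "dim_col X = N"
    using A B C D J X by auto
  define R where "R z L = D + ht_scale_mat z (C \<star>\<^bsub>t\<^esub> L \<star>\<^bsub>t\<^esub> B)" for z L
  define E where "E z L = block_row (ht_scale_mat z (C \<star>\<^bsub>t\<^esub> L)) (ht_one_mat n)" for z L
  have one: "ht_one_mat n \<in> carrier_mat n n" by (intro carrier_matI) simp_all
  have EM: "E z L \<star>\<^bsub>t\<^esub> ?M = block_row (C \<star>\<^bsub>t\<^esub> L) (R z L)" and CL: "C \<star>\<^bsub>t\<^esub> L \<in> carrier_mat n N"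
    and RL: "R z L \<in> carrier_mat n n" and zCL: "ht_scale_mat z (C \<star>\<^bsub>t\<^esub> L) \<in> carrier_mat n N"
    and dE: "dim_row (E z L) = n" "dim_col (E z L) = N + n"
    if L: "ht_is_inverse t N (pencil N A z) L" for z L
  proof -
    have dL [simp]: "dim_row L = N" "dim_col L = N" using L by (auto simp: ht_is_inverse_def)
    show "C \<star>\<^bsub>t\<^esub> L \<in> carrier_mat n N" "R z L \<in> carrier_mat n n"
      and c: "ht_scale_mat z (C \<star>\<^bsub>t\<^esub> L) \<in> carrier_mat n N"
      by (intro carrier_matI; simp add: R_def)+
    show "dim_row (E z L) = n" "dim_col (E z L) = N + n" by (simp_all add: E_def block_row_def)
    have "ht_scale_mat z (C \<star>\<^bsub>t\<^esub> L) \<star>\<^bsub>t\<^esub> A + ht_one_mat n \<star>\<^bsub>t\<^esub> C = C + ht_scale_mat z (C \<star>\<^bsub>t\<^esub> (L \<star>\<^bsub>t\<^esub> A))"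
      by (intro eq_matI) (simp_all add: ht_scale_left ht_assoc)
    also have "\<dots> = C \<star>\<^bsub>t\<^esub> L"
      by (subst (2) resolvent_expand(2)[OF A L]) (simp add: ht_add_right ht_scale_right)
    finally have "ht_scale_mat z (C \<star>\<^bsub>t\<^esub> L) \<star>\<^bsub>t\<^esub> A + ht_one_mat n \<star>\<^bsub>t\<^esub> C = C \<star>\<^bsub>t\<^esub> L" .
    moreover have "ht_scale_mat z (C \<star>\<^bsub>t\<^esub> L) \<star>\<^bsub>t\<^esub> B + ht_one_mat n \<star>\<^bsub>t\<^esub> D = R z L"
      by (intro eq_matI) (simp_all add: R_def ht_scale_left)
    ultimately show "E z L \<star>\<^bsub>t\<^esub> ?M = block_row (C \<star>\<^bsub>t\<^esub> L) (R z L)"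
      unfolding E_def by (simp add: block_row_mult[OF c one A B C D])
  qed
  note x = EM[OF Lx] CL[OF Lx] RL[OF Lx] zCL[OF Lx] dE[OF Lx]
  note y = EM[OF Ly] CL[OF Ly] RL[OF Ly] zCL[OF Ly] dE[OF Ly]
  let ?c = "C \<star>\<^bsub>t\<^esub> Lx" and ?c' = "C \<star>\<^bsub>t\<^esub> Ly"
  have dL [simp]: "dim_row Lx = N" "dim_col Lx = N" "dim_row Ly = N" "dim_col Ly = N"
    using Lx Ly by (auto simp: ht_is_inverse_def)
  have "?c \<star>\<^bsub>t\<^esub> X \<star>\<^bsub>t\<^esub> ht_adj ?c' + R x Lx \<star>\<^bsub>t\<^esub> J \<star>\<^bsub>t\<^esub> ht_adj (R y Ly) =
      (E x Lx \<star>\<^bsub>t\<^esub> ?M) \<star>\<^bsub>t\<^esub> ?K \<star>\<^bsub>t\<^esub> ht_adj (E y Ly \<star>\<^bsub>t\<^esub> ?M)"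
    unfolding x(1) y(1) by (rule block_row_form[OF x(2,3) y(2,3) X J, symmetric])
  also have "\<dots> = E x Lx \<star>\<^bsub>t\<^esub> (?M \<star>\<^bsub>t\<^esub> ?K \<star>\<^bsub>t\<^esub> ht_adj ?M) \<star>\<^bsub>t\<^esub> ht_adj (E y Ly)"
    by (simp add: ht_adj_mult ht_assoc x(5,6) y(5,6))
  also have "\<dots> = E x Lx \<star>\<^bsub>t\<^esub> ?K \<star>\<^bsub>t\<^esub> ht_adj (E y Ly)" by (simp only: stein)
  also have "\<dots> = ht_scale_mat x ?c \<star>\<^bsub>t\<^esub> X \<star>\<^bsub>t\<^esub> ht_adj (ht_scale_mat y ?c') + ht_one_mat n \<star>\<^bsub>t\<^esub> J \<star>\<^bsub>t\<^esub> ht_adj (ht_one_mat n)"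
    unfolding E_def by (rule block_row_form[OF x(4) one y(4) one X J])
  also have "\<dots> = ?c \<star>\<^bsub>t\<^esub> X \<star>\<^bsub>t\<^esub> ht_adj ?c' + J"
    using xy by (simp add: ht_adj_scale ht_scale_left ht_scale_right mult.commute[of y x])
  finally have "R x Lx \<star>\<^bsub>t\<^esub> J \<star>\<^bsub>t\<^esub> ht_adj (R y Ly) = J"
    by (rule mat_add_left_cancel[where m = n and n = n])
      (use J RL[OF Lx] RL[OF Ly] in \<open>auto intro!: carrier_matI\<close>)
  then show ?thesis by (simp add: R_def)
qed

text \<open>
  P, Q, U, V are the blocks of the inverse of M. A similarity X between the systems (A, BJ, C) and
  (P*, U*, JQ*) satisfies three of the four block equations of M K = K (M^-1)*; the fourth one,
  DJ = JV*, is the equality of the two transfer functions at 0.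
\<close>

lemma stein_from_moments:
  assumes A: "A \<in> carrier_mat N N" and B: "B \<in> carrier_mat N n" and C: "C \<in> carrier_mat n N"
    and D: "D \<in> carrier_mat n n" and J: "J \<in> carrier_mat n n"
    and JJ: "J \<star>\<^bsub>t\<^esub> J = ht_one_mat n" and Jadj: "ht_adj J = J"
    and P: "P \<in> carrier_mat N N" and Q: "Q \<in> carrier_mat N n" and U: "U \<in> carrier_mat n N"
    and V: "V \<in> carrier_mat n n"
    and inv: "ht_is_inverse t (N + n) (four_block_mat A B C D) (four_block_mat P Q U V)"
    and L: "\<And>k. L k \<in> carrier_mat N n"
    and left: "ht_sum N N K (\<lambda>k. L k \<star>\<^bsub>t\<^esub> (C \<star>\<^bsub>t\<^esub> ht_mat_pow t A k)) = ht_one_mat N"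
    and W: "\<And>k. W k \<in> carrier_mat n N"
    and right: "ht_sum N N K' (\<lambda>k. ht_mat_pow t A k \<star>\<^bsub>t\<^esub> B \<star>\<^bsub>t\<^esub> W k) = ht_one_mat N"
    and DJ: "D \<star>\<^bsub>t\<^esub> J = J \<star>\<^bsub>t\<^esub> ht_adj V"
    and moments: "\<And>k. C \<star>\<^bsub>t\<^esub> ht_mat_pow t A k \<star>\<^bsub>t\<^esub> (B \<star>\<^bsub>t\<^esub> J) =
      J \<star>\<^bsub>t\<^esub> ht_adj Q \<star>\<^bsub>t\<^esub> ht_mat_pow t (ht_adj P) k \<star>\<^bsub>t\<^esub> ht_adj U"
  shows "\<exists>X Z. ht_is_inverse t N X Z \<and> ht_adj X = X \<and>
    four_block_mat A B C D \<star>\<^bsub>t\<^esub> four_block_mat X (0\<^sub>m N n) (0\<^sub>m n N) J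
      \<star>\<^bsub>t\<^esub> ht_adj (four_block_mat A B C D) = four_block_mat X (0\<^sub>m N n) (0\<^sub>m n N) J"
proof -
  let ?M = "four_block_mat A B C D" and ?I = "four_block_mat P Q U V"
  let ?K = "\<lambda>X. four_block_mat X (0\<^sub>m N n) (0\<^sub>m n N) J"
  have d [simp]: "dim_row A = N" "dim_col A = N" "dim_row B = N" "dim_col B = n" "dim_row C = n" "dim_col C = N"
    "dim_row D = n" "dim_col D = n" "dim_row J = n" "dim_col J = n"
    "dim_row P = N" "dim_col P = N" "dim_row Q = N" "dim_col Q = n"
    "dim_row U = n" "dim_col U = N" "dim_row V = n" "dim_col V = n"
    using A B C D J P Q U V by auto
  have dW [simp]: "dim_row (W k) = n" "dim_col (W k) = N" for k using W[of k] by auto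
  have JJX: "J \<star>\<^bsub>t\<^esub> (J \<star>\<^bsub>t\<^esub> Y) = Y" if "dim_row Y = n" for Y
  proof -
    have "J \<star>\<^bsub>t\<^esub> (J \<star>\<^bsub>t\<^esub> Y) = J \<star>\<^bsub>t\<^esub> J \<star>\<^bsub>t\<^esub> Y" using that by (simp add: ht_assoc)
    then show ?thesis using that by (simp add: JJ)
  qed
  have MI: "?M \<star>\<^bsub>t\<^esub> ?I = ht_one_mat (N + n)" "?I \<star>\<^bsub>t\<^esub> ?M = ht_one_mat (N + n)"
    using inv by (simp_all add: ht_is_inverse_def)
  have IM_adj: "ht_adj ?I \<star>\<^bsub>t\<^esub> ht_adj ?M = ht_one_mat (N + n)"
    "ht_adj ?M \<star>\<^bsub>t\<^esub> ht_adj ?I = ht_one_mat (N + n)"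
    by (simp_all add: ht_adj_mult[symmetric] MI)
  have "\<exists>X Z. ht_is_inverse t N X Z \<and> C \<star>\<^bsub>t\<^esub> X = J \<star>\<^bsub>t\<^esub> ht_adj Q \<and> A \<star>\<^bsub>t\<^esub> X = X \<star>\<^bsub>t\<^esub> ht_adj P \<and>
      B \<star>\<^bsub>t\<^esub> J = X \<star>\<^bsub>t\<^esub> ht_adj U"
  proof (rule state_space_similarity[OF A _ C _ _ _ L left _ _ moments])
    show "J \<star>\<^bsub>t\<^esub> W k \<in> carrier_mat n N" for k by (intro carrier_matI) simp_all
    have "ht_sum N N K' (\<lambda>k. ht_mat_pow t A k \<star>\<^bsub>t\<^esub> (B \<star>\<^bsub>t\<^esub> J) \<star>\<^bsub>t\<^esub> (J \<star>\<^bsub>t\<^esub> W k)) =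
        ht_sum N N K' (\<lambda>k. ht_mat_pow t A k \<star>\<^bsub>t\<^esub> B \<star>\<^bsub>t\<^esub> W k)"
      by (rule ht_sum_cong) (simp add: ht_assoc JJX)
    then show "ht_sum N N K' (\<lambda>k. ht_mat_pow t A k \<star>\<^bsub>t\<^esub> (B \<star>\<^bsub>t\<^esub> J) \<star>\<^bsub>t\<^esub> (J \<star>\<^bsub>t\<^esub> W k)) = ht_one_mat N"
      by (simp only: right)
  qed (intro carrier_matI; simp)+
  then obtain X Z where XZ: "ht_is_inverse t N X Z" and CX: "C \<star>\<^bsub>t\<^esub> X = J \<star>\<^bsub>t\<^esub> ht_adj Q"
    and AX: "A \<star>\<^bsub>t\<^esub> X = X \<star>\<^bsub>t\<^esub> ht_adj P" and BJ: "B \<star>\<^bsub>t\<^esub> J = X \<star>\<^bsub>t\<^esub> ht_adj U"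
    by blast
  have X: "X \<in> carrier_mat N N" using XZ by (simp add: ht_is_inverse_def)
  then have dX [simp]: "dim_row X = N" "dim_col X = N" by auto
  have adjI: "ht_adj ?I = four_block_mat (ht_adj P) (ht_adj U) (ht_adj Q) (ht_adj V)"
    by (rule ht_four_block_adj[OF P Q U V])
  have ca: "ht_adj P \<in> carrier_mat N N" "ht_adj U \<in> carrier_mat N n" "ht_adj Q \<in> carrier_mat n N"
    "ht_adj V \<in> carrier_mat n n" by (intro carrier_matI; simp)+
  have z: "0\<^sub>m N n \<in> carrier_mat N n" "0\<^sub>m n N \<in> carrier_mat n N" by simp_all
  have MK: "?M \<star>\<^bsub>t\<^esub> ?K Y = four_block_mat (A \<star>\<^bsub>t\<^esub> Y) (B \<star>\<^bsub>t\<^esub> J) (C \<star>\<^bsub>t\<^esub> Y) (D \<star>\<^bsub>t\<^esub> J)"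
    and KI: "?K Y \<star>\<^bsub>t\<^esub> ht_adj ?I = four_block_mat (Y \<star>\<^bsub>t\<^esub> ht_adj P) (Y \<star>\<^bsub>t\<^esub> ht_adj U)
      (J \<star>\<^bsub>t\<^esub> ht_adj Q) (J \<star>\<^bsub>t\<^esub> ht_adj V)"
    if Y: "Y \<in> carrier_mat N N" for Y
  proof -
    have dY: "dim_row Y = N" "dim_col Y = N" using Y by auto
    show "?M \<star>\<^bsub>t\<^esub> ?K Y = four_block_mat (A \<star>\<^bsub>t\<^esub> Y) (B \<star>\<^bsub>t\<^esub> J) (C \<star>\<^bsub>t\<^esub> Y) (D \<star>\<^bsub>t\<^esub> J)"
      unfolding ht_four_block_mult[OF A B C D Y z J]
      by (intro cong_four_block_mat eq_matI) (use dY in simp_all)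
    show "?K Y \<star>\<^bsub>t\<^esub> ht_adj ?I = four_block_mat (Y \<star>\<^bsub>t\<^esub> ht_adj P) (Y \<star>\<^bsub>t\<^esub> ht_adj U)
      (J \<star>\<^bsub>t\<^esub> ht_adj Q) (J \<star>\<^bsub>t\<^esub> ht_adj V)"
      unfolding adjI ht_four_block_mult[OF Y z J ca]
      by (intro cong_four_block_mat eq_matI) (use dY in simp_all)
  qed
  have eq: "?M \<star>\<^bsub>t\<^esub> ?K X = ?K X \<star>\<^bsub>t\<^esub> ht_adj ?I"
    by (simp only: MK[OF X] KI[OF X] AX BJ CX DJ)
  have stein: "?M \<star>\<^bsub>t\<^esub> ?K X \<star>\<^bsub>t\<^esub> ht_adj ?M = ?K X"
    unfolding eq by (subst ht_assoc) (simp_all add: IM_adj)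
  \<comment> \<open>the adjoint of the Stein equation is the Stein equation for the adjoint\<close>
  have Xa: "ht_adj X \<in> carrier_mat N N" by (intro carrier_matI) simp_all
  have adjK: "ht_adj (?K X) = ?K (ht_adj X)"
    by (simp add: ht_four_block_adj[OF X z J] Jadj)
  have "ht_adj (?M \<star>\<^bsub>t\<^esub> ?K X \<star>\<^bsub>t\<^esub> ht_adj ?M) = ?M \<star>\<^bsub>t\<^esub> ?K (ht_adj X) \<star>\<^bsub>t\<^esub> ht_adj ?M"
    by (simp add: ht_adj_mult adjK ht_assoc)
  then have stein': "?M \<star>\<^bsub>t\<^esub> ?K (ht_adj X) \<star>\<^bsub>t\<^esub> ht_adj ?M = ?K (ht_adj X)"
    by (simp only: stein adjK)
  have "?M \<star>\<^bsub>t\<^esub> ?K (ht_adj X) = ?M \<star>\<^bsub>t\<^esub> ?K (ht_adj X) \<star>\<^bsub>t\<^esub> (ht_adj ?M \<star>\<^bsub>t\<^esub> ht_adj ?I)"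
    by (simp add: IM_adj)
  also have "\<dots> = ?M \<star>\<^bsub>t\<^esub> ?K (ht_adj X) \<star>\<^bsub>t\<^esub> ht_adj ?M \<star>\<^bsub>t\<^esub> ht_adj ?I"
    by (simp add: ht_assoc)
  also have "\<dots> = ?K (ht_adj X) \<star>\<^bsub>t\<^esub> ht_adj ?I" by (simp only: stein')
  finally have "four_block_mat (A \<star>\<^bsub>t\<^esub> ht_adj X) (B \<star>\<^bsub>t\<^esub> J) (C \<star>\<^bsub>t\<^esub> ht_adj X) (D \<star>\<^bsub>t\<^esub> J) =
      four_block_mat (ht_adj X \<star>\<^bsub>t\<^esub> ht_adj P) (ht_adj X \<star>\<^bsub>t\<^esub> ht_adj U)
      (J \<star>\<^bsub>t\<^esub> ht_adj Q) (J \<star>\<^bsub>t\<^esub> ht_adj V)"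
    by (simp only: MK[OF Xa] KI[OF Xa])
  note blk = four_block_inject[OF _ _ _ _ _ _ _ _ this]
  have AX': "A \<star>\<^bsub>t\<^esub> ht_adj X = ht_adj X \<star>\<^bsub>t\<^esub> ht_adj P" and CX': "C \<star>\<^bsub>t\<^esub> ht_adj X = J \<star>\<^bsub>t\<^esub> ht_adj Q"
    by (rule blk[of N N n n]; intro carrier_matI; simp)+
  have "ht_adj X = X"
  proof (rule observability_cancel[OF A C L left Xa X])
    show "C \<star>\<^bsub>t\<^esub> ht_mat_pow t A k \<star>\<^bsub>t\<^esub> ht_adj X = C \<star>\<^bsub>t\<^esub> ht_mat_pow t A k \<star>\<^bsub>t\<^esub> X" for k
      using intertwine_moments[OF _ _ _ _ _ _ _ CX' AX', of N k]
        intertwine_moments[OF _ _ _ _ _ _ _ CX AX, of N k] by simp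
  qed
  with stein XZ show ?thesis by blast
qed

section \<open>The given function near a point and at infinity\<close>

lemma ht_tendsto_compose:
  assumes "ht_tendsto m n F M G" "filterlim g G H"
  shows "ht_tendsto m n (\<lambda>x. F (g x)) M H"
  using assms unfolding ht_tendsto_def
  by (auto intro: eventually_compose_filterlim filterlim_compose[of "\<lambda>x. F x $$ (_, _)"])

lemma ht_tendsto_entrywise_continuous:
  assumes S: "\<forall>\<^sub>F y in at x. y \<in> S" and x: "x \<in> S"
    and carr: "\<And>y. y \<in> S \<Longrightarrow> R y \<in> carrier_mat m n"
    and cont: "\<And>i k. i < m \<Longrightarrow> k < n \<Longrightarrow> continuous_on S (\<lambda>x. R x $$ (i, k))"
  shows "ht_tendsto m n R (R x) (at (x :: real))"
  unfolding ht_tendsto_def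
proof (intro conjI allI impI)
  show "R x \<in> carrier_mat m n" by (rule carr[OF x])
  show "\<forall>\<^sub>F y in at x. R y \<in> carrier_mat m n"
    using S by eventually_elim (rule carr)
  fix i k assume "i < m" "k < n"
  then have lim: "((\<lambda>y. R y $$ (i, k)) \<longlongrightarrow> R x $$ (i, k)) (at x within S)"
    using cont x by (simp add: continuous_on_def)
  show "((\<lambda>y. R y $$ (i, k)) \<longlongrightarrow> R x $$ (i, k)) (at x)"
  proof (rule tendstoI)
    fix e :: real assume "e > 0"
    with lim have "\<forall>\<^sub>F y in at x within S. dist (R y $$ (i, k)) (R x $$ (i, k)) < e"
      by (rule tendstoD)
    then have "\<forall>\<^sub>F y in nhds x. y \<noteq> x \<longrightarrow> y \<in> S \<longrightarrow> dist (R y $$ (i, k)) (R x $$ (i, k)) < e"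
      by (simp add: eventually_at_filter)
    moreover have "\<forall>\<^sub>F y in nhds x. y \<noteq> x \<longrightarrow> y \<in> S"
      using S by (simp add: eventually_at_filter)
    ultimately have "\<forall>\<^sub>F y in nhds x. y \<noteq> x \<longrightarrow> dist (R y $$ (i, k)) (R x $$ (i, k)) < e"
      by eventually_elim blast
    then show "\<forall>\<^sub>F y in at x. dist (R y $$ (i, k)) (R x $$ (i, k)) < e"
      by (simp add: eventually_at_filter)
  qed
qed

lemma eventually_at_avoid_finite:
  fixes x :: real
  assumes "finite F"
  shows "\<forall>\<^sub>F y in at x. y \<notin> F"
proof -
  have "\<forall>\<^sub>F y in nhds x. y \<in> - (F - {x})"
    by (intro eventually_nhds_in_open open_Compl finite_imp_closed finite_Diff assms) simp
  then have "\<forall>\<^sub>F y in nhds x. y \<noteq> x \<longrightarrow> y \<notin> F"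
    by eventually_elim blast
  then show ?thesis by (simp add: eventually_at_filter)
qed

text \<open>
  Real coordinates reduce the claim to scalar power series.
\<close>

lemma power_series_tendsto_0:
  fixes g :: "real \<Rightarrow> ht"
  assumes \<epsilon>: "\<epsilon> > 0" and g: "\<And>x. \<bar>x\<bar> < \<epsilon> \<Longrightarrow> (\<lambda>m. x ^ m *\<^sub>R c m) sums g x"
  shows "(g \<longlongrightarrow> g 0) (at 0)"
proof -
  have comp: "((\<lambda>x. inner (g x) b) \<longlongrightarrow> inner (c 0) b) (at 0)" for b
  proof (rule powser_limit_0[OF \<epsilon>, of "\<lambda>m. inner (c m) b"])
    fix x :: real assume "norm x < \<epsilon>"
    then have "(\<lambda>m. inner (x ^ m *\<^sub>R c m) b) sums inner (g x) b"
      by (intro bounded_linear.sums[OF bounded_linear_inner_left] g) simp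
    then show "(\<lambda>m. inner (c m) b * x ^ m) sums inner (g x) b" by (simp add: mult.commute)
  qed
  have "(\<lambda>m. (0::real) ^ m *\<^sub>R c m) sums (\<Sum>m\<in>{0}. 0 ^ m *\<^sub>R c m)"
    by (rule sums_finite) auto
  then have "g 0 = c 0" using g[of 0] \<epsilon> sums_unique2 by fastforce
  have "((\<lambda>x. \<Sum>b\<in>Basis. inner (g x) b *\<^sub>R b) \<longlongrightarrow> (\<Sum>b\<in>Basis. inner (c 0) b *\<^sub>R b)) (at 0)"
    by (intro tendsto_sum tendsto_scaleR comp tendsto_const)
  then show ?thesis by (simp add: euclidean_representation \<open>g 0 = c 0\<close>)
qed

text \<open>
  Q is the value at 0 of the analytic extension of R(1/x), reached through x = 1/y.
\<close>

lemma analytic_at_infinity_limit: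
  assumes A: "A \<in> carrier_mat N N"
    and real: "realization t n N S R A B C D"
    and inf: "analytic_invertible_at_infinity t n S R"
  obtains Q where "ht_invertible t n Q" and
    "ht_tendsto n n (\<lambda>y. D + ht_scale_mat y (C \<star>\<^bsub>t\<^esub> ht_inverse t N (pencil N A y) \<star>\<^bsub>t\<^esub> B)) Q at_infinity"
proof -
  let ?R = "\<lambda>y. D + ht_scale_mat y (C \<star>\<^bsub>t\<^esub> ht_inverse t N (pencil N A y) \<star>\<^bsub>t\<^esub> B)"
  obtain \<epsilon> G where \<epsilon>: "\<epsilon> > 0" and RG: "\<And>x. 0 < \<bar>x\<bar> \<Longrightarrow> \<bar>x\<bar> < \<epsilon> \<Longrightarrow> R (1 / x) = G x"
    and ser: "\<And>i k. i < n \<Longrightarrow> k < n \<Longrightarrow> \<exists>c. \<forall>x. \<bar>x\<bar> < \<epsilon> \<longrightarrow> (\<lambda>m. x ^ m *\<^sub>R c m) sums (G x $$ (i, k))"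
    and Q: "ht_invertible t n (G 0)"
    using inf unfolding analytic_invertible_at_infinity_def by blast
  have BCD: "B \<in> carrier_mat N n" "C \<in> carrier_mat n N" "D \<in> carrier_mat n n"
    and form: "\<And>y. ht_invertible t N (pencil N A y) \<Longrightarrow> R y = ?R y"
    using real by (auto simp: realization_def)
  have lim0: "((\<lambda>x. G x $$ (i, k)) \<longlongrightarrow> G 0 $$ (i, k)) (at 0)" if ik: "i < n" "k < n" for i k
  proof -
    obtain c where "\<And>x. \<bar>x\<bar> < \<epsilon> \<Longrightarrow> (\<lambda>m. x ^ m *\<^sub>R c m) sums (G x $$ (i, k))"
      using ser[OF ik] by blast
    then show ?thesis by (rule power_series_tendsto_0[OF \<epsilon>])
  qed
  have at0: "filterlim inverse (at 0) (at_infinity :: real filter)"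
    by (simp add: filterlim_inverse_at_iff filterlim_ident)
  have small: "\<forall>\<^sub>F x in at (0::real). 0 < \<bar>x\<bar> \<and> \<bar>x\<bar> < \<epsilon>"
    using \<epsilon> by (auto simp: eventually_at dist_real_def intro!: exI[of _ \<epsilon>])
  have ev: "\<forall>\<^sub>F y in at_infinity. G (inverse y) = ?R y \<and> ?R y \<in> carrier_mat n n"
    using eventually_compose_filterlim[OF small at0] eventually_pencil_inverse_at_infinity[OF A, of t]
  proof eventually_elim
    case (elim y)
    have "R y = G (inverse y)" using elim(1) RG[of "inverse y"] by (simp add: divide_inverse)
    moreover have "R y = ?R y" using elim(2) by (intro form) (auto simp: ht_invertible_def)
    moreover have "?R y \<in> carrier_mat n n"
      using BCD by (intro carrier_matI) auto
    ultimately show ?case by simp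
  qed
  have "ht_tendsto n n ?R (G 0) at_infinity"
    unfolding ht_tendsto_def
  proof (intro conjI allI impI)
    show "G 0 \<in> carrier_mat n n" using Q by (auto simp: ht_invertible_def ht_is_inverse_def)
    show "\<forall>\<^sub>F y in at_infinity. ?R y \<in> carrier_mat n n" using ev by eventually_elim blast
    fix i k assume ik: "i < n" "k < n"
    have "((\<lambda>y. G (inverse y) $$ (i, k)) \<longlongrightarrow> G 0 $$ (i, k)) at_infinity"
      by (rule filterlim_compose[OF lim0[OF ik] at0])
    moreover have "\<forall>\<^sub>F y in at_infinity. G (inverse y) $$ (i, k) = ?R y $$ (i, k)"
      using ev by eventually_elim simp
    ultimately show "((\<lambda>y. ?R y $$ (i, k)) \<longlongrightarrow> G 0 $$ (i, k)) at_infinity"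
      by (rule Lim_transform_eventually)
  qed
  with Q that show ?thesis by blast
qed

lemma transfer_vanishes_at_infinity:
  assumes A: "A \<in> carrier_mat N N" and B: "B \<in> carrier_mat N n" and C: "C \<in> carrier_mat n N"
    and D: "D \<in> carrier_mat n n"
    and lim: "ht_tendsto n n (\<lambda>y. D + ht_scale_mat y (C \<star>\<^bsub>t\<^esub> ht_inverse t N (pencil N A y) \<star>\<^bsub>t\<^esub> B)) Q at_infinity"
  shows "ht_tendsto n n (\<lambda>y. C \<star>\<^bsub>t\<^esub> ht_inverse t N (pencil N A y) \<star>\<^bsub>t\<^esub> B) (0\<^sub>m n n) at_infinity"
proof -
  let ?T = "\<lambda>y. C \<star>\<^bsub>t\<^esub> ht_inverse t N (pencil N A y) \<star>\<^bsub>t\<^esub> B"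
  have d [simp]: "dim_row B = N" "dim_col B = n" "dim_row C = n" "dim_col C = N" "dim_row D = n" "dim_col D = n"
    using B C D by auto
  let ?F = "\<lambda>y. ht_scale_mat (inverse y) (ht_scale_mat (- 1) D + (D + ht_scale_mat y (?T y)))"
  have "ht_tendsto n n ?F (ht_scale_mat 0 (ht_scale_mat (- 1) D + Q)) at_infinity"
    by (intro ht_tendsto_scale ht_tendsto_add[OF _ lim] ht_tendsto_const D tendsto_inverse_0 tendsto_const)
  moreover have "Q \<in> carrier_mat n n" using lim by (simp add: ht_tendsto_def)
  then have "ht_scale_mat 0 (ht_scale_mat (- 1) D + Q) = 0\<^sub>m n n" by (intro eq_matI) auto
  ultimately have F: "ht_tendsto n n ?F (0\<^sub>m n n) at_infinity" by simp
  have "\<forall>\<^sub>F y :: real in at_infinity. y \<noteq> 0"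
    by (rule eventually_at_infinityI[of 1]) auto
  then have "\<forall>\<^sub>F y in at_infinity. ?F y = ?T y"
    by eventually_elim (intro eq_matI, simp_all)
  with F show ?thesis by (rule ht_tendsto_cong)
qed

lemma pencil_adj: "A \<in> carrier_mat N N \<Longrightarrow> ht_adj (pencil N A x) = pencil N (ht_adj A) x"
  by (auto simp: pencil_def ht_adj_diff ht_adj_scale)

theorem theorem5p1:
  fixes t :: real and n N :: nat and J A B C D :: "ht mat"
    and S :: "real set" and R :: "real \<Rightarrow> ht mat"
  assumes "t \<noteq> 0"
    and "ht_invertible t n J" and "J = ht_adj J" and "J = ht_inverse t n J"
    and "rational_at_origin t n S R"
    and "minimal_realization t n N S R A B C D"
    and "analytic_invertible_at_infinity t n S R"
  shows "(\<forall>x. x \<noteq> 0 \<and> x \<in> S \<and> 1 / x \<in> S \<longrightarrow>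
            R x \<star>\<^bsub>t\<^esub> J \<star>\<^bsub>t\<^esub> ht_adj (R (1 / x)) = J)
     \<longleftrightarrow>
     (\<exists>H. ht_invertible t N H \<and> H = ht_adj H \<and>
          four_block_mat A B C D
            \<star>\<^bsub>t\<^esub> four_block_mat (ht_inverse t N H) (0\<^sub>m N n) (0\<^sub>m n N) J
            \<star>\<^bsub>t\<^esub> ht_adj (four_block_mat A B C D)
          = four_block_mat (ht_inverse t N H) (0\<^sub>m N n) (0\<^sub>m n N) J)"
    (is "?unitary \<longleftrightarrow> ?stein")
proof -
  let ?L = "\<lambda>y. ht_inverse t N (pencil N A y)"
  let ?R = "\<lambda>y. D + ht_scale_mat y (C \<star>\<^bsub>t\<^esub> ?L y \<star>\<^bsub>t\<^esub> B)"
  have real: "realization t n N S R A B C D" and obs: "observable t n N C A"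
    and ctrl: "controllable t n N A B"
    using assms(6) by (auto simp: minimal_realization_def)
  have A: "A \<in> carrier_mat N N" and B: "B \<in> carrier_mat N n" and C: "C \<in> carrier_mat n N"
    and D: "D \<in> carrier_mat n n"
    and form: "\<And>y. ht_invertible t N (pencil N A y) \<Longrightarrow> y \<in> S \<and> R y = ?R y"
    using real by (auto simp: realization_def)
  have d [simp]: "dim_row A = N" "dim_col A = N" "dim_row B = N" "dim_col B = n" "dim_row C = n" "dim_col C = N"
    "dim_row D = n" "dim_col D = n"
    using A B C D by auto
  have "ht_is_inverse t n J J"
    using ht_inverse_is_inverse[OF assms(2)] by (simp flip: assms(4))
  then have J: "J \<in> carrier_mat n n" and JJ: "J \<star>\<^bsub>t\<^esub> J = ht_one_mat n"
    by (simp_all add: ht_is_inverse_def)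
  then have dJ [simp]: "dim_row J = n" "dim_col J = n" by auto
  show ?thesis
  proof
    assume unitary: ?unitary
    obtain K L where L: "\<And>k. L k \<in> carrier_mat N n"
      and left: "ht_sum N N K (\<lambda>k. L k \<star>\<^bsub>t\<^esub> (C \<star>\<^bsub>t\<^esub> ht_mat_pow t A k)) = ht_one_mat N"
      using moments_left_inverse[OF assms(1) A C observable_moments[OF A C obs]] by blast
    obtain K' W where W: "\<And>k. W k \<in> carrier_mat n N"
      and right: "ht_sum N N K' (\<lambda>k. ht_mat_pow t A k \<star>\<^bsub>t\<^esub> B \<star>\<^bsub>t\<^esub> W k) = ht_one_mat N"
      using moments_right_inverse[OF assms(1) A B ctrl] by blast
    obtain Rinf where Rinf: "ht_invertible t n Rinf" and lim: "ht_tendsto n n ?R Rinf at_infinity"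
      using analytic_at_infinity_limit[OF A real assms(7)] by blast
    have res: "ht_tendsto N N ?L (0\<^sub>m N N) at_infinity"
      by (rule resolvent_vanishes_at_infinity[OF A B C L left W right
            transfer_vanishes_at_infinity[OF A B C D lim]])
    have "ht_invertible t (N + n) (four_block_mat A B C D)"
      by (rule system_matrix_invertible[OF A B C D])
        (use system_matrix_left_kernel[OF A B C D _ _ _ _ res lim Rinf] in blast)
    then obtain M' where M': "ht_is_inverse t (N + n) (four_block_mat A B C D) M'"
      by (auto simp: ht_invertible_def)
    obtain P Q U V where split: "split_block M' N N = (P, Q, U, V)" by (metis prod_cases4)
    have "dim_row M' = N + n" "dim_col M' = N + n" using M' by (auto simp: ht_is_inverse_def)
    note PQUV = split_block[OF split this]
    have inv: "ht_is_inverse t (N + n) (four_block_mat A B C D) (four_block_mat P Q U V)"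
      using M' PQUV(5) by simp
    have dP [simp]: "dim_row P = N" "dim_col P = N" "dim_row Q = N" "dim_col Q = n"
      "dim_row U = n" "dim_col U = N" "dim_row V = n" "dim_col V = n"
      using PQUV(1-4) by auto
    let ?L' = "\<lambda>w. ht_inverse t N (pencil N P w)"
    let ?T = "\<lambda>w. V + ht_scale_mat w (U \<star>\<^bsub>t\<^esub> ?L' w \<star>\<^bsub>t\<^esub> Q)"
    have nz: "\<forall>\<^sub>F w :: real in at 0. w \<noteq> 0" by (simp add: eventually_at_filter)
    \<comment> \<open>R(w) J = J (R(1/w)*)^-1, the inverse being given by the transfer function of M^-1\<close>
    have ev: "\<forall>\<^sub>F w in at 0. D \<star>\<^bsub>t\<^esub> J + ht_scale_mat w (C \<star>\<^bsub>t\<^esub> ?L w \<star>\<^bsub>t\<^esub> (B \<star>\<^bsub>t\<^esub> J)) =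
        J \<star>\<^bsub>t\<^esub> ht_adj V + ht_scale_mat w
          (J \<star>\<^bsub>t\<^esub> ht_adj Q \<star>\<^bsub>t\<^esub> ht_inverse t N (pencil N (ht_adj P) w) \<star>\<^bsub>t\<^esub> ht_adj U)"
      using nz eventually_pencil_inverse_at_0[OF A, of t]
        eventually_compose_filterlim[OF eventually_pencil_inverse_at_infinity[OF A, of t] filterlim_inverse_at_infinity]
        eventually_pencil_inverse_at_0[OF PQUV(1), of t]
    proof eventually_elim
      case (elim w)
      have dL [simp]: "dim_row (?L w) = N" "dim_col (?L w) = N" "dim_row (?L' w) = N" "dim_col (?L' w) = N"
        "dim_row (?L (1 / w)) = N" "dim_col (?L (1 / w)) = N"
        using elim(2,3,4) by (auto simp: ht_is_inverse_def inverse_eq_divide)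
      have Lw: "ht_is_inverse t N (pencil N A (1 / w)) (?L (1 / w))"
        using elim(3) by (simp add: inverse_eq_divide)
      have good: "w \<in> S \<and> R w = ?R w" "1 / w \<in> S \<and> R (1 / w) = ?R (1 / w)"
        using elim(2) Lw by (auto intro!: form simp: ht_invertible_def)
      have TR: "?T w \<star>\<^bsub>t\<^esub> ?R (1 / w) = ht_one_mat n"
        by (rule inverse_system[OF A B C D PQUV(1-4) _ _ Lw elim(4)])
          (use inv elim(1) in \<open>auto simp: ht_is_inverse_def\<close>)
      have "?R w \<star>\<^bsub>t\<^esub> J = ?R w \<star>\<^bsub>t\<^esub> J \<star>\<^bsub>t\<^esub> ht_adj (?T w \<star>\<^bsub>t\<^esub> ?R (1 / w))"
        by (simp add: TR)
      also have "\<dots> = ?R w \<star>\<^bsub>t\<^esub> J \<star>\<^bsub>t\<^esub> ht_adj (?R (1 / w)) \<star>\<^bsub>t\<^esub> ht_adj (?T w)"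
        by (subst ht_adj_mult, simp, rule ht_assoc[symmetric]) simp_all
      also have "?R w \<star>\<^bsub>t\<^esub> J \<star>\<^bsub>t\<^esub> ht_adj (?R (1 / w)) = J"
        using unitary elim(1) good by metis
      finally have RJ: "?R w \<star>\<^bsub>t\<^esub> J = J \<star>\<^bsub>t\<^esub> ht_adj (?T w)" .
      have "ht_is_inverse t N (pencil N (ht_adj P) w) (ht_adj (?L' w))"
        using ht_is_inverse_adj[OF elim(4)] pencil_adj[OF PQUV(1)] by simp
      then have LP: "ht_inverse t N (pencil N (ht_adj P) w) = ht_adj (?L' w)"
        by (rule ht_inverse_eq)
      show ?case
        using RJ unfolding LP
        by (simp add: ht_add_left ht_add_right ht_scale_left ht_scale_right ht_adj_add ht_adj_scale
            ht_adj_mult ht_assoc)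
    qed
    have carr: "B \<star>\<^bsub>t\<^esub> J \<in> carrier_mat N n" "D \<star>\<^bsub>t\<^esub> J \<in> carrier_mat n n"
      "ht_adj P \<in> carrier_mat N N" "ht_adj U \<in> carrier_mat N n" "J \<star>\<^bsub>t\<^esub> ht_adj Q \<in> carrier_mat n N"
      "J \<star>\<^bsub>t\<^esub> ht_adj V \<in> carrier_mat n n"
      by (intro carrier_matI; simp)+
    note markov = markov_parameters_unique[OF A carr(1) C carr(2) carr(3-6) ev]
    obtain X Z where XZ: "ht_is_inverse t N X Z" and Xadj: "ht_adj X = X"
      and stein: "four_block_mat A B C D \<star>\<^bsub>t\<^esub> four_block_mat X (0\<^sub>m N n) (0\<^sub>m n N) J
        \<star>\<^bsub>t\<^esub> ht_adj (four_block_mat A B C D) = four_block_mat X (0\<^sub>m N n) (0\<^sub>m n N) J"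
      using stein_from_moments[OF A B C D J JJ assms(3)[symmetric] PQUV(1-4) inv L left W right markov]
      by blast
    have ZX: "ht_is_inverse t N Z X" by (rule ht_is_inverse_sym[OF XZ])
    have "ht_is_inverse t N X (ht_adj Z)" using ht_is_inverse_adj[OF XZ] by (simp add: Xadj)
    then have "Z = ht_adj Z" by (rule ht_is_inverse_unique[OF XZ])
    moreover have "ht_inverse t N Z = X" by (rule ht_inverse_eq[OF ZX])
    ultimately show ?stein
      using stein ZX by (intro exI[of _ Z]) (auto simp: ht_invertible_def)
  next
    assume ?stein
    then obtain H where H: "ht_invertible t N H"
      and stein: "four_block_mat A B C D
            \<star>\<^bsub>t\<^esub> four_block_mat (ht_inverse t N H) (0\<^sub>m N n) (0\<^sub>m n N) J
            \<star>\<^bsub>t\<^esub> ht_adj (four_block_mat A B C D)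
          = four_block_mat (ht_inverse t N H) (0\<^sub>m N n) (0\<^sub>m n N) J" by blast
    have X: "ht_inverse t N H \<in> carrier_mat N N"
      using ht_inverse_is_inverse[OF H] by (simp add: ht_is_inverse_def)
    let ?good = "\<lambda>y. ht_invertible t N (pencil N A y)"
    have generic: "R y \<star>\<^bsub>t\<^esub> J \<star>\<^bsub>t\<^esub> ht_adj (R (inverse y)) = J" if "y \<noteq> 0" "?good y" "?good (inverse y)" for y
      using stein_imp_J_unitary[OF A B C D J X stein _ ht_inverse_is_inverse[OF that(2)]
          ht_inverse_is_inverse[OF that(3)]] form[OF that(2)] form[OF that(3)] that(1) by simp
    have fin: "finite {y. \<not> ?good y}" by (rule finite_singular_pencil[OF A])
    \<comment> \<open>the resolvent identity covers all but finitely many points; continuity of R covers the rest\<close>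
    have good_at: "\<forall>\<^sub>F y in at x. ?good y" for x
      using eventually_at_avoid_finite[OF fin] by simp
    have carrS: "R y \<in> carrier_mat n n" if "y \<in> S" for y
      using assms(5) that by (simp add: rational_at_origin_def)
    have limS: "ht_tendsto n n R (R x) (at x)" if "x \<in> S" for x
    proof (rule ht_tendsto_entrywise_continuous[OF _ that carrS])
      show "\<forall>\<^sub>F y in at x. y \<in> S" using good_at by eventually_elim (use form in blast)
      show "continuous_on S (\<lambda>x. R x $$ (i, k))" if "i < n" "k < n" for i k
        using assms(5) that by (simp add: rational_at_origin_def)
    qed
    show ?unitary
    proof (intro allI impI, elim conjE)
      fix x assume x: "x \<noteq> 0" "x \<in> S" "1 / x \<in> S"
      have "(inverse \<longlongrightarrow> inverse x) (at x)" by (intro tendsto_inverse tendsto_ident_at x)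
      moreover have "\<forall>\<^sub>F y in at x. inverse y \<noteq> inverse x"
        by (simp add: eventually_at_filter)
      ultimately have inv_at: "filterlim inverse (at (inverse x)) (at x)"
        by (simp add: filterlim_at)
      have "inverse x \<in> S" using x by (simp add: inverse_eq_divide)
      note lims = ht_tendsto_mult[OF limS[OF x(2)] ht_tendsto_const[OF J]]
        ht_tendsto_adj[OF ht_tendsto_compose[OF limS[OF this] inv_at]]
      have "ht_tendsto n n (\<lambda>y. R y \<star>\<^bsub>t\<^esub> J \<star>\<^bsub>t\<^esub> ht_adj (R (inverse y))) (R x \<star>\<^bsub>t\<^esub> J \<star>\<^bsub>t\<^esub> ht_adj (R (inverse x))) (at x)"
        by (rule ht_tendsto_mult[OF lims])
      moreover have "\<forall>\<^sub>F y in at x. R y \<star>\<^bsub>t\<^esub> J \<star>\<^bsub>t\<^esub> ht_adj (R (inverse y)) = J"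
        using good_at[of x] eventually_compose_filterlim[OF good_at inv_at]
          eventually_at_avoid_finite[of "{0}" x, simplified]
        by eventually_elim (use generic in auto)
      ultimately have "ht_tendsto n n (\<lambda>_. J) (R x \<star>\<^bsub>t\<^esub> J \<star>\<^bsub>t\<^esub> ht_adj (R (inverse x))) (at x)"
        by (rule ht_tendsto_cong)
      then have "R x \<star>\<^bsub>t\<^esub> J \<star>\<^bsub>t\<^esub> ht_adj (R (inverse x)) = J"
        by (rule ht_tendsto_unique[OF _ ht_tendsto_const[OF J]]) simp
      then show "R x \<star>\<^bsub>t\<^esub> J \<star>\<^bsub>t\<^esub> ht_adj (R (1 / x)) = J" by (simp add: inverse_eq_divide)
    qed
  qed
qed

end
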